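(* Assume the coefficient hypotheses stated in the context and let $S^\theta_{s,t}(x;y)$ be the common raw flow. Fix $(x,\theta,s,y)$ and write $q=Q(x)$, $Z_t=Z_t^{\theta,s,y}(x,q)$, $Y_t=S^\theta_{s,t}(x;y)$. For every $h\in C_0^{\mathrm{bv}}([0,T])$ (continuous finite-variation paths on $[0,T]$ starting at zero), the map $\varepsilon\mapsto S^\theta_{s,t}(x+\varepsilon h;y)$ is differentiable at $\varepsilon=0$, locally uniformly in $(\theta,s,t,y)$; denote the derivative by $D_hS^\theta_{s,t}(x;y)$. In Lamperti coordinates, the directional derivative $U=D_hZ$ is the unique solution of $$U_t=h_t-h_s+\int_s^t\widehat b_\theta'(Z_r)U_r\,dr+\int_s^t\widehat c_\theta'(Z_r)U_r\,dQ_r(x).$$ Moreover, $D_hS^\theta_{s,t}(x;y)=G_\theta'(Z_t)U_t$. Define the pathwise response kernel $$\mathcal K^\theta_{s,t}(r;x,y)=\sigma_\theta(Y_r)\,\partial_\xi S^\theta_{r,t}(x;\xi)\Big|_{\xi=Y_r},\qquad s\le r\le t.$$ Then $$D_hS^\theta_{s,t}(x;y)=\int_{(s,t]}\mathcal K^\theta_{s,t}(r;x,y)\,dh_r$$ and $$\sup_{\substack{x\in\Omega,\ \theta\in\Theta,\ y\in\mathbb R\\0\le s\le r\le t\le T}}|\mathcal K^\theta_{s,t}(r;x,y)|\le\overline\sigma C_*.$$ Consequently, $|D_hS^\theta_{s,t}(x;y)|\le\overline\sigma C_*\operatorname{Var}(h;[s,t])$.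
   Context: Fix $T,\Lambda>0$. $\Omega=C_0([0,T];\mathbb R)$ is the space of continuous real paths on $[0,T]$ starting at $0$, with the uniform topology. $\operatorname{Var}(h;[s,t])$ is the total variation of $h$ on $[s,t]$. Bracket functional. $\mathcal A_\Lambda=\{q\in C([0,T]):q_0=0,\ 0\le q_t-q_s\le\Lambda(t-s)\text{ for }s\le t\}$. With $t_k^n=kT2^{-n}$, put $V^n_t(x)=\sum_{k:\,t^n_{k+1}\le t}(x_{t^n_{k+1}}-x_{t^n_k})^2$; for nonnegative increasing $a$ with $a_0=0$ put $(\mathcal R_\Lambda a)_t=\inf_{0\le u\le t}\{a_u+\Lambda(t-u)\}$; $q^n(x)=\mathcal R_\Lambda V^n(x)$ and $Q_t(x)=\limsup_nq^n_t(x)$. One has $Q(x)\in\mathcal A_\Lambda$ for every $x\in\Omega$. Coefficient hypotheses. $\Theta\subset\mathbb R^d$ is compact; $\theta\mapsto(b_\theta,\sigma_\theta)$ is continuous from $\Theta$ into $C_b^2(\mathbb R)\times C_b^3(\mathbb R)$; and there are $L<\infty$, $0<\underline\sigma\le\overline\sigma<\infty$ with $\sup_{\theta}(\|b_\theta\|_{C_b^2}+\|\sigma_\theta\|_{C_b^3})\le L$ and $\underline\sigma\le\sigma_\theta(y)\le\overline\sigma$. Flow. $F_\theta(y)=\int_0^y dr/\sigma_\theta(r)$, $G_\theta=F_\theta^{-1}$, $\widehat b_\theta(z)=b_\theta(G_\theta(z))/\sigma_\theta(G_\theta(z))$, $\widehat c_\theta(z)=-\tfrac12\sigma_\theta'(G_\theta(z))$.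 For $x\in\Omega$, $q\in\mathcal A_\Lambda$, $0\le s\le T$, $y\in\mathbb R$, $Z=Z^{\theta,s,y}(x,q)$ is the unique continuous solution of $Z_t=F_\theta(y)+x_t-x_s+\int_s^t\widehat b_\theta(Z_r)\,dr+\int_s^t\widehat c_\theta(Z_r)\,dq_r$, $s\le t\le T$; $\Phi^\theta_{s,t}(x,q;y)=G_\theta(Z_t^{\theta,s,y}(x,q))$ and $S^\theta_{s,t}(x;y)=\Phi^\theta_{s,t}(x,Q(x);y)$. The map $y\mapsto\Phi^\theta_{s,t}(x,q;y)$ is $C^1$, and $C_*<\infty$ denotes a constant, depending only on $L,\underline\sigma,\overline\sigma,\Lambda,T$, such that $0<\partial_y\Phi^\theta_{s,t}(x,q;y)\le C_*$ for all $x\in\Omega$, $q\in\mathcal A_\Lambda$, $\theta\in\Theta$, $0\le s\le t\le T$, $y\in\mathbb R$ (such a constant exists). *)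

theory Defs
  imports "HOL-Analysis.Analysis"
begin

text \<open>
  Paths on \<open>[0,T]\<close> are represented by functions on the whole real line. All notions below only
  depend on their values on \<open>[0,T]\<close>.
\<close>

definition paths :: "real \<Rightarrow> (real \<Rightarrow> real) set" where
  "paths T = {x. continuous_on {0..T} x \<and> x 0 = 0}"


subsection \<open>Total variation and Stieltjes integrals\<close>

definition variation_sums :: "(real \<Rightarrow> real) \<Rightarrow> real \<Rightarrow> real \<Rightarrow> real set" where
  "variation_sums h s t =
     {(\<Sum>i<n. \<bar>h (u (Suc i)) - h (u i)\<bar>) | (n::nat) u.
        (\<forall>i\<le>n. u i \<in> {s..t}) \<and> (\<forall>i<n. u i \<le> u (Suc i))}"

definition Var :: "(real \<Rightarrow> real) \<Rightarrow> real \<Rightarrow> real \<Rightarrow> real" where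
  "Var h s t = Sup (variation_sums h s t)"

definition bv_paths :: "real \<Rightarrow> (real \<Rightarrow> real) set" where
  "bv_paths T = {h \<in> paths T. bdd_above (variation_sums h 0 T)}"

text \<open>
  \<^const>\<open>interval_measure\<close> expects a nondecreasing, right-continuous function on the whole line, so a
  function on \<open>[0,T]\<close> is extended by its endpoint values; the resulting measure lives on \<open>[0,T]\<close>.
\<close>

definition stieltjes_measure :: "real \<Rightarrow> (real \<Rightarrow> real) \<Rightarrow> real measure" where
  "stieltjes_measure T g = interval_measure (\<lambda>r. g (max 0 (min T r)))"

text \<open>
  For \<open>h\<close> of finite variation the signed measure \<open>dh\<close> is the difference of the Stieltjes measures of
  the two monotone functions of the Jordan decomposition.
\<close>

definition pos_var :: "(real \<Rightarrow> real) \<Rightarrow> real \<Rightarrow> real" where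
  "pos_var h r = (Var h 0 r + h r) / 2"

definition neg_var :: "(real \<Rightarrow> real) \<Rightarrow> real \<Rightarrow> real" where
  "neg_var h r = (Var h 0 r - h r) / 2"

definition bv_integrable_on ::
    "real \<Rightarrow> (real \<Rightarrow> real) \<Rightarrow> real set \<Rightarrow> (real \<Rightarrow> real) \<Rightarrow> bool" where
  "bv_integrable_on T h A f \<longleftrightarrow>
     set_integrable (stieltjes_measure T (pos_var h)) A f \<and>
     set_integrable (stieltjes_measure T (neg_var h)) A f"

definition bv_integral ::
    "real \<Rightarrow> (real \<Rightarrow> real) \<Rightarrow> real set \<Rightarrow> (real \<Rightarrow> real) \<Rightarrow> real" where
  "bv_integral T h A f =
     (LINT r:A|stieltjes_measure T (pos_var h). f r) -
     (LINT r:A|stieltjes_measure T (neg_var h). f r)"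


subsection \<open>The bracket functional\<close>

definition clocks :: "real \<Rightarrow> real \<Rightarrow> (real \<Rightarrow> real) set" where
  "clocks T \<Lambda> = {q. continuous_on {0..T} q \<and> q 0 = 0 \<and>
     (\<forall>s t. 0 \<le> s \<and> s \<le> t \<and> t \<le> T \<longrightarrow> 0 \<le> q t - q s \<and> q t - q s \<le> \<Lambda> * (t - s))}"

definition dyadic :: "real \<Rightarrow> nat \<Rightarrow> nat \<Rightarrow> real" where
  "dyadic T n k = real k * T / 2 ^ n"

definition dyadic_qv :: "real \<Rightarrow> nat \<Rightarrow> (real \<Rightarrow> real) \<Rightarrow> real \<Rightarrow> real" where
  "dyadic_qv T n x t =
     (\<Sum>k | dyadic T n (Suc k) \<le> t. (x (dyadic T n (Suc k)) - x (dyadic T n k))\<^sup>2)"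

definition regularise :: "real \<Rightarrow> (real \<Rightarrow> real) \<Rightarrow> real \<Rightarrow> real" where
  "regularise \<Lambda> a t = (INF u\<in>{0..t}. a u + \<Lambda> * (t - u))"

text \<open>
  The sequence under the \<open>limsup\<close> takes values in \<open>[0, \<Lambda> t]\<close>, so the conversion from
  \<^typ>\<open>ereal\<close> loses nothing.
\<close>

definition bracket :: "real \<Rightarrow> real \<Rightarrow> (real \<Rightarrow> real) \<Rightarrow> real \<Rightarrow> real" where
  "bracket T \<Lambda> x t =
     real_of_ereal (limsup (\<lambda>n. ereal (regularise \<Lambda> (dyadic_qv T n x) t)))"


subsection \<open>Coefficients\<close>

definition Cb :: "nat \<Rightarrow> (real \<Rightarrow> real) set" where
  "Cb k = {f. (\<forall>j<k. \<forall>y. (deriv ^^ j) f field_differentiable at y) \<and>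
     (\<forall>j\<le>k. continuous_on UNIV ((deriv ^^ j) f) \<and> bounded (range ((deriv ^^ j) f)))}"

definition Cb_norm :: "nat \<Rightarrow> (real \<Rightarrow> real) \<Rightarrow> real" where
  "Cb_norm k f = (\<Sum>j\<le>k. SUP y. \<bar>(deriv ^^ j) f y\<bar>)"

definition Cb_continuous_on ::
    "'p::topological_space set \<Rightarrow> nat \<Rightarrow> ('p \<Rightarrow> real \<Rightarrow> real) \<Rightarrow> bool" where
  "Cb_continuous_on \<Theta> k f \<longleftrightarrow> (\<forall>\<theta>\<in>\<Theta>. f \<theta> \<in> Cb k) \<and>
     (\<forall>\<theta>\<^sub>0\<in>\<Theta>. ((\<lambda>\<theta>. Cb_norm k (\<lambda>y. f \<theta> y - f \<theta>\<^sub>0 y)) \<longlongrightarrow> 0) (at \<theta>\<^sub>0 within \<Theta>))"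

definition coefficient_hypotheses ::
    "(real ^ 'd) set \<Rightarrow> (real ^ 'd \<Rightarrow> real \<Rightarrow> real) \<Rightarrow> (real ^ 'd \<Rightarrow> real \<Rightarrow> real) \<Rightarrow>
     real \<Rightarrow> real \<Rightarrow> real \<Rightarrow> bool" where
  "coefficient_hypotheses \<Theta> b \<sigma> L \<sigma>min \<sigma>max \<longleftrightarrow>
     compact \<Theta> \<and> Cb_continuous_on \<Theta> 2 b \<and> Cb_continuous_on \<Theta> 3 \<sigma> \<and>
     (\<forall>\<theta>\<in>\<Theta>. Cb_norm 2 (b \<theta>) + Cb_norm 3 (\<sigma> \<theta>) \<le> L) \<and>
     0 < \<sigma>min \<and> \<sigma>min \<le> \<sigma>max \<and> (\<forall>\<theta>\<in>\<Theta>. \<forall>y. \<sigma>min \<le> \<sigma> \<theta> y \<and> \<sigma> \<theta> y \<le> \<sigma>max)"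


subsection \<open>The flow\<close>

text \<open>Below, \<open>b\<close> and \<open>\<sigma>\<close> are the coefficients at one fixed parameter \<open>\<theta>\<close>.\<close>

definition lampF :: "(real \<Rightarrow> real) \<Rightarrow> real \<Rightarrow> real" where
  "lampF \<sigma> y = (LBINT r=0..y. 1 / \<sigma> r)"

definition lampG :: "(real \<Rightarrow> real) \<Rightarrow> real \<Rightarrow> real" where
  "lampG \<sigma> = inv (lampF \<sigma>)"

definition b_hat :: "(real \<Rightarrow> real) \<Rightarrow> (real \<Rightarrow> real) \<Rightarrow> real \<Rightarrow> real" where
  "b_hat b \<sigma> z = b (lampG \<sigma> z) / \<sigma> (lampG \<sigma> z)"

definition c_hat :: "(real \<Rightarrow> real) \<Rightarrow> real \<Rightarrow> real" where
  "c_hat \<sigma> z = - (1 / 2) * deriv \<sigma> (lampG \<sigma> z)"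

definition lamperti_solution ::
    "real \<Rightarrow> (real \<Rightarrow> real) \<Rightarrow> (real \<Rightarrow> real) \<Rightarrow> real \<Rightarrow> real \<Rightarrow> (real \<Rightarrow> real) \<Rightarrow> (real \<Rightarrow> real) \<Rightarrow>
     (real \<Rightarrow> real) \<Rightarrow> bool" where
  "lamperti_solution T b \<sigma> s y x q Z \<longleftrightarrow> continuous_on {s..T} Z \<and>
     (\<forall>t\<in>{s..T}. Z t = lampF \<sigma> y + x t - x s
        + (LBINT r=s..t. b_hat b \<sigma> (Z r))
        + (LINT r:{s<..t}|stieltjes_measure T q. c_hat \<sigma> (Z r)))"

text \<open>
  Extensionality (a fixed value outside \<open>[s,T]\<close>) makes the solution unique as a function on the real
  line.
\<close>

definition lampZ ::
    "real \<Rightarrow> (real \<Rightarrow> real) \<Rightarrow> (real \<Rightarrow> real) \<Rightarrow> real \<Rightarrow> real \<Rightarrow> (real \<Rightarrow> real) \<Rightarrow> (real \<Rightarrow> real) \<Rightarrow>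
     real \<Rightarrow> real" where
  "lampZ T b \<sigma> s y x q =
     (THE Z. Z \<in> extensional {s..T} \<and> lamperti_solution T b \<sigma> s y x q Z)"

definition flow ::
    "real \<Rightarrow> (real \<Rightarrow> real) \<Rightarrow> (real \<Rightarrow> real) \<Rightarrow> real \<Rightarrow> real \<Rightarrow> (real \<Rightarrow> real) \<Rightarrow> (real \<Rightarrow> real) \<Rightarrow>
     real \<Rightarrow> real" where
  "flow T b \<sigma> s t x q y = lampG \<sigma> (lampZ T b \<sigma> s y x q t)"

definition raw_flow ::
    "real \<Rightarrow> real \<Rightarrow> (real \<Rightarrow> real) \<Rightarrow> (real \<Rightarrow> real) \<Rightarrow> real \<Rightarrow> real \<Rightarrow> (real \<Rightarrow> real) \<Rightarrow>
     real \<Rightarrow> real" where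
  "raw_flow T \<Lambda> b \<sigma> s t x y = flow T b \<sigma> s t x (bracket T \<Lambda> x) y"

definition raw_Z ::
    "real \<Rightarrow> real \<Rightarrow> (real \<Rightarrow> real) \<Rightarrow> (real \<Rightarrow> real) \<Rightarrow> real \<Rightarrow> real \<Rightarrow> (real \<Rightarrow> real) \<Rightarrow>
     real \<Rightarrow> real" where
  "raw_Z T \<Lambda> b \<sigma> s t x y = lampZ T b \<sigma> s y x (bracket T \<Lambda> x) t"

definition flow_derivative_bound ::
    "real \<Rightarrow> real \<Rightarrow> (real ^ 'd) set \<Rightarrow> (real ^ 'd \<Rightarrow> real \<Rightarrow> real) \<Rightarrow>
     (real ^ 'd \<Rightarrow> real \<Rightarrow> real) \<Rightarrow> real \<Rightarrow> bool" where
  "flow_derivative_bound T \<Lambda> \<Theta> b \<sigma> C \<longleftrightarrow>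
     (\<forall>x\<in>paths T. \<forall>q\<in>clocks T \<Lambda>. \<forall>\<theta>\<in>\<Theta>. \<forall>s t y. 0 \<le> s \<and> s \<le> t \<and> t \<le> T \<longrightarrow>
        0 < deriv (flow T (b \<theta>) (\<sigma> \<theta>) s t x q) y \<and>
        deriv (flow T (b \<theta>) (\<sigma> \<theta>) s t x q) y \<le> C)"


subsection \<open>Directional derivatives and the response kernel\<close>

text \<open>The perturbation moves the bracket as well: it is evaluated at the perturbed path.\<close>

definition shift :: "(real \<Rightarrow> real) \<Rightarrow> (real \<Rightarrow> real) \<Rightarrow> real \<Rightarrow> real \<Rightarrow> real" where
  "shift x h \<epsilon> = (\<lambda>r. x r + \<epsilon> * h r)"

definition D_S ::
    "real \<Rightarrow> real \<Rightarrow> (real \<Rightarrow> real) \<Rightarrow> (real \<Rightarrow> real) \<Rightarrow> (real \<Rightarrow> real) \<Rightarrow> real \<Rightarrow> real \<Rightarrow>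
     (real \<Rightarrow> real) \<Rightarrow> real \<Rightarrow> real" where
  "D_S T \<Lambda> b \<sigma> h s t x y = deriv (\<lambda>\<epsilon>. raw_flow T \<Lambda> b \<sigma> s t (shift x h \<epsilon>) y) 0"

definition D_Z ::
    "real \<Rightarrow> real \<Rightarrow> (real \<Rightarrow> real) \<Rightarrow> (real \<Rightarrow> real) \<Rightarrow> (real \<Rightarrow> real) \<Rightarrow> real \<Rightarrow> real \<Rightarrow>
     (real \<Rightarrow> real) \<Rightarrow> real \<Rightarrow> real" where
  "D_Z T \<Lambda> b \<sigma> h s t x y = deriv (\<lambda>\<epsilon>. raw_Z T \<Lambda> b \<sigma> s t (shift x h \<epsilon>) y) 0"

definition linearised_solution ::
    "real \<Rightarrow> real \<Rightarrow> (real \<Rightarrow> real) \<Rightarrow> (real \<Rightarrow> real) \<Rightarrow> (real \<Rightarrow> real) \<Rightarrow> real \<Rightarrow> (real \<Rightarrow> real) \<Rightarrow>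
     real \<Rightarrow> (real \<Rightarrow> real) \<Rightarrow> bool" where
  "linearised_solution T \<Lambda> b \<sigma> h s x y U \<longleftrightarrow> continuous_on {s..T} U \<and>
     (\<forall>t\<in>{s..T}. U t = h t - h s
        + (LBINT r=s..t. deriv (b_hat b \<sigma>) (raw_Z T \<Lambda> b \<sigma> s r x y) * U r)
        + (LINT r:{s<..t}|stieltjes_measure T (bracket T \<Lambda> x).
             deriv (c_hat \<sigma>) (raw_Z T \<Lambda> b \<sigma> s r x y) * U r))"

definition response_kernel ::
    "real \<Rightarrow> real \<Rightarrow> (real \<Rightarrow> real) \<Rightarrow> (real \<Rightarrow> real) \<Rightarrow> real \<Rightarrow> real \<Rightarrow> real \<Rightarrow>
     (real \<Rightarrow> real) \<Rightarrow> real \<Rightarrow> real" where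
  "response_kernel T \<Lambda> b \<sigma> s t r x y =
     \<sigma> (raw_flow T \<Lambda> b \<sigma> s r x y) *
     deriv (\<lambda>\<xi>. raw_flow T \<Lambda> b \<sigma> r t x \<xi>) (raw_flow T \<Lambda> b \<sigma> s r x y)"

definition parameter_domain :: "real \<Rightarrow> 'p set \<Rightarrow> ('p \<times> real \<times> real \<times> real) set" where
  "parameter_domain T \<Theta> = {(\<theta>, s, t, y). \<theta> \<in> \<Theta> \<and> 0 \<le> s \<and> s \<le> t \<and> t \<le> T}"

definition locally_uniform_limit ::
    "'p::topological_space set \<Rightarrow> ('e \<Rightarrow> 'p \<Rightarrow> 'b::metric_space) \<Rightarrow> ('p \<Rightarrow> 'b) \<Rightarrow> 'e filter \<Rightarrow> bool" where
  "locally_uniform_limit P f l F \<longleftrightarrow>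
     (\<forall>p\<in>P. \<exists>N. open N \<and> p \<in> N \<and> uniform_limit (N \<inter> P) f l F)"

end

theory Submission
  imports Defs
begin

text \<open>
  A finite-variation perturbation does not change the bracket, so along \<open>x + \<epsilon> h\<close> the clock \<open>q = Q x\<close>
  stays frozen. As \<open>q\<close> is \<open>\<Lambda>\<close>-Lipschitz, \<open>dq = \<rho> dr\<close> with \<open>0 \<le> \<rho> \<le> \<Lambda>\<close>, and the Lamperti equation becomes
  a Volterra equation \<open>Z = g + \<integral> f r (Z r) dr\<close> whose right-hand side is \<open>C\<^sup>2\<close> in \<open>z\<close> with bounds depending
  on \<open>L, \<sigma>min, \<sigma>max, \<Lambda>\<close> only. Gronwall's inequality then gives a linearisation error \<open>O(\<epsilon>\<^sup>2)\<close> when \<open>g\<close> moves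
  to \<open>g + \<epsilon> k\<close>, uniformly in all parameters. The choice \<open>k = h - h s\<close> yields the directional derivative,
  and \<open>k = 1\<close> the derivative in the starting point. With \<open>E\<close> the exponential of the integrated linear
  coefficient, the former is \<open>\<integral> E t / E r dh\<^sub>r\<close> by Duhamel's formula, while the latter, started at time
  \<open>r\<close> from the current position, is \<open>E t / E r\<close>; this identifies the response kernel.
\<close>

subsection \<open>Functions of bounded variation\<close>

text \<open>Two obstacles shape the argument. The density \<rho> is only bounded and measurable, and
  the measure dh may be singular to Lebesgue measure, so neither the equation for \<open>E\<close>
  nor Duhamel's formula can be obtained by differentiating in time. Both are proved by showing that
  the defect of the integral equation has increments of higher order
  (\<open>eq_if_superlinear_increments\<close>). Moreover the linearised equation is unbounded in
  its unknown, so the bounds behind Picard iteration and linearisation do not cover it: its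
  solutions come from the explicit formula, and its uniqueness has a separate Gronwall argument. The
  signed measure dh is treated as a difference of two positive measures. Duhamel's formula is
  applied to each of them and needs their distribution functions to be continuous; this is why the
  continuity of the variation function is established first.\<close>

lemma variation_sumsI:
  assumes "\<And>i. i \<le> n \<Longrightarrow> u i \<in> {s..t}" "\<And>i. i < n \<Longrightarrow> u i \<le> u (Suc i)"
  shows "(\<Sum>i<n. \<bar>h (u (Suc i)) - h (u i)\<bar>) \<in> variation_sums h s t"
  using assms unfolding variation_sums_def by blast

lemma variation_sumsE:
  assumes "v \<in> variation_sums h s t"
  obtains n u where "\<And>i. i \<le> n \<Longrightarrow> u i \<in> {s..t}" "\<And>i. i < n \<Longrightarrow> u i \<le> u (Suc i)"
    "v = (\<Sum>i<n. \<bar>h (u (Suc i)) - h (u i)\<bar>)"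
proof -
  from assms obtain n u where "\<forall>i\<le>n. u i \<in> {s..t}" "\<forall>i<n. u i \<le> u (Suc i)"
    "v = (\<Sum>i<n. \<bar>h (u (Suc i)) - h (u i)\<bar>)"
    unfolding variation_sums_def by blast
  then show thesis using that[of n u] by blast
qed

lemma variation_sums_mono:
  assumes "a \<le> s" "t \<le> b"
  shows "variation_sums h s t \<subseteq> variation_sums h a b"
proof
  fix v assume v: "v \<in> variation_sums h s t"
  obtain n u where "\<And>i. i \<le> n \<Longrightarrow> u i \<in> {s..t}" "\<And>i. i < n \<Longrightarrow> u i \<le> u (Suc i)"
    "v = (\<Sum>i<n. \<bar>h (u (Suc i)) - h (u i)\<bar>)"
    using variation_sumsE[OF v] by metis
  then show "v \<in> variation_sums h a b"
    using assms by (auto intro!: variation_sumsI) force+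
qed

lemma diff_in_variation_sums:
  assumes "s \<le> t"
  shows "\<bar>h t - h s\<bar> \<in> variation_sums h s t"
  using variation_sumsI[of 1 "\<lambda>i. if i = 0 then s else t" s t h] assms by (auto split: if_splits)

lemma variation_sums_nonempty: "s \<le> t \<Longrightarrow> variation_sums h s t \<noteq> {}"
  using diff_in_variation_sums by blast

section \<open>Additivity and continuity of the variation function\<close>

context
  fixes h :: "real \<Rightarrow> real" and T :: real
  assumes bv: "bdd_above (variation_sums h 0 T)"
begin

lemma bdd_above_variation_sums: "0 \<le> s \<Longrightarrow> t \<le> T \<Longrightarrow> bdd_above (variation_sums h s t)"
  using bdd_above_mono[OF bv variation_sums_mono] .

lemma variation_sum_le_Var:
  "v \<in> variation_sums h s t \<Longrightarrow> 0 \<le> s \<Longrightarrow> t \<le> T \<Longrightarrow> v \<le> Var h s t"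
  unfolding Var_def by (intro cSup_upper bdd_above_variation_sums)

lemma abs_diff_le_Var: "0 \<le> s \<Longrightarrow> s \<le> t \<Longrightarrow> t \<le> T \<Longrightarrow> \<bar>h t - h s\<bar> \<le> Var h s t"
  by (intro variation_sum_le_Var diff_in_variation_sums)

text \<open>Partitions of the two halves concatenate to a partition of the whole; the two suprema
  are then taken one after the other.\<close>

lemma Var_add_le:
  assumes "0 \<le> a" "a \<le> s" "s \<le> c" "c \<le> T"
  shows "Var h a s + Var h s c \<le> Var h a c"
proof -
  have join: "v + w \<le> Var h a c"
    if v: "v \<in> variation_sums h a s" and w: "w \<in> variation_sums h s c" for v w
  proof -
    obtain n u where u: "\<And>i. i \<le> n \<Longrightarrow> u i \<in> {a..s}" "\<And>i. i < n \<Longrightarrow> u i \<le> u (Suc i)"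
      "v = (\<Sum>i<n. \<bar>h (u (Suc i)) - h (u i)\<bar>)"
      using variation_sumsE[OF v] by metis
    obtain m y where y: "\<And>i. i \<le> m \<Longrightarrow> y i \<in> {s..c}" "\<And>i. i < m \<Longrightarrow> y i \<le> y (Suc i)"
      "w = (\<Sum>i<m. \<bar>h (y (Suc i)) - h (y i)\<bar>)"
      using variation_sumsE[OF w] by metis
    \<comment> \<open>The shift by \<open>Suc n\<close> keeps both points at the junction: index
      \<open>n\<close> is the step from \<open>u n\<close> to \<open>y 0\<close>, which only adds a
      nonnegative term.\<close>
    define z where "z i = (if i \<le> n then u i else y (i - Suc n))" for i
    have *: "(\<Sum>i<Suc n + m. \<bar>h (z (Suc i)) - h (z i)\<bar>) \<in> variation_sums h a c"
    proof (rule variation_sumsI)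
      fix i assume i: "i \<le> Suc n + m"
      show "z i \<in> {a..c}"
      proof (cases "i \<le> n")
        case True
        then show ?thesis using u(1)[of i] assms by (auto simp: z_def)
      next
        case False
        then have "y (i - Suc n) \<in> {s..c}" using i by (intro y(1)) auto
        then show ?thesis using False assms by (auto simp: z_def)
      qed
    next
      fix i assume i: "i < Suc n + m"
      consider "i < n" | "i = n" | "i > n" by linarith
      then show "z i \<le> z (Suc i)"
      proof cases
        case 1
        then show ?thesis using u(2)[of i] by (simp add: z_def)
      next
        case 2
        then show ?thesis using u(1)[of n] y(1)[of 0] by (simp add: z_def)
      next
        case 3
        then have "Suc i - Suc n = Suc (i - Suc n)" by simp
        then show ?thesis using y(2)[of "i - Suc n"] 3 i by (simp add: z_def)
      qed
    qed
    have "v + w \<le> (\<Sum>i<Suc n + m. \<bar>h (z (Suc i)) - h (z i)\<bar>)"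
    proof -
      have eq: "{..<Suc n + m} = {..<n} \<union> {n} \<union> (\<lambda>i. Suc n + i) ` {..<m}"
      proof (intro set_eqI iffI)
        fix i assume i: "i \<in> {..<Suc n + m}"
        show "i \<in> {..<n} \<union> {n} \<union> (\<lambda>i. Suc n + i) ` {..<m}"
        proof (cases "i \<le> n")
          case False
          then have "i = Suc n + (i - Suc n)" "i - Suc n < m" using i by auto
          then show ?thesis by blast
        qed auto
      qed auto
      have "(\<Sum>i<Suc n + m. \<bar>h (z (Suc i)) - h (z i)\<bar>)
          = (\<Sum>i<n. \<bar>h (z (Suc i)) - h (z i)\<bar>) + \<bar>h (z (Suc n)) - h (z n)\<bar>
            + (\<Sum>i\<in>(\<lambda>i. Suc n + i) ` {..<m}. \<bar>h (z (Suc i)) - h (z i)\<bar>)"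
        unfolding eq by (subst sum.union_disjoint; force)+
      also have "(\<Sum>i<n. \<bar>h (z (Suc i)) - h (z i)\<bar>) = v"
        unfolding u(3) by (rule sum.cong) (auto simp: z_def)
      also have "(\<Sum>i\<in>(\<lambda>i. Suc n + i) ` {..<m}. \<bar>h (z (Suc i)) - h (z i)\<bar>) = w"
        unfolding y(3) by (subst sum.reindex) (auto simp: z_def intro: inj_onI)
      finally show ?thesis by simp
    qed
    also have "\<dots> \<le> Var h a c" using * assms by (intro variation_sum_le_Var) auto
    finally show ?thesis .
  qed
  have "Var h s c \<le> Var h a c - v" if v: "v \<in> variation_sums h a s" for v
    unfolding Var_def[of h s c]
    using join[OF v] assms by (intro cSup_least variation_sums_nonempty) (auto simp: algebra_simps)
  then have "v \<le> Var h a c - Var h s c" if "v \<in> variation_sums h a s" for v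
    using that by force
  then have "Var h a s \<le> Var h a c - Var h s c"
    unfolding Var_def[of h a s] using assms by (intro cSup_least variation_sums_nonempty) auto
  then show ?thesis by simp
qed

text \<open>
  Clipping a partition at \<open>s\<close> from above and from below splits each of its increments into two.
\<close>
lemma Var_le_add:
  assumes "0 \<le> a" "a \<le> s" "s \<le> c" "c \<le> T"
  shows "Var h a c \<le> Var h a s + Var h s c"
proof -
  have "v \<le> Var h a s + Var h s c" if v: "v \<in> variation_sums h a c" for v
  proof -
    obtain n u where u: "\<And>i. i \<le> n \<Longrightarrow> u i \<in> {a..c}" "\<And>i. i < n \<Longrightarrow> u i \<le> u (Suc i)"
      "v = (\<Sum>i<n. \<bar>h (u (Suc i)) - h (u i)\<bar>)"
      using variation_sumsE[OF v] by metis
    have "(\<Sum>i<n. \<bar>h (min (u (Suc i)) s) - h (min (u i) s)\<bar>) \<in> variation_sums h a s"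
      using u(1) assms by (intro variation_sumsI min.mono u(2)) auto
    moreover have "(\<Sum>i<n. \<bar>h (max (u (Suc i)) s) - h (max (u i) s)\<bar>) \<in> variation_sums h s c"
      using u(1) assms by (intro variation_sumsI max.mono u(2)) auto
    moreover have "v \<le> (\<Sum>i<n. \<bar>h (min (u (Suc i)) s) - h (min (u i) s)\<bar>)
        + (\<Sum>i<n. \<bar>h (max (u (Suc i)) s) - h (max (u i) s)\<bar>)"
      unfolding u(3) sum.distrib[symmetric]
    proof (rule sum_mono)
      fix i assume "i \<in> {..<n}"
      then have "u i \<le> u (Suc i)" using u(2) by auto
      then show "\<bar>h (u (Suc i)) - h (u i)\<bar> \<le> \<bar>h (min (u (Suc i)) s) - h (min (u i) s)\<bar>
          + \<bar>h (max (u (Suc i)) s) - h (max (u i) s)\<bar>"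
        unfolding min_def max_def by auto
    qed
    ultimately show ?thesis
      using variation_sum_le_Var[of _ a s] variation_sum_le_Var[of _ s c] assms
      by (smt (verit, best))
  qed
  then show ?thesis
    unfolding Var_def[of h a c] using assms by (intro cSup_least variation_sums_nonempty) auto
qed

lemma Var_diff:
  assumes "0 \<le> s" "s \<le> t" "t \<le> T"
  shows "Var h 0 t - Var h 0 s = Var h s t"
  using Var_add_le[of 0 s t] Var_le_add[of 0 s t] assms by auto

text \<open>
  The variation is lower semicontinuous: a partition of \<open>[s,T]\<close> clipped at \<open>t \<down> s\<close> is a partition
  of \<open>[t,T]\<close> whose variation sum converges to the original one.
\<close>
lemma Var_right_continuous:
  assumes cont: "continuous_on {0..T} h" and s: "0 \<le> s" "s < T"
  shows "((\<lambda>t. Var h 0 t) \<longlongrightarrow> Var h 0 s) (at_right s)"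
proof -
  have near: "\<forall>\<^sub>F t in at_right s. s < t \<and> t < T"
    using s(2) eventually_at_right_less[of s] eventually_at_right_field by fastforce
  have "\<forall>\<^sub>F t in at_right s. \<bar>Var h 0 t - Var h 0 s\<bar> < e" if "e > 0" for e
  proof -
    obtain v where v: "v \<in> variation_sums h s T" "Var h s T - e < v"
      using less_cSup_iff[of "variation_sums h s T" "Var h s T - e"] \<open>e > 0\<close> s
        variation_sums_nonempty[of s T h] bdd_above_variation_sums[of s T]
      unfolding Var_def by auto
    obtain n u where u: "\<And>i. i \<le> n \<Longrightarrow> u i \<in> {s..T}" "\<And>i. i < n \<Longrightarrow> u i \<le> u (Suc i)"
      "v = (\<Sum>i<n. \<bar>h (u (Suc i)) - h (u i)\<bar>)"
      using variation_sumsE[OF v(1)] by metis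
    have lim1: "((\<lambda>t. h (max (u i) t)) \<longlongrightarrow> h (u i)) (at_right s)" if "i \<le> n" for i
    proof (rule continuous_on_tendsto_compose[OF cont])
      have "((\<lambda>t. max (u i) t) \<longlongrightarrow> max (u i) s) (at_right s)"
        by (intro tendsto_intros)
      then show "((\<lambda>t. max (u i) t) \<longlongrightarrow> u i) (at_right s)"
        using u(1)[OF that] by (simp add: max_absorb1)
      show "u i \<in> {0..T}" using u(1)[OF that] s by auto
      show "\<forall>\<^sub>F t in at_right s. max (u i) t \<in> {0..T}"
        using near by eventually_elim (use u(1)[OF that] s in auto)
    qed
    have "((\<lambda>t. \<Sum>i<n. \<bar>h (max (u (Suc i)) t) - h (max (u i) t)\<bar>) \<longlongrightarrow> v) (at_right s)"
      unfolding u(3) by (intro tendsto_sum tendsto_rabs tendsto_diff lim1) auto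
    then have "\<forall>\<^sub>F t in at_right s. Var h s T - e < (\<Sum>i<n. \<bar>h (max (u (Suc i)) t) - h (max (u i) t)\<bar>)"
      using v(2) order_tendstoD(1) by blast
    then show ?thesis
      using near
    proof eventually_elim
      case (elim t)
      have "(\<Sum>i<n. \<bar>h (max (u (Suc i)) t) - h (max (u i) t)\<bar>) \<in> variation_sums h t T"
        using u(1) elim by (intro variation_sumsI max.mono u(2)) auto
      then have "Var h s T - e < Var h t T"
        using variation_sum_le_Var[of _ t T] elim s by fastforce
      \<comment> \<open>The near-optimal sum for \<open>[s,T]\<close> is almost recovered on
        \<open>[t,T]\<close>, so superadditivity leaves less than \<open>e\<close> for
        \<open>[s,t]\<close>.\<close>
      moreover have "Var h s t + Var h t T \<le> Var h s T"
        using elim s by (intro Var_add_le) auto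
      moreover have "Var h s t \<ge> 0"
        using abs_diff_le_Var[of s t] elim s by auto
      ultimately show ?case using Var_diff[of s t] elim s by auto
    qed
  qed
  then show ?thesis by (simp add: tendsto_iff dist_real_def)
qed

text \<open>Mirror image of the previous argument: a near-optimal partition of \<open>[0,s]\<close>,
  clipped from above at t tending to s from below, is a partition of \<open>[0,t]\<close> with
  almost the same sum.\<close>

lemma Var_left_continuous:
  assumes cont: "continuous_on {0..T} h" and s: "0 < s" "s \<le> T"
  shows "((\<lambda>t. Var h 0 t) \<longlongrightarrow> Var h 0 s) (at_left s)"
proof -
  have near: "\<forall>\<^sub>F t in at_left s. 0 < t \<and> t < s"
    unfolding eventually_at_left_field using s(1) by blast
  have "\<forall>\<^sub>F t in at_left s. \<bar>Var h 0 t - Var h 0 s\<bar> < e" if "e > 0" for e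
  proof -
    obtain v where v: "v \<in> variation_sums h 0 s" "Var h 0 s - e < v"
      using less_cSup_iff[of "variation_sums h 0 s" "Var h 0 s - e"] \<open>e > 0\<close> s
        variation_sums_nonempty[of 0 s h] bdd_above_variation_sums[of 0 s]
      unfolding Var_def by auto
    obtain n u where u: "\<And>i. i \<le> n \<Longrightarrow> u i \<in> {0..s}" "\<And>i. i < n \<Longrightarrow> u i \<le> u (Suc i)"
      "v = (\<Sum>i<n. \<bar>h (u (Suc i)) - h (u i)\<bar>)"
      using variation_sumsE[OF v(1)] by metis
    have lim1: "((\<lambda>t. h (min (u i) t)) \<longlongrightarrow> h (u i)) (at_left s)" if "i \<le> n" for i
    proof (rule continuous_on_tendsto_compose[OF cont])
      have "((\<lambda>t. min (u i) t) \<longlongrightarrow> min (u i) s) (at_left s)"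
        by (intro tendsto_intros)
      then show "((\<lambda>t. min (u i) t) \<longlongrightarrow> u i) (at_left s)"
        using u(1)[OF that] by (simp add: min_absorb1)
      show "u i \<in> {0..T}" using u(1)[OF that] s by auto
      show "\<forall>\<^sub>F t in at_left s. min (u i) t \<in> {0..T}"
        using near by eventually_elim (use u(1)[OF that] s in auto)
    qed
    have "((\<lambda>t. \<Sum>i<n. \<bar>h (min (u (Suc i)) t) - h (min (u i) t)\<bar>) \<longlongrightarrow> v) (at_left s)"
      unfolding u(3) by (intro tendsto_sum tendsto_rabs tendsto_diff lim1) auto
    then have "\<forall>\<^sub>F t in at_left s. Var h 0 s - e < (\<Sum>i<n. \<bar>h (min (u (Suc i)) t) - h (min (u i) t)\<bar>)"
      using v(2) order_tendstoD(1) by blast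
    then show ?thesis
      using near
    proof eventually_elim
      case (elim t)
      have "(\<Sum>i<n. \<bar>h (min (u (Suc i)) t) - h (min (u i) t)\<bar>) \<in> variation_sums h 0 t"
        using u(1) elim by (intro variation_sumsI min.mono u(2)) auto
      then have "Var h 0 s - e < Var h 0 t"
        using variation_sum_le_Var[of _ 0 t] elim s by fastforce
      moreover have "Var h t s \<ge> 0"
        using abs_diff_le_Var[of t s] elim s by auto
      ultimately show ?case using Var_diff[of t s] elim s by auto
    qed
  qed
  then show ?thesis by (simp add: tendsto_iff dist_real_def)
qed

lemma continuous_on_Var:
  assumes "continuous_on {0..T} h"
  shows "continuous_on {0..T} (Var h 0)"
  unfolding continuous_on_def
proof
  fix s assume s: "s \<in> {0..T}"
  \<comment> \<open>At an endpoint of \<open>{0..T}\<close> one of the two one-sided intervals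
    collapses to \<open>{s}\<close>, where the filter is trivial.\<close>
  have triv: "(Var h 0 \<longlongrightarrow> Var h 0 s) (at s within {s})"
    by (simp add: at_within_def)
  have "(Var h 0 \<longlongrightarrow> Var h 0 s) (at s within {s..T})"
    using Var_right_continuous[OF assms, of s] s triv
    by (cases "s < T") (auto simp: at_within_Icc_at_right)
  moreover have "(Var h 0 \<longlongrightarrow> Var h 0 s) (at s within {0..s})"
    using Var_left_continuous[OF assms, of s] s triv
    by (cases "0 < s") (auto simp: at_within_Icc_at_left)
  ultimately have "(Var h 0 \<longlongrightarrow> Var h 0 s) (at s within {0..s} \<union> {s..T})"
    by (simp add: at_within_union filterlim_sup)
  then show "(Var h 0 \<longlongrightarrow> Var h 0 s) (at s within {0..T})"
    using s by (simp add: ivl_disj_un_two_touch)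
qed

end

text \<open>Monotonicity is the estimate of an increment of \<open>h\<close> by its variation. The
  last identity says that the two Jordan measures add up to the variation measure, the source of
  \<open>Var h s t\<close> in the final bound.\<close>

lemma jordan_decomposition:
  assumes T: "0 \<le> T" and h: "h \<in> bv_paths T"
  shows "continuous_on {0..T} (pos_var h)" "continuous_on {0..T} (neg_var h)"
    "\<And>r s. 0 \<le> r \<Longrightarrow> r \<le> s \<Longrightarrow> s \<le> T \<Longrightarrow> pos_var h r \<le> pos_var h s"
    "\<And>r s. 0 \<le> r \<Longrightarrow> r \<le> s \<Longrightarrow> s \<le> T \<Longrightarrow> neg_var h r \<le> neg_var h s"
    "\<And>r s. 0 \<le> r \<Longrightarrow> r \<le> s \<Longrightarrow> s \<le> T \<Longrightarrow>
      (pos_var h s - pos_var h r) + (neg_var h s - neg_var h r) = Var h r s"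
proof -
  have c: "continuous_on {0..T} h" and bv: "bdd_above (variation_sums h 0 T)"
    using h by (auto simp: bv_paths_def paths_def)
  show "continuous_on {0..T} (pos_var h)" "continuous_on {0..T} (neg_var h)"
    unfolding pos_var_def[abs_def] neg_var_def[abs_def]
    by (intro continuous_intros c continuous_on_Var[OF bv c]; simp)+
  fix r s assume rs: "0 \<le> r" "r \<le> s" "s \<le> T"
  show "pos_var h r \<le> pos_var h s" "neg_var h r \<le> neg_var h s"
    "(pos_var h s - pos_var h r) + (neg_var h s - neg_var h r) = Var h r s"
    using abs_diff_le_Var[OF bv rs] Var_diff[OF bv rs]
    unfolding pos_var_def neg_var_def by (auto simp: field_simps)
qed

lemma pos_var_minus_neg_var: "pos_var h r - neg_var h r = h r"
  by (simp add: pos_var_def neg_var_def field_simps)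

subsection \<open>The bracket functional\<close>

text \<open>The index set of \<open>dyadic_qv\<close> is not visibly finite, and a sum over an
  infinite set would be 0 by convention.\<close>

lemma dyadic_le_subset:
  assumes "T > 0" "t \<le> T"
  shows "{k. dyadic T n (Suc k) \<le> t} \<subseteq> {..<2 ^ n}"
proof
  fix k assume "k \<in> {k. dyadic T n (Suc k) \<le> t}"
  then have "real (Suc k) * T / 2 ^ n \<le> T" using assms by (simp add: dyadic_def)
  then have "real (Suc k) * T \<le> 2 ^ n * T" by (simp add: field_simps)
  then have "real (Suc k) \<le> 2 ^ n" using assms(1) by (rule mult_right_le_imp_le)
  then have "Suc k \<le> 2 ^ n" by (metis of_nat_le_iff of_nat_numeral of_nat_power)
  then show "k \<in> {..<2 ^ n}" by auto
qed

lemma dyadic_qv_mono: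
  assumes "T > 0" "s \<le> t" "t \<le> T"
  shows "dyadic_qv T n x s \<le> dyadic_qv T n x t"
  unfolding dyadic_qv_def
  using assms finite_subset[OF dyadic_le_subset[of T t n]]
  by (intro sum_mono2) auto

lemma dyadic_qv_nonneg: "0 \<le> dyadic_qv T n x t"
  unfolding dyadic_qv_def by (intro sum_nonneg) auto

lemma dyadic_qv_0:
  assumes "T > 0"
  shows "dyadic_qv T n x 0 = 0"
proof -
  have "{k. dyadic T n (Suc k) \<le> 0} = {}"
    using assms by (auto simp: dyadic_def not_le)
  then show ?thesis by (simp add: dyadic_qv_def)
qed

section \<open>The Lipschitz regularisation of an increasing path\<close>

context
  fixes \<Lambda> T :: real and a :: "real \<Rightarrow> real"
  assumes \<Lambda>: "\<Lambda> > 0" and a_nonneg: "\<And>t. 0 \<le> a t" and a_0: "a 0 = 0"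
begin

lemma bdd_below_regularise: "bdd_below ((\<lambda>u. a u + \<Lambda> * (t - u)) ` {0..t})"
  using \<Lambda> a_nonneg by (intro bdd_belowI2[of _ 0]) auto

lemma regularise_le: "u \<in> {0..t} \<Longrightarrow> regularise \<Lambda> a t \<le> a u + \<Lambda> * (t - u)"
  unfolding regularise_def by (intro cINF_lower bdd_below_regularise)

lemma regularise_ge:
  "0 \<le> t \<Longrightarrow> (\<And>u. u \<in> {0..t} \<Longrightarrow> m \<le> a u + \<Lambda> * (t - u)) \<Longrightarrow> m \<le> regularise \<Lambda> a t"
  unfolding regularise_def by (intro cINF_greatest) auto

lemma regularise_bounds:
  assumes "0 \<le> t"
  shows "0 \<le> regularise \<Lambda> a t" "regularise \<Lambda> a t \<le> \<Lambda> * t"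
  using regularise_le[of 0 t] regularise_ge[of t 0] \<Lambda> a_nonneg a_0 assms by auto

text \<open>Every competitor \<open>u\<close> for time \<open>s\<close> is one for time
  \<open>t\<close> as well, at the extra cost \<open>\<Lambda> * (t - s)\<close>.\<close>

lemma regularise_Lipschitz:
  assumes "0 \<le> s" "s \<le> t"
  shows "regularise \<Lambda> a t \<le> regularise \<Lambda> a s + \<Lambda> * (t - s)"
proof -
  have "regularise \<Lambda> a t - \<Lambda> * (t - s) \<le> regularise \<Lambda> a s"
  proof (rule regularise_ge)
    fix u assume "u \<in> {0..s}"
    then have "regularise \<Lambda> a t \<le> a u + \<Lambda> * (t - u)" using assms by (intro regularise_le) auto
    then show "regularise \<Lambda> a t - \<Lambda> * (t - s) \<le> a u + \<Lambda> * (s - u)" by (simp add: algebra_simps)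
  qed (use assms in auto)
  then show ?thesis by simp
qed

text \<open>A competitor \<open>u \<le> s\<close> for time \<open>t\<close> is cheaper at time
  \<open>s\<close>; one beyond \<open>s\<close> is replaced by \<open>s\<close> itself, using that
  \<open>a\<close> increases.\<close>

lemma regularise_mono:
  assumes mono: "\<And>u v. 0 \<le> u \<Longrightarrow> u \<le> v \<Longrightarrow> v \<le> T \<Longrightarrow> a u \<le> a v"
    and "0 \<le> s" "s \<le> t" "t \<le> T"
  shows "regularise \<Lambda> a s \<le> regularise \<Lambda> a t"
proof (rule regularise_ge)
  fix u assume u: "u \<in> {0..t}"
  show "regularise \<Lambda> a s \<le> a u + \<Lambda> * (t - u)"
  proof (cases "u \<le> s")
    case True
    then have "regularise \<Lambda> a s \<le> a u + \<Lambda> * (s - u)" using u by (intro regularise_le) auto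
    also have "\<dots> \<le> a u + \<Lambda> * (t - u)" using \<Lambda> assms by auto
    finally show ?thesis .
  next
    case False
    have "regularise \<Lambda> a s \<le> a s" using regularise_le[of s s] assms by auto
    also have "\<dots> \<le> a u + \<Lambda> * (t - u)"
      using mono[of s u] False u assms \<Lambda> by (smt (verit) atLeastAtMost_iff mult_nonneg_nonneg)
    finally show ?thesis .
  qed
qed (use assms in auto)

end

text \<open>An infimum is 1-Lipschitz in its data for the sup norm. This carries estimates on the
  dyadic sums over to their regularisations.\<close>

lemma regularise_close:
  assumes "\<Lambda> > 0" "0 \<le> t" "\<And>u. 0 \<le> a u" "\<And>u. 0 \<le> a' u"
    and "\<And>u. u \<in> {0..t} \<Longrightarrow> \<bar>a u - a' u\<bar> \<le> d"
    and "a 0 = 0" "a' 0 = 0"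
  shows "\<bar>regularise \<Lambda> a t - regularise \<Lambda> a' t\<bar> \<le> d"
proof -
  have "regularise \<Lambda> a t - d \<le> regularise \<Lambda> a' t"
  proof (rule regularise_ge)
    fix u assume "u \<in> {0..t}"
    then show "regularise \<Lambda> a t - d \<le> a' u + \<Lambda> * (t - u)"
      using regularise_le[of \<Lambda> a u t] assms by (smt (verit, best))
  qed (use assms in auto)
  moreover have "regularise \<Lambda> a' t - d \<le> regularise \<Lambda> a t"
  proof (rule regularise_ge)
    fix u assume "u \<in> {0..t}"
    then show "regularise \<Lambda> a' t - d \<le> a u + \<Lambda> * (t - u)"
      using regularise_le[of \<Lambda> a' u t] assms by (smt (verit, best))
  qed (use assms in auto)
  ultimately show ?thesis by linarith
qed

text \<open>Keeps the limsup away from the infinities, where \<open>real_of_ereal\<close> returns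
  the default 0.\<close>

lemma limsup_ereal_bounded:
  fixes X :: "nat \<Rightarrow> real"
  assumes "\<And>n. X n \<in> {l..u}"
  obtains m where "limsup (\<lambda>n. ereal (X n)) = ereal m" "m \<in> {l..u}"
proof -
  have "limsup (\<lambda>n. ereal (X n)) \<le> ereal u"
    using assms by (intro Limsup_bounded) auto
  moreover have "ereal l \<le> limsup (\<lambda>n. ereal (X n))"
    using assms by (intro le_Limsup) auto
  ultimately show ?thesis
    using that by (cases "limsup (\<lambda>n. ereal (X n))") auto
qed

section \<open>The bracket is a clock and ignores finite-variation perturbations\<close>

context
  fixes T \<Lambda> :: real
  assumes T: "T > 0" and \<Lambda>: "\<Lambda> > 0"
begin

text \<open>Monotonicity and the slope bound hold for each \<open>n\<close> and survive the limsup,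
  out of which the finite constant \<open>\<Lambda> * (t - s)\<close> can be pulled.\<close>

lemma bracket_in_clocks: "bracket T \<Lambda> x \<in> clocks T \<Lambda>"
proof -
  define R where "R t n = regularise \<Lambda> (dyadic_qv T n x) t" for t n
  have bounds: "R t n \<in> {0..\<Lambda> * t}" if "0 \<le> t" for t n
    using regularise_bounds[of \<Lambda> "dyadic_qv T n x" t] \<Lambda> dyadic_qv_nonneg dyadic_qv_0[OF T] that
    unfolding R_def by auto
  have lim: "limsup (\<lambda>n. ereal (R t n)) = ereal (bracket T \<Lambda> x t) \<and> bracket T \<Lambda> x t \<in> {0..\<Lambda> * t}"
    if "0 \<le> t" for t
    using limsup_ereal_bounded[of "R t" 0 "\<Lambda> * t", OF bounds[OF that]]
    unfolding bracket_def R_def by (metis real_of_ereal.simps(1))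
  have incr: "0 \<le> bracket T \<Lambda> x t - bracket T \<Lambda> x s"
    "bracket T \<Lambda> x t - bracket T \<Lambda> x s \<le> \<Lambda> * (t - s)"
    if st: "0 \<le> s" "s \<le> t" "t \<le> T" for s t
  proof -
    have "R s n \<le> R t n" for n
      unfolding R_def using st T
      by (intro regularise_mono[where T=T] dyadic_qv_mono \<Lambda> dyadic_qv_nonneg dyadic_qv_0) auto
    then have "limsup (\<lambda>n. ereal (R s n)) \<le> limsup (\<lambda>n. ereal (R t n))"
      by (intro Limsup_mono) auto
    then show "0 \<le> bracket T \<Lambda> x t - bracket T \<Lambda> x s" using lim[of s] lim[of t] st by auto
    have "R t n \<le> R s n + \<Lambda> * (t - s)" for n
      unfolding R_def using regularise_Lipschitz[of \<Lambda> "dyadic_qv T n x"] \<Lambda> dyadic_qv_nonneg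
        dyadic_qv_0[OF T] st by auto
    then have "limsup (\<lambda>n. ereal (R t n)) \<le> limsup (\<lambda>n. ereal (R s n) + ereal (\<Lambda> * (t - s)))"
      by (intro Limsup_mono) auto
    also have "\<dots> = limsup (\<lambda>n. ereal (R s n)) + ereal (\<Lambda> * (t - s))"
      by (rule Limsup_add_ereal_right) auto
    finally show "bracket T \<Lambda> x t - bracket T \<Lambda> x s \<le> \<Lambda> * (t - s)"
      using lim[of s] lim[of t] st by auto
  qed
  have "\<Lambda>-lipschitz_on {0..T} (bracket T \<Lambda> x)"
  proof (rule lipschitz_onI)
    fix s t assume "s \<in> {0..T}" "t \<in> {0..T}"
    then show "dist (bracket T \<Lambda> x s) (bracket T \<Lambda> x t) \<le> \<Lambda> * dist s t"
      using incr[of s t] incr[of t s] by (cases "s \<le> t") (auto simp: dist_real_def)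
  qed (use \<Lambda> in auto)
  then have "continuous_on {0..T} (bracket T \<Lambda> x)" by (rule lipschitz_on_continuous_on)
  then show ?thesis using incr lim[of 0] unfolding clocks_def by auto
qed

text \<open>Expanding the square leaves a cross term and a square in the increments of
  \<open>h\<close>. In each, one factor is at most the modulus \<open>d\<close>, and the remaining
  increments of \<open>h\<close> sum to at most its variation.\<close>

lemma abs_dyadic_qv_shift_le:
  assumes bv: "bdd_above (variation_sums h 0 T)" and "t \<le> T"
    and d: "\<And>k. k < 2 ^ n \<Longrightarrow> \<bar>x (dyadic T n (Suc k)) - x (dyadic T n k)\<bar> \<le> d"
      "\<And>k. k < 2 ^ n \<Longrightarrow> \<bar>h (dyadic T n (Suc k)) - h (dyadic T n k)\<bar> \<le> d"
  shows "\<bar>dyadic_qv T n (shift x h \<epsilon>) t - dyadic_qv T n x t\<bar> \<le> (2 * \<bar>\<epsilon>\<bar> + \<epsilon>\<^sup>2) * d * Var h 0 T"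
proof -
  define K where "K = {k. dyadic T n (Suc k) \<le> t}"
  define X where "X k = x (dyadic T n (Suc k)) - x (dyadic T n k)" for k
  define H where "H k = h (dyadic T n (Suc k)) - h (dyadic T n k)" for k
  have K: "K \<subseteq> {..<2 ^ n}" unfolding K_def using T \<open>t \<le> T\<close> by (rule dyadic_le_subset)
  have "dyadic_qv T n (shift x h \<epsilon>) t - dyadic_qv T n x t = (\<Sum>k\<in>K. 2 * \<epsilon> * X k * H k + \<epsilon>\<^sup>2 * H k * H k)"
    unfolding dyadic_qv_def sum_subtractf[symmetric] K_def shift_def X_def H_def
    by (intro sum.cong refl) (simp add: power2_eq_square algebra_simps)
  also have "\<bar>\<dots>\<bar> \<le> (\<Sum>k\<in>K. (2 * \<bar>\<epsilon>\<bar> + \<epsilon>\<^sup>2) * d * \<bar>H k\<bar>)"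
  proof (rule order_trans[OF sum_abs sum_mono])
    fix k assume "k \<in> K"
    then have XH: "\<bar>X k\<bar> \<le> d" "\<bar>H k\<bar> \<le> d" using d K unfolding X_def H_def by auto
    have "\<bar>2 * \<epsilon> * X k * H k + \<epsilon>\<^sup>2 * H k * H k\<bar> \<le> \<bar>2 * \<epsilon> * X k * H k\<bar> + \<bar>\<epsilon>\<^sup>2 * H k * H k\<bar>"
      by (rule abs_triangle_ineq)
    also have "\<dots> = (2 * \<bar>\<epsilon>\<bar>) * \<bar>X k\<bar> * \<bar>H k\<bar> + \<epsilon>\<^sup>2 * \<bar>H k\<bar> * \<bar>H k\<bar>"
      by (simp add: abs_mult)
    also have "\<dots> \<le> (2 * \<bar>\<epsilon>\<bar>) * d * \<bar>H k\<bar> + \<epsilon>\<^sup>2 * d * \<bar>H k\<bar>"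
      using XH by (intro add_mono mult_right_mono mult_left_mono) auto
    finally show "\<bar>2 * \<epsilon> * X k * H k + \<epsilon>\<^sup>2 * H k * H k\<bar> \<le> (2 * \<bar>\<epsilon>\<bar> + \<epsilon>\<^sup>2) * d * \<bar>H k\<bar>"
      by (simp add: algebra_simps)
  qed
  also have "\<dots> = (2 * \<bar>\<epsilon>\<bar> + \<epsilon>\<^sup>2) * d * (\<Sum>k\<in>K. \<bar>H k\<bar>)"
    by (simp add: sum_distrib_left)
  also have "\<dots> \<le> (2 * \<bar>\<epsilon>\<bar> + \<epsilon>\<^sup>2) * d * Var h 0 T"
  proof (rule mult_left_mono)
    have "(\<Sum>k\<in>K. \<bar>H k\<bar>) \<le> (\<Sum>k<2 ^ n. \<bar>H k\<bar>)" using K by (intro sum_mono2) auto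
    also have "\<dots> \<le> Var h 0 T"
    proof (rule variation_sum_le_Var[OF bv])
      show "(\<Sum>k<2 ^ n. \<bar>H k\<bar>) \<in> variation_sums h 0 T"
        unfolding H_def
      proof (rule variation_sumsI)
        fix i :: nat assume "i \<le> 2 ^ n"
        then have "real i \<le> 2 ^ n" by (metis of_nat_le_iff of_nat_numeral of_nat_power)
        then show "dyadic T n i \<in> {0..T}" using T by (auto simp: dyadic_def field_simps)
      qed (use T in \<open>auto simp: dyadic_def divide_right_mono\<close>)
    qed auto
    finally show "(\<Sum>k\<in>K. \<bar>H k\<bar>) \<le> Var h 0 T" .
    have "0 \<le> d" using d(1)[of 0] by auto
    then show "0 \<le> (2 * \<bar>\<epsilon>\<bar> + \<epsilon>\<^sup>2) * d" by auto
  qed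
  finally show ?thesis .
qed

text \<open>A finite-variation perturbation has no quadratic variation, nor any covariation with \<open>x\<close>.\<close>
lemma bracket_shift:
  assumes x: "continuous_on {0..T} x" and h: "h \<in> bv_paths T" and t: "t \<in> {0..T}"
  shows "bracket T \<Lambda> (shift x h \<epsilon>) t = bracket T \<Lambda> x t"
proof -
  have hc: "continuous_on {0..T} h" and bv: "bdd_above (variation_sums h 0 T)"
    using h by (auto simp: bv_paths_def paths_def)
  define R where "R n = regularise \<Lambda> (dyadic_qv T n x) t" for n
  define R' where "R' n = regularise \<Lambda> (dyadic_qv T n (shift x h \<epsilon>)) t" for n
  have "\<forall>\<^sub>F n in sequentially. \<bar>R' n - R n\<bar> < e" if "e > 0" for e
  proof -
    define V where "V = (2 * \<bar>\<epsilon>\<bar> + \<epsilon>\<^sup>2) * Var h 0 T"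
    have "V \<ge> 0" using abs_diff_le_Var[OF bv, of 0 T] T unfolding V_def by auto
    \<comment> \<open>Dividing by \<open>V + 1\<close> covers the case \<open>V = 0\<close>, and the
      factor 2 makes the final inequality strict.\<close>
    define d where "d = e / (2 * (V + 1))"
    have "d > 0" using \<open>e > 0\<close> \<open>V \<ge> 0\<close> by (simp add: d_def)
    have "d * V \<le> d * (V + 1)" using \<open>d > 0\<close> by (intro mult_left_mono) auto
    also have "\<dots> = e / 2" using \<open>V \<ge> 0\<close> unfolding d_def by (auto simp: divide_simps)
    also have "\<dots> < e" using \<open>e > 0\<close> by simp
    finally have "d * V < e" .
    have ux: "uniformly_continuous_on {0..T} x" and uh: "uniformly_continuous_on {0..T} h"
      using x hc by (auto intro: compact_uniformly_continuous)
    obtain \<delta>1 where \<delta>1: "\<delta>1 > 0" "\<And>u v. u \<in> {0..T} \<Longrightarrow> v \<in> {0..T} \<Longrightarrow> \<bar>u - v\<bar> < \<delta>1 \<Longrightarrow> \<bar>x u - x v\<bar> < d"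
      using uniformly_continuous_onE[OF ux \<open>d > 0\<close>] unfolding dist_real_def by metis
    obtain \<delta>2 where \<delta>2: "\<delta>2 > 0" "\<And>u v. u \<in> {0..T} \<Longrightarrow> v \<in> {0..T} \<Longrightarrow> \<bar>u - v\<bar> < \<delta>2 \<Longrightarrow> \<bar>h u - h v\<bar> < d"
      using uniformly_continuous_onE[OF uh \<open>d > 0\<close>] unfolding dist_real_def by metis
    have "(\<lambda>n. T / 2 ^ n) \<longlonglongrightarrow> 0"
      using tendsto_mult_right_zero[OF LIMSEQ_inverse_realpow_zero[of 2], of T]
      by (simp add: field_simps)
    then have "\<forall>\<^sub>F n in sequentially. T / 2 ^ n < min \<delta>1 \<delta>2"
      using \<delta>1(1) \<delta>2(1) by (intro order_tendstoD(2)[where y=0]) auto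
    then show ?thesis
    proof eventually_elim
      case (elim n)
      have mem: "dyadic T n k \<in> {0..T}" if "k \<le> 2 ^ n" for k
      proof -
        have "real k \<le> 2 ^ n" using that by (metis of_nat_le_iff of_nat_numeral of_nat_power)
        then show ?thesis using T by (auto simp: dyadic_def field_simps)
      qed
      have step: "dyadic T n (Suc k) - dyadic T n k = T / 2 ^ n" for k
        by (simp add: dyadic_def field_simps)
      have "\<bar>R' n - R n\<bar> \<le> d * V"
        unfolding R_def R'_def
      proof (rule regularise_close[OF \<Lambda>])
        fix u assume "u \<in> {0..t}"
        then have "u \<le> T" using t by auto
        have "\<bar>dyadic_qv T n (shift x h \<epsilon>) u - dyadic_qv T n x u\<bar>
            \<le> (2 * \<bar>\<epsilon>\<bar> + \<epsilon>\<^sup>2) * d * Var h 0 T"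
        proof (rule abs_dyadic_qv_shift_le[OF bv \<open>u \<le> T\<close>])
          fix k :: nat assume k: "k < 2 ^ n"
          have *: "\<bar>dyadic T n (Suc k) - dyadic T n k\<bar> < min \<delta>1 \<delta>2"
            unfolding step using elim T by auto
          show "\<bar>x (dyadic T n (Suc k)) - x (dyadic T n k)\<bar> \<le> d"
            "\<bar>h (dyadic T n (Suc k)) - h (dyadic T n k)\<bar> \<le> d"
            using \<delta>1(2)[OF mem mem, of "Suc k" k] \<delta>2(2)[OF mem mem, of "Suc k" k] * k
            by auto
        qed
        then show "\<bar>dyadic_qv T n (shift x h \<epsilon>) u - dyadic_qv T n x u\<bar> \<le> d * V"
          by (simp add: V_def mult_ac)
      qed (use t T dyadic_qv_nonneg dyadic_qv_0 in auto)
      then show ?case using \<open>d * V < e\<close> by simp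
    qed
  qed
  \<comment> \<open>Neither sequence need converge; since the difference tends to 0, the two limsups
    agree all the same.\<close>
  then have "(\<lambda>n. R' n - R n) \<longlonglongrightarrow> 0" by (simp add: tendsto_iff dist_real_def)
  then have "(\<lambda>n. ereal (R' n - R n)) \<longlonglongrightarrow> 0" by (simp add: zero_ereal_def)
  then have "limsup (\<lambda>n. ereal (R' n - R n) + ereal (R n)) = 0 + limsup (\<lambda>n. ereal (R n))"
    by (rule ereal_limsup_lim_add) auto
  then have "limsup (\<lambda>n. ereal (R' n)) = limsup (\<lambda>n. ereal (R n))" by simp
  then show ?thesis unfolding bracket_def R_def R'_def by simp
qed

end

subsection \<open>Stieltjes measures of monotone functions\<close>

lemma continuous_on_clamp:
  fixes g :: "real \<Rightarrow> real" and T :: real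
  assumes "0 \<le> T" "continuous_on {0..T} g"
  shows "continuous_on UNIV (\<lambda>r. g (max 0 (min T r)))"
  using assms(1) by (intro continuous_on_compose2[OF assms(2)] continuous_intros) auto

lemma
  assumes T: "0 \<le> T"
    and mono: "\<And>r s. 0 \<le> r \<Longrightarrow> r \<le> s \<Longrightarrow> s \<le> T \<Longrightarrow> g r \<le> g s"
    and cont: "continuous_on {0..T} g"
    and st: "0 \<le> s" "s \<le> t" "t \<le> T"
  shows emeasure_stieltjes_Ioc: "emeasure (stieltjes_measure T g) {s<..t} = ennreal (g t - g s)"
    and measure_stieltjes_Ioc: "measure (stieltjes_measure T g) {s<..t} = g t - g s"
proof -
  let ?G = "\<lambda>r. g (max 0 (min T r))"
  have "emeasure (stieltjes_measure T g) {s<..t} = ennreal (?G t - ?G s)"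
    unfolding stieltjes_measure_def
  proof (rule emeasure_interval_measure_Ioc[OF st(2)])
    show "?G x \<le> ?G y" if "x \<le> y" for x y
      using that T by (intro mono) auto
    show "continuous (at_right a) ?G" for a
      using continuous_on_clamp[OF T cont]
      by (simp add: continuous_on_eq_continuous_at continuous_at_imp_continuous_within)
  qed
  then show "emeasure (stieltjes_measure T g) {s<..t} = ennreal (g t - g s)"
    using st by (simp add: min_def max_def)
  then show "measure (stieltjes_measure T g) {s<..t} = g t - g s"
    using mono[of s t] st by (simp add: measure_def)
qed

lemma sets_stieltjes_measure [simp, measurable_cong]: "sets (stieltjes_measure T g) = sets borel"
  by (simp add: stieltjes_measure_def)

lemma space_stieltjes_measure [simp]: "space (stieltjes_measure T g) = UNIV"
  by (simp add: stieltjes_measure_def)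

text \<open>
  The complementary clock \<open>\<Lambda> r - q r\<close> is increasing too, and the two Stieltjes measures add up to
  \<open>\<Lambda>\<close> times Lebesgue measure.
\<close>
lemma emeasure_clock_le:
  assumes T: "0 \<le> T" and \<Lambda>: "0 \<le> \<Lambda>" and q: "q \<in> clocks T \<Lambda>" and A: "A \<in> sets borel"
  shows "emeasure (stieltjes_measure T q) A \<le> ennreal \<Lambda> * emeasure lborel A"
proof -
  let ?N = "stieltjes_measure T q"
  let ?q = "\<lambda>r. q (max 0 (min T r))"
  let ?N' = "interval_measure (\<lambda>r. \<Lambda> * r - ?q r)"
  let ?S = "measure_of UNIV (sets borel) (\<lambda>A. emeasure ?N A + emeasure ?N' A)"
  \<comment> \<open>Clamping to \<open>[0,T]\<close> is monotone and 1-Lipschitz, so both clock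
    inequalities extend to the whole line.\<close>
  have inc: "0 \<le> ?q t - ?q s" "?q t - ?q s \<le> \<Lambda> * (t - s)" if "s \<le> t" for s t
  proof -
    have le: "0 \<le> max 0 (min T s)" "max 0 (min T s) \<le> max 0 (min T t)" "max 0 (min T t) \<le> T"
      using that T by auto
    have 1: "0 \<le> ?q t - ?q s \<and> ?q t - ?q s \<le> \<Lambda> * (max 0 (min T t) - max 0 (min T s))"
      using q le unfolding clocks_def by blast
    have "\<Lambda> * (max 0 (min T t) - max 0 (min T s)) \<le> \<Lambda> * (t - s)"
      using \<Lambda> that by (intro mult_left_mono) auto
    then show "?q t - ?q s \<le> \<Lambda> * (t - s)" using 1 by linarith
    show "0 \<le> ?q t - ?q s" using 1 by blast
  qed
  have cont: "continuous_on UNIV ?q"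
    using q by (intro continuous_on_clamp T) (auto simp: clocks_def)
  then have rc: "continuous (at_right a) ?q" for a
    by (simp add: continuous_on_eq_continuous_at continuous_at_imp_continuous_within)
  have N: "emeasure ?N {a<..c} = ennreal (?q c - ?q a)" if "a \<le> c" for a c
    unfolding stieltjes_measure_def using that inc rc
    by (intro emeasure_interval_measure_Ioc) auto
  have N': "emeasure ?N' {a<..c} = ennreal ((\<Lambda> * c - ?q c) - (\<Lambda> * a - ?q a))" if "a \<le> c" for a c
    using that
  proof (rule emeasure_interval_measure_Ioc)
    fix x y :: real assume "x \<le> y"
    then show "\<Lambda> * x - ?q x \<le> \<Lambda> * y - ?q y" using inc(2)[of x y] by (simp add: algebra_simps)
  next
    show "continuous (at_right a) (\<lambda>r. \<Lambda> * r - ?q r)" for a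
      by (intro continuous_intros rc)
  qed
  have S: "emeasure ?S A = emeasure ?N A + emeasure ?N' A" if "A \<in> sets borel" for A
  proof (rule emeasure_measure_of_sigma[OF _ _ _ that])
    show "sigma_algebra UNIV (sets borel)"
      using sets.sigma_algebra_axioms[of borel] by simp
    show "countably_additive (sets borel) (\<lambda>A. emeasure ?N A + emeasure ?N' A)"
    proof (rule countably_additiveI)
      fix A :: "nat \<Rightarrow> real set"
      assume "range A \<subseteq> sets borel" "disjoint_family A"
      then show "(\<Sum>i. emeasure ?N (A i) + emeasure ?N' (A i)) =
          emeasure ?N (\<Union>i. A i) + emeasure ?N' (\<Union>i. A i)"
        by (subst suminf_add[symmetric]) (auto simp: suminf_emeasure)
    qed
  qed (auto simp: positive_def)
  \<comment> \<open>On half-open intervals the increments of \<open>?q\<close> cancel and only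
    \<Lambda> times the length remains. The intervals \<open>{- real i<..real i}\<close> have finite
    mass and exhaust the line, so agreement on this generator suffices.\<close>
  have "?S = density lborel (\<lambda>_. ennreal \<Lambda>)"
  proof (rule measure_eqI_generator_eq)
    let ?E = "range (\<lambda>(a, c). {a<..c::real})"
    show "Int_stable ?E"
      by (auto simp: Int_stable_def Int_greaterThanAtMost)
    show "?E \<subseteq> Pow UNIV" by auto
    have "sigma_algebra (UNIV :: real set) (sets borel)"
      using sets.sigma_algebra_axioms[of borel] by simp
    then have "sets ?S = sets borel"
      by (simp add: sigma_algebra.sets_measure_of_eq sigma_algebra.sigma_sets_eq)
    then show "sets ?S = sigma_sets UNIV ?E"
      "sets (density lborel (\<lambda>_. ennreal \<Lambda>)) = sigma_sets UNIV ?E"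
      by (simp_all add: borel_sigma_sets_Ioc)
    have eq: "emeasure ?S {a<..c} = ennreal \<Lambda> * emeasure lborel {a<..c}" for a c
    proof (cases "a \<le> c")
      case True
      then have "emeasure ?S {a<..c} = ennreal (?q c - ?q a) + ennreal ((\<Lambda> * c - ?q c) - (\<Lambda> * a - ?q a))"
        using S N N' by simp
      also have "\<dots> = ennreal (\<Lambda> * (c - a))"
        using inc[OF True] by (subst ennreal_plus[symmetric]) (auto simp: algebra_simps)
      finally show ?thesis using True \<Lambda> by (simp add: ennreal_mult')
    qed (simp add: S)
    show "emeasure ?S X = emeasure (density lborel (\<lambda>_. ennreal \<Lambda>)) X" if "X \<in> ?E" for X
      using that eq by (auto simp: emeasure_density_const)
    show "range (\<lambda>i::nat. {- real i<..real i}) \<subseteq> ?E" by auto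
    show "(\<Union>i::nat. {- real i<..real i}) = UNIV"
    proof -
      have "\<exists>i::nat. - real i < x \<and> x \<le> real i" for x
        using reals_Archimedean2[of "\<bar>x\<bar>"] by (metis abs_le_iff less_le linorder_not_le minus_less_iff neg_less_iff_less)
      then show ?thesis by auto
    qed
    show "emeasure ?S {- real i<..real i} \<noteq> \<infinity>" for i
      unfolding eq by (simp add: ennreal_mult_eq_top_iff)
  qed
  then have "emeasure ?N A + emeasure ?N' A = ennreal \<Lambda> * emeasure lborel A"
    using S[OF A] A by (simp add: emeasure_density_const)
  then show ?thesis by (metis le_iff_add)
qed

text \<open>On a bounded piece \<open>A\<close> of the set where \<open>f\<close> exceeds
  \<open>c\<close>, the integral of \<open>f - c\<close> vanishes by the domination although the
  integrand is positive, so \<open>A\<close> is null. Cutting to bounded pieces keeps the subtracted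
  integral finite, as subtraction in \<open>ennreal\<close> demands.\<close>

lemma AE_density_le_const:
  fixes f :: "real \<Rightarrow> ennreal"
  assumes f[measurable]: "f \<in> borel_measurable lborel"
    and le: "\<And>A. A \<in> sets borel \<Longrightarrow> emeasure (density lborel f) A \<le> ennreal c * emeasure lborel A"
  shows "AE x in lborel. f x \<le> ennreal c"
proof -
  have "AE x in lborel. x \<in> {- real n<..real n} \<longrightarrow> f x \<le> ennreal c" for n
  proof -
    define A where "A = {x \<in> space lborel. ennreal c < f x} \<inter> {- real n<..real n}"
    have [measurable]: "A \<in> sets borel" unfolding A_def by measurable
    have "emeasure lborel A \<le> emeasure lborel {- real n<..real n}"
      by (intro emeasure_mono) (auto simp: A_def)
    then have fin: "emeasure lborel A < \<infinity>"
      by (simp add: order_le_less_trans)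
    have "(\<integral>\<^sup>+x. (f x * indicator A x - ennreal c * indicator A x) \<partial>lborel)
        = (\<integral>\<^sup>+x. f x * indicator A x \<partial>lborel) - (\<integral>\<^sup>+x. ennreal c * indicator A x \<partial>lborel)"
    proof (rule nn_integral_diff)
      show "(\<integral>\<^sup>+x. ennreal c * indicator A x \<partial>lborel) \<noteq> \<infinity>"
        using fin by (simp add: nn_integral_cmult_indicator ennreal_mult_eq_top_iff)
      show "AE x in lborel. ennreal c * indicator A x \<le> f x * indicator A x"
        by (auto simp: A_def split: split_indicator)
    qed auto
    also have "\<dots> = emeasure (density lborel f) A - ennreal c * emeasure lborel A"
      by (simp add: emeasure_density nn_integral_cmult_indicator)
    also have "\<dots> = 0"
      using le[of A] order_le_less_trans[OF le[of A]] fin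
      by (simp add: diff_eq_0_iff_ennreal ennreal_mult_less_top)
    finally have "AE x in lborel. f x * indicator A x - ennreal c * indicator A x = 0"
      by (subst (asm) nn_integral_0_iff_AE) auto
    then show ?thesis
    proof eventually_elim
      case (elim x)
      show ?case
      proof
        assume x: "x \<in> {- real n<..real n}"
        show "f x \<le> ennreal c"
        proof (rule ccontr)
          assume "\<not> f x \<le> ennreal c"
          then have "ennreal c < f x" "x \<in> A" using x by (auto simp: A_def)
          then have "f x - ennreal c = 0" using elim by simp
          then show False
            using \<open>ennreal c < f x\<close> by (simp add: diff_eq_0_iff_ennreal flip: not_le)
        qed
      qed
    qed
  qed
  then have "AE x in lborel. \<forall>n::nat. x \<in> {- real n<..real n} \<longrightarrow> f x \<le> ennreal c"
    by (subst AE_all_countable) blast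
  then show ?thesis
  proof eventually_elim
    case (elim x)
    obtain n :: nat where "\<bar>x\<bar> < real n" using reals_Archimedean2 by blast
    then have "x \<in> {- real n<..real n}" by auto
    then show ?case using elim by blast
  qed
qed

text \<open>Domination by a multiple of Lebesgue measure gives absolute continuity, so Radon-Nikodym
  applies, and also bounds the density almost everywhere.\<close>

lemma clock_density:
  assumes T: "0 \<le> T" and \<Lambda>: "0 \<le> \<Lambda>" and q: "q \<in> clocks T \<Lambda>"
  obtains \<rho> :: "real \<Rightarrow> real" where "\<rho> \<in> borel_measurable borel" "\<And>r. 0 \<le> \<rho> r" "\<And>r. \<rho> r \<le> \<Lambda>"
    "stieltjes_measure T q = density lborel (\<lambda>r. ennreal (\<rho> r))"
proof -
  let ?N = "stieltjes_measure T q"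
  have le: "emeasure ?N A \<le> ennreal \<Lambda> * emeasure lborel A" if "A \<in> sets borel" for A
    using emeasure_clock_le[OF T \<Lambda> q that] .
  have "absolutely_continuous lborel ?N"
    unfolding absolutely_continuous_def null_sets_def using le by fastforce
  then obtain f where f[measurable]: "f \<in> borel_measurable lborel" "density lborel f = ?N"
    using sigma_finite_measure.Radon_Nikodym[OF sigma_finite_lborel, of ?N] by auto
  have AE: "AE x in lborel. f x \<le> ennreal \<Lambda>"
    using le f by (intro AE_density_le_const) auto
  \<comment> \<open>Capping alters the density on a null set only and makes the bound hold at every
    point, which the locale \<open>drift\<close> will ask for.\<close>
  define \<rho> where "\<rho> x = enn2real (min (f x) (ennreal \<Lambda>))" for x
  have \<rho>: "ennreal (\<rho> x) = min (f x) (ennreal \<Lambda>)" for x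
    unfolding \<rho>_def by (simp add: ennreal_enn2real_if min_def top_unique)
  have "density lborel f = density lborel (\<lambda>x. ennreal (\<rho> x))"
  proof (rule density_cong)
    show "AE x in lborel. f x = ennreal (\<rho> x)"
      using AE by eventually_elim (simp add: \<rho> min_absorb1)
  qed (auto simp: \<rho>)
  moreover have "\<rho> x \<le> \<Lambda>" for x
    using \<Lambda> unfolding \<rho>_def by (intro enn2real_leI) auto
  moreover have "\<rho> \<in> borel_measurable borel"
    unfolding \<rho>_def using f(1) by simp
  ultimately show ?thesis
    using that[of \<rho>] f(2) unfolding \<rho>_def by auto
qed

lemma set_integral_density_real:
  fixes g \<rho> :: "real \<Rightarrow> real"
  assumes "\<rho> \<in> borel_measurable borel" "\<And>r. 0 \<le> \<rho> r" "set_borel_measurable lborel A g"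
  shows "(LINT r:A|density lborel (\<lambda>r. ennreal (\<rho> r)). g r) = (LBINT r:A. \<rho> r * g r)"
  unfolding set_lebesgue_integral_def
  using assms by (subst integral_density) (auto simp: set_borel_measurable_def ac_simps)

subsection \<open>Volterra equations\<close>

lemma set_integrable_Ioc_bounded:
  fixes w :: "real \<Rightarrow> real"
  assumes "set_borel_measurable lborel {s<..t} w" "\<And>r. r \<in> {s<..t} \<Longrightarrow> \<bar>w r\<bar> \<le> B"
  shows "set_integrable lborel {s<..t} w"
proof (rule set_integrable_bound[where f = "\<lambda>_. B"])
  show "set_integrable lborel {s<..t} (\<lambda>_. B)"
    unfolding set_integrable_def
    by (cases "s \<le> t") (auto intro!: integrable_mult_left integrable_real_indicator)
qed (use assms in fastforce)+

lemma set_lebesgue_integral_Ioc_const: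
  fixes B :: real
  shows "s \<le> t \<Longrightarrow> (LBINT r:{s<..t}. B) = B * (t - s)"
  unfolding set_lebesgue_integral_def by simp

lemma abs_LBINT_Ioc_le:
  fixes w :: "real \<Rightarrow> real"
  assumes "s \<le> t" "set_borel_measurable lborel {s<..t} w" "\<And>r. r \<in> {s<..t} \<Longrightarrow> \<bar>w r\<bar> \<le> B"
  shows "\<bar>LBINT r:{s<..t}. w r\<bar> \<le> B * (t - s)"
proof -
  have int: "set_integrable lborel {s<..t} w"
    using assms by (intro set_integrable_Ioc_bounded) auto
  have c: "set_integrable lborel {s<..t} (\<lambda>_. c::real)" for c
    using assms(1) unfolding set_integrable_def
    by (auto intro!: integrable_mult_left integrable_real_indicator)
  have "(LBINT r:{s<..t}. w r) \<le> (LBINT r:{s<..t}. B)"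
    using assms(3) by (intro set_integral_mono int c) fastforce
  moreover have "(LBINT r:{s<..t}. - B) \<le> (LBINT r:{s<..t}. w r)"
    using assms(3) by (intro set_integral_mono int c) fastforce
  ultimately show ?thesis
    unfolding set_lebesgue_integral_Ioc_const[OF assms(1)] by auto
qed

lemma LBINT_Ioc_split:
  fixes w :: "real \<Rightarrow> real"
  assumes "s \<le> r" "r \<le> t" "set_integrable lborel {s<..t} w"
  shows "(LBINT v:{s<..t}. w v) = (LBINT v:{s<..r}. w v) + (LBINT v:{r<..t}. w v)"
proof -
  have "{s<..t} = {s<..r} \<union> {r<..t}" using assms by auto
  moreover have "set_integrable lborel {s<..r} w" "set_integrable lborel {r<..t} w"
    by (rule set_integrable_subset[OF assms(3)]; use assms in auto)+
  ultimately show ?thesis by (simp add: set_integral_Un)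
qed

lemma set_borel_measurable_Ioc_subset:
  assumes "set_borel_measurable lborel {s<..t} w" "{a<..c} \<subseteq> {s<..t::real}"
  shows "set_borel_measurable lborel {a<..c} (w :: real \<Rightarrow> real)"
  by (rule set_borel_measurable_subset[OF assms(1) _ assms(2)]) auto

lemma continuous_on_LBINT_Ioc:
  fixes w :: "real \<Rightarrow> real"
  assumes meas: "set_borel_measurable lborel {s<..T} w" and B: "\<And>r. r \<in> {s<..T} \<Longrightarrow> \<bar>w r\<bar> \<le> B"
  shows "continuous_on {s..T} (\<lambda>t. LBINT r:{s<..t}. w r)"
proof (cases "s < T")
  case True
  have "B \<ge> 0" using B[of T] True by auto
  have int: "set_integrable lborel {s<..T} w" by (rule set_integrable_Ioc_bounded[OF meas B])
  have *: "\<bar>(LBINT r:{s<..t}. w r) - (LBINT r:{s<..u}. w r)\<bar> \<le> B * (t - u)"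
    if "u \<in> {s..T}" "t \<in> {s..T}" "u \<le> t" for u t
  proof -
    have "set_integrable lborel {s<..t} w"
      by (rule set_integrable_subset[OF int]) (use that in auto)
    then have "(LBINT r:{s<..t}. w r) - (LBINT r:{s<..u}. w r) = (LBINT r:{u<..t}. w r)"
      using LBINT_Ioc_split[of s u t w] that by auto
    also have "\<bar>\<dots>\<bar> \<le> B * (t - u)"
      using that B by (intro abs_LBINT_Ioc_le set_borel_measurable_Ioc_subset[OF meas]) auto
    finally show ?thesis .
  qed
  have "B-lipschitz_on {s..T} (\<lambda>t. LBINT r:{s<..t}. w r)"
  proof (rule lipschitz_onI)
    fix u t assume "u \<in> {s..T}" "t \<in> {s..T}"
    then show "dist (LBINT r:{s<..u}. w r) (LBINT r:{s<..t}. w r) \<le> B * dist u t"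
      using *[of u t] *[of t u] by (cases "u \<le> t") (auto simp: dist_real_def abs_minus_commute)
  qed fact
  then show ?thesis by (rule lipschitz_on_continuous_on)
next
  case False
  then have "{s..T} \<subseteq> {s}" by auto
  then show ?thesis by (rule continuous_on_subset[rotated]) simp
qed

lemma set_borel_measurable_Ioc_continuous_on:
  fixes w :: "real \<Rightarrow> real"
  assumes "continuous_on {s..t} w"
  shows "set_borel_measurable lborel {s<..t} w"
proof -
  have "continuous_on {s<..t} w" using assms by (rule continuous_on_subset) auto
  then show ?thesis
    using borel_measurable_continuous_on_indicator[of "{s<..t}" w]
    by (simp add: set_borel_measurable_def)
qed

lemma set_integrable_Ioc_continuous_on:
  fixes w :: "real \<Rightarrow> real"
  assumes "continuous_on {s..t} w"
  shows "set_integrable lborel {s<..t} w"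
  by (rule set_integrable_subset[OF borel_integrable_atLeastAtMost'[OF assms]]) auto

lemma continuous_on_Icc_bounded:
  fixes w :: "real \<Rightarrow> real"
  assumes "continuous_on {s..t} w"
  obtains B where "B \<ge> 0" "\<And>r. r \<in> {s..t} \<Longrightarrow> \<bar>w r\<bar> \<le> B"
proof -
  have "bounded (w ` {s..t})"
    using assms by (intro compact_imp_bounded compact_continuous_image) auto
  then obtain B where "\<forall>r\<in>{s..t}. \<bar>w r\<bar> \<le> B" by (auto simp: bounded_iff)
  then show ?thesis using that[of "max 0 B"] by fastforce
qed

lemma LBINT_Ioc_exp:
  fixes s t c :: real
  assumes "s \<le> t" "c \<noteq> 0"
  shows "(LBINT r:{s<..t}. exp (c * (r - s))) = (exp (c * (t - s)) - 1) / c"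
proof -
  have "(LBINT r=s..t. exp (c * (r - s))) = exp (c * (t - s)) / c - exp (c * (s - s)) / c"
  proof (rule interval_integral_FTC_finite)
    fix x
    have "((\<lambda>r. exp (c * (r - s)) / c) has_field_derivative exp (c * (x - s)))
        (at x within {min s t..max s t})"
      using assms(2) by (auto intro!: derivative_eq_intros)
    then show "((\<lambda>r. exp (c * (r - s)) / c) has_vector_derivative exp (c * (x - s)))
        (at x within {min s t..max s t})"
      by (simp add: has_real_derivative_iff_has_vector_derivative)
  qed (intro continuous_intros)
  then show ?thesis
    using interval_integral_Ioc[OF assms(1), of "\<lambda>r. exp (c * (r - s))"]
    by (simp add: diff_divide_distrib)
qed

text \<open>
  Gronwall with a cruder constant: the maximum of \<open>exp (-2K(t - s)) w t\<close> is at most \<open>A\<close> plus half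
  of itself.
\<close>
lemma gronwall:
  fixes K A s T :: real
  assumes w: "continuous_on {s..T} w" "\<And>t. t \<in> {s..T} \<Longrightarrow> 0 \<le> w t" and K: "K > 0"
    and le: "\<And>t. t \<in> {s..T} \<Longrightarrow> w t \<le> A + K * (LBINT r:{s<..t}. w r)"
    and t: "t \<in> {s..T}"
  shows "w t \<le> 2 * A * exp (2 * K * (t - s))"
proof -
  define m where "m t = exp (- 2 * K * (t - s)) * w t" for t
  have "continuous_on {s..T} m" unfolding m_def by (intro continuous_intros w)
  then obtain u where u: "u \<in> {s..T}" "\<And>t. t \<in> {s..T} \<Longrightarrow> m t \<le> m u"
    using continuous_attains_sup[of "{s..T}" m] t by auto
  have "m u \<ge> 0" using w(2) u(1) by (simp add: m_def)
  have "A \<ge> 0"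
    using le[of s] w(2)[of s] t by (auto simp: set_lebesgue_integral_def)
  have wm: "w r = exp (2 * K * (r - s)) * m r" for r
    by (simp add: m_def flip: exp_add mult.assoc)
  have "(LBINT r:{s<..u}. w r) \<le> (LBINT r:{s<..u}. m u * exp (2 * K * (r - s)))"
  proof (rule set_integral_mono)
    show "set_integrable lborel {s<..u} w"
      using u by (intro set_integrable_Ioc_continuous_on continuous_on_subset[OF w(1)]) auto
    show "set_integrable lborel {s<..u} (\<lambda>r. m u * exp (2 * K * (r - s)))"
      by (intro set_integrable_Ioc_continuous_on continuous_intros)
    show "w r \<le> m u * exp (2 * K * (r - s))" if "r \<in> {s<..u}" for r
      using u(2)[of r] that u(1) wm[of r] by (simp add: mult.commute)
  qed
  also have "\<dots> = m u * ((exp (2 * K * (u - s)) - 1) / (2 * K))"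
    using LBINT_Ioc_exp[of s u "2 * K"] u K by simp
  finally have "K * (LBINT r:{s<..u}. w r) \<le> K * (m u * ((exp (2 * K * (u - s)) - 1) / (2 * K)))"
    using K by (intro mult_left_mono) auto
  \<comment> \<open>The rate \<open>2 * K\<close> in the weight turns the factor \<open>K\<close>
    into 1/2, so half of \<open>m u\<close> can be absorbed on the left.\<close>
  also have "\<dots> = m u / 2 * (exp (2 * K * (u - s)) - 1)"
    using K by (simp add: field_simps)
  finally have "w u \<le> A + m u / 2 * (exp (2 * K * (u - s)) - 1)"
    using le[OF u(1)] by linarith
  also have "\<dots> \<le> A + m u / 2 * exp (2 * K * (u - s))"
    using \<open>m u \<ge> 0\<close> by (simp add: algebra_simps)
  finally have "exp (2 * K * (u - s)) * m u \<le> A + m u / 2 * exp (2 * K * (u - s))"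
    unfolding wm[of u] by simp
  then have "exp (2 * K * (u - s)) * (m u / 2) \<le> A"
    by (simp add: field_simps)
  moreover have "1 * (m u / 2) \<le> exp (2 * K * (u - s)) * (m u / 2)"
    using \<open>m u \<ge> 0\<close> u(1) K by (intro mult_right_mono) auto
  ultimately have "m u \<le> 2 * A" by simp
  then have "m t \<le> 2 * A" using u(2)[OF t] by simp
  then have "exp (2 * K * (t - s)) * m t \<le> exp (2 * K * (t - s)) * (2 * A)"
    by (intro mult_left_mono) auto
  then show ?thesis unfolding wm[of t] by (simp add: mult_ac)
qed

text \<open>The forcing \<open>g\<close> collects the starting value and the rough path, which needs
  no regularity beyond continuity; \<open>f\<close> carries both the dr and the dq integrand. Linear
  equations are the instance \<open>f r u = \<alpha> r * u\<close>.\<close>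

definition volterra ::
    "(real \<Rightarrow> real \<Rightarrow> real) \<Rightarrow> real \<Rightarrow> real \<Rightarrow> (real \<Rightarrow> real) \<Rightarrow> (real \<Rightarrow> real) \<Rightarrow> bool" where
  "volterra f s T g Z \<longleftrightarrow> continuous_on {s..T} Z \<and>
     (\<forall>t\<in>{s..T}. Z t = g t + (LBINT r:{s<..t}. f r (Z r)))"

lemma volterra_cong:
  assumes "\<And>r. r \<in> {s<..T} \<Longrightarrow> f r (Z r) = f' r (Z r)" "\<And>t. t \<in> {s..T} \<Longrightarrow> g t = g' t"
  shows "volterra f s T g Z \<longleftrightarrow> volterra f' s T g' Z"
proof -
  have "(LBINT r:{s<..t}. f r (Z r)) = (LBINT r:{s<..t}. f' r (Z r))" if "t \<in> {s..T}" for t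
    using assms(1) that by (intro set_lebesgue_integral_cong) auto
  then show ?thesis using assms(2) unfolding volterra_def by auto
qed

lemma volterra_eq_on:
  assumes eq: "\<And>t. t \<in> {s..T} \<Longrightarrow> W t = Z t"
  shows "volterra f s T g W \<longleftrightarrow> volterra f s T g Z"
proof -
  have "(LBINT r:{s<..t}. f r (W r)) = (LBINT r:{s<..t}. f r (Z r))" if "t \<in> {s..T}" for t
    using eq that by (intro set_lebesgue_integral_cong) auto
  moreover have "continuous_on {s..T} W \<longleftrightarrow> continuous_on {s..T} Z"
    using eq by (rule continuous_on_cong[OF refl])
  ultimately show ?thesis using eq unfolding volterra_def by auto
qed

text \<open>Measurability is asked of composites because the clock density makes \<open>f\<close>
  merely measurable in time. The last two bounds are what two bounded derivatives in
  \<open>z\<close> yield, and \<open>f'\<close> stands for the derivative in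
  \<open>z\<close>.\<close>

locale drift =
  fixes f f' :: "real \<Rightarrow> real \<Rightarrow> real" and K :: real
  assumes K: "K > 0"
    and measurable: "\<And>w. w \<in> borel_measurable borel \<Longrightarrow> (\<lambda>r. f r (w r)) \<in> borel_measurable borel"
      "\<And>w. w \<in> borel_measurable borel \<Longrightarrow> (\<lambda>r. f' r (w r)) \<in> borel_measurable borel"
    and bounded: "\<And>r z. \<bar>f r z\<bar> \<le> K" "\<And>r z. \<bar>f' r z\<bar> \<le> K"
    and Lipschitz: "\<And>r z z'. \<bar>f r z' - f r z\<bar> \<le> K * \<bar>z' - z\<bar>"
    and remainder: "\<And>r z z'. \<bar>f r z' - f r z - f' r z * (z' - z)\<bar> \<le> K * (z' - z)\<^sup>2"
begin

text \<open>Constant extension from \<open>[s,T]\<close> to the line: the measurability axioms of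
  \<open>drift\<close> and the Banach space of bounded continuous functions both concern functions
  on all of \<open>real\<close>.\<close>

definition clip :: "real \<Rightarrow> real \<Rightarrow> (real \<Rightarrow> real) \<Rightarrow> real \<Rightarrow> real" where
  "clip s T Z r = Z (max s (min T r))"

lemma continuous_on_clip:
  assumes "s \<le> T" "continuous_on {s..T} Z"
  shows "continuous_on UNIV (clip s T Z)"
  unfolding clip_def using assms
  by (intro continuous_on_compose2[OF assms(2)] continuous_intros) auto

lemma clip_eq: "r \<in> {s..T} \<Longrightarrow> clip s T Z r = Z r"
  by (auto simp: clip_def min_def max_def)

lemma measurable_clip:
  "s \<le> T \<Longrightarrow> continuous_on {s..T} Z \<Longrightarrow> clip s T Z \<in> borel_measurable borel"
  by (intro borel_measurable_continuous_onI continuous_on_clip)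

lemma set_borel_measurable_drift:
  assumes "continuous_on {s..T} Z" "t \<le> T"
  shows "set_borel_measurable lborel {s<..t} (\<lambda>r. f r (Z r))"
    "set_borel_measurable lborel {s<..t} (\<lambda>r. f' r (Z r))"
proof -
  have "set_borel_measurable lborel {s<..t} (\<lambda>r. f r (Z r)) \<and>
    set_borel_measurable lborel {s<..t} (\<lambda>r. f' r (Z r))"
  proof (cases "s < t")
    case True
    have [measurable]: "(\<lambda>r. f r (clip s T Z r)) \<in> borel_measurable borel"
      "(\<lambda>r. f' r (clip s T Z r)) \<in> borel_measurable borel"
      using True assms by (auto intro!: measurable measurable_clip)
    have "(\<lambda>r. indicator {s<..t} r *\<^sub>R f r (Z r)) = (\<lambda>r. indicator {s<..t} r *\<^sub>R f r (clip s T Z r))"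
      "(\<lambda>r. indicator {s<..t} r *\<^sub>R f' r (Z r)) = (\<lambda>r. indicator {s<..t} r *\<^sub>R f' r (clip s T Z r))"
      using assms by (auto simp: fun_eq_iff clip_eq split: split_indicator)
    then show ?thesis unfolding set_borel_measurable_def by simp
  qed (simp add: set_borel_measurable_def)
  then show "set_borel_measurable lborel {s<..t} (\<lambda>r. f r (Z r))"
    "set_borel_measurable lborel {s<..t} (\<lambda>r. f' r (Z r))" by auto
qed

lemma set_integrable_drift:
  assumes "continuous_on {s..T} Z" "t \<le> T"
  shows "set_integrable lborel {s<..t} (\<lambda>r. f r (Z r))"
  by (intro set_integrable_Ioc_bounded[where B=K] set_borel_measurable_drift[OF assms] bounded)

lemma set_integrable_linear:
  assumes "continuous_on {s..T} Z" "continuous_on {s..T} U" "t \<le> T"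
  shows "set_integrable lborel {s<..t} (\<lambda>r. f' r (Z r) * U r)"
proof -
  have U: "continuous_on {s..t} U" using assms by (intro continuous_on_subset[OF assms(2)]) auto
  obtain B where B: "B \<ge> 0" "\<And>r. r \<in> {s..t} \<Longrightarrow> \<bar>U r\<bar> \<le> B"
    using continuous_on_Icc_bounded[OF U] by blast
  have "set_borel_measurable lborel {s<..t} (\<lambda>r. f' r (Z r) * U r)"
  proof -
    have "(\<lambda>r. (indicator {s<..t} r *\<^sub>R f' r (Z r)) * (indicator {s<..t} r *\<^sub>R U r)) \<in> borel_measurable lborel"
      using set_borel_measurable_drift(2)[OF assms(1,3)] set_borel_measurable_Ioc_continuous_on[OF U]
      unfolding set_borel_measurable_def by (rule borel_measurable_times)
    also have "(\<lambda>r. (indicator {s<..t} r *\<^sub>R f' r (Z r)) * (indicator {s<..t} r *\<^sub>R U r)) =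
        (\<lambda>r. indicator {s<..t} r *\<^sub>R (f' r (Z r) * U r))"
      by (auto split: split_indicator)
    finally show ?thesis by (simp add: set_borel_measurable_def)
  qed
  then show ?thesis
    by (rule set_integrable_Ioc_bounded[where B = "K * B"])
      (auto simp: abs_mult intro!: mult_mono bounded B(2) order.strict_implies_order[OF K])
qed

text \<open>
  Picard iteration in the exponentially weighted sup norm, in which the integral operator contracts
  by \<open>1/2\<close> on the whole interval at once.
\<close>
lemma volterra_exists:
  assumes st: "s \<le> T" and g: "continuous_on {s..T} g"
  shows "\<exists>Z. volterra f s T g Z"
proof -
  \<comment> \<open>With \<open>W = Z / e\<close> as unknown, the weighted norm of \<open>Z\<close>
    becomes the plain sup norm of \<open>W\<close>; \<open>P\<close> is the Picard operator in this
    variable.\<close>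
  define e where "e r = exp (2 * K * (r - s))" for r
  have e_pos: "e r > 0" for r by (simp add: e_def)
  have e_cont: "continuous_on A e" for A unfolding e_def by (intro continuous_intros)
  define P where "P W t = (g t + (LBINT r:{s<..t}. f r (e r * W r))) / e t" for W t
  have eW: "continuous_on {s..T} (\<lambda>r. e r * apply_bcontfun W r)" for W :: "real \<Rightarrow>\<^sub>C real"
    by (intro continuous_intros e_cont continuous_on_apply_bcontfun)
  have P_cont: "continuous_on {s..T} (P (apply_bcontfun W))" for W :: "real \<Rightarrow>\<^sub>C real"
    unfolding P_def using e_pos
    by (intro continuous_intros g e_cont continuous_on_LBINT_Ioc[where B=K]
        set_borel_measurable_drift(1)[OF eW] bounded) (auto simp: less_imp_neq[THEN not_sym])
  have "clip s T (P (apply_bcontfun W)) \<in> bcontfun" for W :: "real \<Rightarrow>\<^sub>C real"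
  proof -
    obtain B where "\<And>r. r \<in> {s..T} \<Longrightarrow> \<bar>P (apply_bcontfun W) r\<bar> \<le> B"
      using continuous_on_Icc_bounded[OF P_cont] by blast
    then show ?thesis
      using st by (intro bcontfun_normI[where b=B] continuous_on_clip P_cont) (auto simp: clip_def)
  qed
  then have app: "apply_bcontfun (Bcontfun (clip s T (P (apply_bcontfun W)))) = clip s T (P (apply_bcontfun W))"
    for W :: "real \<Rightarrow>\<^sub>C real"
    by (rule Bcontfun_inverse)
  have "\<exists>!W. Bcontfun (clip s T (P (apply_bcontfun W))) = W"
  proof (rule banach_fix_type[where c = "1/2"], safe)
    fix W V :: "real \<Rightarrow>\<^sub>C real"
    have main: "\<bar>P W t - P V t\<bar> \<le> 1/2 * dist W V" if t: "t \<in> {s..T}" for t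
    proof -
      have int: "set_integrable lborel {s<..t} (\<lambda>r. f r (e r * X r))" for X :: "real \<Rightarrow>\<^sub>C real"
        using t by (intro set_integrable_drift[OF eW]) auto
      have "(LBINT r:{s<..t}. f r (e r * W r)) - (LBINT r:{s<..t}. f r (e r * V r))
          = (LBINT r:{s<..t}. f r (e r * W r) - f r (e r * V r))"
        by (intro set_integral_diff(2)[symmetric] int)
      also have "\<bar>\<dots>\<bar> \<le> (LBINT r:{s<..t}. \<bar>f r (e r * W r) - f r (e r * V r)\<bar>)"
        using set_integral_norm_bound[OF set_integral_diff(1)[OF int int]] by simp
      also have "\<dots> \<le> (LBINT r:{s<..t}. K * dist W V * e r)"
      proof (intro set_integral_mono set_integrable_abs set_integral_diff(1) int)
        show "set_integrable lborel {s<..t} (\<lambda>r. K * dist W V * e r)"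
          by (intro set_integrable_Ioc_continuous_on continuous_intros e_cont)
        show "\<bar>f r (e r * W r) - f r (e r * V r)\<bar> \<le> K * dist W V * e r" for r
        proof -
          have "\<bar>f r (e r * W r) - f r (e r * V r)\<bar> \<le> K * \<bar>e r * W r - e r * V r\<bar>"
            by (rule Lipschitz)
          also have "\<bar>e r * W r - e r * V r\<bar> = e r * dist (W r) (V r)"
            using e_pos[of r] by (simp add: dist_real_def abs_mult flip: right_diff_distrib)
          also have "K * \<dots> \<le> K * (e r * dist W V)"
            using K e_pos[of r] by (intro mult_left_mono dist_bounded) auto
          finally show ?thesis by (simp add: mult_ac)
        qed
      qed
      also have "\<dots> = K * dist W V * ((e t - 1) / (2 * K))"
        using LBINT_Ioc_exp[of s t "2 * K"] t K by (simp add: e_def)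
      also have "\<dots> = 1/2 * dist W V * (e t - 1)" using K by simp
      also have "\<dots> \<le> 1/2 * dist W V * e t"
        by (intro mult_left_mono) auto
      finally have "\<bar>(LBINT r:{s<..t}. f r (e r * W r)) - (LBINT r:{s<..t}. f r (e r * V r))\<bar> / e t
          \<le> 1/2 * dist W V"
        using e_pos[of t] by (simp add: pos_divide_le_eq)
      moreover have "P W t - P V t
          = ((LBINT r:{s<..t}. f r (e r * W r)) - (LBINT r:{s<..t}. f r (e r * V r))) / e t"
        by (simp add: P_def diff_divide_distrib add_divide_distrib)
      ultimately show ?thesis using e_pos[of t] by (simp add: abs_divide)
    qed
    show "dist (Bcontfun (clip s T (P W))) (Bcontfun (clip s T (P V))) \<le> 1/2 * dist W V"
    proof (rule dist_bound)
      fix t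
      have "max s (min T t) \<in> {s..T}" using st by auto
      from main[OF this]
      show "dist (apply_bcontfun (Bcontfun (clip s T (P W))) t) (apply_bcontfun (Bcontfun (clip s T (P V))) t)
          \<le> 1/2 * dist W V"
        unfolding app by (simp add: clip_def dist_real_def)
    qed
  qed auto
  then obtain W where W: "Bcontfun (clip s T (P (apply_bcontfun W))) = W" by blast
  have W_eq: "apply_bcontfun W t = P (apply_bcontfun W) t" if "t \<in> {s..T}" for t
    using app[of W] clip_eq[OF that] unfolding W by metis
  have "volterra f s T g (\<lambda>t. e t * apply_bcontfun W t)"
    unfolding volterra_def
  proof (intro conjI eW ballI)
    fix t assume "t \<in> {s..T}"
    then show "e t * apply_bcontfun W t = g t + (LBINT r:{s<..t}. f r (e r * apply_bcontfun W r))"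
      using W_eq[of t] e_pos[of t] by (simp add: P_def field_simps)
  qed
  then show ?thesis by blast
qed

lemma volterra_stability:
  assumes Z: "volterra f s T g Z" and Z': "volterra f s T g' Z'"
    and A: "\<And>t. t \<in> {s..T} \<Longrightarrow> \<bar>g' t - g t\<bar> \<le> A" and t: "t \<in> {s..T}"
  shows "\<bar>Z' t - Z t\<bar> \<le> 2 * A * exp (2 * K * (t - s))"
proof (rule gronwall[where w = "\<lambda>t. \<bar>Z' t - Z t\<bar>" and s=s and T=T and K=K])
  have c: "continuous_on {s..T} Z" "continuous_on {s..T} Z'" using Z Z' by (auto simp: volterra_def)
  then show d: "continuous_on {s..T} (\<lambda>t. \<bar>Z' t - Z t\<bar>)" by (intro continuous_intros)
  fix t assume t: "t \<in> {s..T}"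
  have int: "set_integrable lborel {s<..t} (\<lambda>r. f r (Z r))" "set_integrable lborel {s<..t} (\<lambda>r. f r (Z' r))"
    using t c by (auto intro: set_integrable_drift)
  have "Z' t - Z t = g' t - g t + (LBINT r:{s<..t}. f r (Z' r) - f r (Z r))"
    using Z Z' t int by (simp add: volterra_def set_integral_diff)
  also have "\<bar>\<dots>\<bar> \<le> A + \<bar>LBINT r:{s<..t}. f r (Z' r) - f r (Z r)\<bar>"
    using A[OF t] by linarith
  also have "\<bar>LBINT r:{s<..t}. f r (Z' r) - f r (Z r)\<bar> \<le> (LBINT r:{s<..t}. \<bar>f r (Z' r) - f r (Z r)\<bar>)"
    using set_integral_norm_bound[OF set_integral_diff(1)[OF int(2,1)]] by simp
  also have "\<dots> \<le> (LBINT r:{s<..t}. K * \<bar>Z' r - Z r\<bar>)"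
    using t by (intro set_integral_mono set_integrable_abs set_integral_diff(1) int Lipschitz
        set_integrable_mult_right set_integrable_Ioc_continuous_on continuous_on_subset[OF d]) auto
  finally show "\<bar>Z' t - Z t\<bar> \<le> A + K * (LBINT r:{s<..t}. \<bar>Z' r - Z r\<bar>)" by simp
qed (use K t in auto)

lemma volterra_unique:
  assumes "volterra f s T g Z" "volterra f s T g Z'" "t \<in> {s..T}"
  shows "Z' t = Z t"
  using volterra_stability[OF assms(1,2) _ assms(3), of 0] by simp

text \<open>Gronwall for the error \<open>Z' - Z - \<epsilon> * U\<close>. By
  \<open>volterra_stability\<close>, \<open>Z' - Z\<close> is of order \<epsilon>, so the Taylor
  remainder of \<open>f\<close> is of order \<open>\<epsilon>\<^sup>2\<close>; the squared factor is
  the stability constant. Stating the bound with \<open>D\<close> instead of \<open>T - s\<close>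
  allows one constant for all starting times.\<close>

lemma volterra_linearisation:
  assumes Z: "volterra f s T g Z" and Z': "volterra f s T (\<lambda>t. g t + \<epsilon> * k t) Z'"
    and U: "volterra (\<lambda>r u. f' r (Z r) * u) s T k U"
    and H: "\<And>t. t \<in> {s..T} \<Longrightarrow> \<bar>k t\<bar> \<le> H" and D: "T - s \<le> D"
    and t: "t \<in> {s..T}"
  shows "\<bar>Z' t - Z t - \<epsilon> * U t\<bar>
      \<le> 2 * (K * (2 * H * exp (2 * K * D))\<^sup>2 * D) * exp (2 * K * D) * \<epsilon>\<^sup>2"
proof -
  define A where "A = K * (2 * H * exp (2 * K * D))\<^sup>2 * D * \<epsilon>\<^sup>2"
  have D0: "D \<ge> 0" using D t by auto
  have H0: "H \<ge> 0" using H[OF t] by auto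
  have c: "continuous_on {s..T} Z" "continuous_on {s..T} Z'" "continuous_on {s..T} U"
    using Z Z' U by (auto simp: volterra_def)
  have stab: "(Z' r - Z r)\<^sup>2 \<le> (2 * H * exp (2 * K * D))\<^sup>2 * \<epsilon>\<^sup>2" if r: "r \<in> {s..T}" for r
  proof -
    have "\<bar>Z' r - Z r\<bar> \<le> 2 * (\<bar>\<epsilon>\<bar> * H) * exp (2 * K * (r - s))"
      using H by (intro volterra_stability[OF Z Z' _ r]) (auto simp: abs_mult intro!: mult_left_mono)
    also have "\<dots> \<le> 2 * (\<bar>\<epsilon>\<bar> * H) * exp (2 * K * D)"
      using r D K H0 by (intro mult_left_mono) auto
    finally have "\<bar>Z' r - Z r\<bar> \<le> \<bar>2 * H * exp (2 * K * D) * \<epsilon>\<bar>"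
      using H0 by (simp add: abs_mult mult_ac)
    then have "\<bar>Z' r - Z r\<bar>\<^sup>2 \<le> \<bar>2 * H * exp (2 * K * D) * \<epsilon>\<bar>\<^sup>2"
      by (intro power_mono) auto
    then show ?thesis by (simp add: power_mult_distrib)
  qed
  have "\<bar>Z' t - Z t - \<epsilon> * U t\<bar> \<le> 2 * A * exp (2 * K * (t - s))"
  proof (rule gronwall[where w = "\<lambda>t. \<bar>Z' t - Z t - \<epsilon> * U t\<bar>" and s=s and T=T and K=K])
    show d: "continuous_on {s..T} (\<lambda>t. \<bar>Z' t - Z t - \<epsilon> * U t\<bar>)" by (intro continuous_intros c)
    fix t assume t: "t \<in> {s..T}"
    have int: "set_integrable lborel {s<..t} (\<lambda>r. f r (Z r))" "set_integrable lborel {s<..t} (\<lambda>r. f r (Z' r))"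
      "set_integrable lborel {s<..t} (\<lambda>r. f' r (Z r) * U r)"
      using t c by (auto intro: set_integrable_drift set_integrable_linear)
    have int': "set_integrable lborel {s<..t} (\<lambda>r. f r (Z' r) - f r (Z r) - \<epsilon> * (f' r (Z r) * U r))"
      by (intro set_integral_diff(1) int set_integrable_mult_right)
    have eq: "Z' t - Z t - \<epsilon> * U t = (LBINT r:{s<..t}. f r (Z' r) - f r (Z r) - \<epsilon> * (f' r (Z r) * U r))"
      using Z Z' U t int by (simp add: volterra_def set_integral_diff algebra_simps)
    have "\<bar>Z' t - Z t - \<epsilon> * U t\<bar> \<le> (LBINT r:{s<..t}. \<bar>f r (Z' r) - f r (Z r) - \<epsilon> * (f' r (Z r) * U r)\<bar>)"
      unfolding eq using set_integral_norm_bound[OF int'] by simp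
    also have "\<dots> \<le> (LBINT r:{s<..t}. K * (2 * H * exp (2 * K * D))\<^sup>2 * \<epsilon>\<^sup>2 + K * \<bar>Z' r - Z r - \<epsilon> * U r\<bar>)"
    proof (rule set_integral_mono)
      show "set_integrable lborel {s<..t}
          (\<lambda>r. K * (2 * H * exp (2 * K * D))\<^sup>2 * \<epsilon>\<^sup>2 + K * \<bar>Z' r - Z r - \<epsilon> * U r\<bar>)"
      proof -
        have "continuous_on {s..t} (\<lambda>r. \<bar>Z' r - Z r - \<epsilon> * U r\<bar>)"
          using d by (rule continuous_on_subset) (use t in auto)
        then show ?thesis
          by (intro set_integrable_Ioc_continuous_on continuous_on_add continuous_on_const continuous_on_mult)
      qed
      fix r assume "r \<in> {s<..t}"
      then have r: "r \<in> {s..T}" using t by auto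
      \<comment> \<open>Taylor remainder of \<open>f\<close> at \<open>Z r\<close>, plus the linear
        coefficient applied to the error itself.\<close>
      have "f r (Z' r) - f r (Z r) - \<epsilon> * (f' r (Z r) * U r)
          = (f r (Z' r) - f r (Z r) - f' r (Z r) * (Z' r - Z r)) + f' r (Z r) * (Z' r - Z r - \<epsilon> * U r)"
        by (simp add: algebra_simps)
      also have "\<bar>\<dots>\<bar> \<le> K * (Z' r - Z r)\<^sup>2 + K * \<bar>Z' r - Z r - \<epsilon> * U r\<bar>"
        by (intro order_trans[OF abs_triangle_ineq] add_mono remainder)
          (auto simp: abs_mult intro!: mult_right_mono bounded)
      also have "\<dots> \<le> K * ((2 * H * exp (2 * K * D))\<^sup>2 * \<epsilon>\<^sup>2) + K * \<bar>Z' r - Z r - \<epsilon> * U r\<bar>"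
        using K stab[OF r] by simp
      finally show "\<bar>f r (Z' r) - f r (Z r) - \<epsilon> * (f' r (Z r) * U r)\<bar>
          \<le> K * (2 * H * exp (2 * K * D))\<^sup>2 * \<epsilon>\<^sup>2 + K * \<bar>Z' r - Z r - \<epsilon> * U r\<bar>" by (simp add: mult_ac)
    qed (intro set_integrable_abs int')
    also have "\<dots> = K * (2 * H * exp (2 * K * D))\<^sup>2 * \<epsilon>\<^sup>2 * (t - s)
        + K * (LBINT r:{s<..t}. \<bar>Z' r - Z r - \<epsilon> * U r\<bar>)"
    proof -
      have "set_integrable lborel {s<..t} (\<lambda>r. \<bar>Z' r - Z r - \<epsilon> * U r\<bar>)"
        using t by (intro set_integrable_Ioc_continuous_on continuous_on_subset[OF d]) auto
      then show ?thesis
        using t set_lebesgue_integral_Ioc_const[of s t "K * (2 * H * exp (2 * K * D))\<^sup>2 * \<epsilon>\<^sup>2"]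
        by (subst set_integral_add(2)) (auto intro!: set_integrable_Ioc_continuous_on)
    qed
    finally have "\<bar>Z' t - Z t - \<epsilon> * U t\<bar> \<le> K * (2 * H * exp (2 * K * D))\<^sup>2 * \<epsilon>\<^sup>2 * (t - s)
        + K * (LBINT r:{s<..t}. \<bar>Z' r - Z r - \<epsilon> * U r\<bar>)" .
    moreover have "K * (2 * H * exp (2 * K * D))\<^sup>2 * \<epsilon>\<^sup>2 * (t - s) \<le> K * (2 * H * exp (2 * K * D))\<^sup>2 * \<epsilon>\<^sup>2 * D"
      using K D t by (intro mult_left_mono) auto
    moreover have "\<dots> = A" by (simp add: A_def mult_ac)
    ultimately show "\<bar>Z' t - Z t - \<epsilon> * U t\<bar> \<le> A + K * (LBINT r:{s<..t}. \<bar>Z' r - Z r - \<epsilon> * U r\<bar>)"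
      by linarith
  qed (use K t in auto)
  also have "\<dots> \<le> 2 * A * exp (2 * K * D)"
    using K D D0 t by (intro mult_left_mono) (auto simp: A_def)
  finally show ?thesis by (simp add: A_def mult_ac)
qed

text \<open>The flow property: the response kernel differentiates a flow started at time
  \<open>r\<close> from the current position, and this identifies that flow with the old
  trajectory.\<close>

lemma volterra_restart:
  assumes Z: "volterra f s T g Z" and r: "r \<in> {s..T}"
  shows "volterra f r T (\<lambda>t. Z r + g t - g r) Z"
  unfolding volterra_def
proof (intro conjI ballI)
  have c: "continuous_on {s..T} Z" using Z by (auto simp: volterra_def)
  then show "continuous_on {r..T} Z" by (rule continuous_on_subset) (use r in auto)
  fix t assume t: "t \<in> {r..T}"
  have "Z t = g t + (LBINT v:{s<..t}. f v (Z v))" "Z r = g r + (LBINT v:{s<..r}. f v (Z v))"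
    using Z r t by (auto simp: volterra_def)
  moreover have "(LBINT v:{s<..t}. f v (Z v)) = (LBINT v:{s<..r}. f v (Z v)) + (LBINT v:{r<..t}. f v (Z v))"
    using r t by (intro LBINT_Ioc_split set_integrable_drift[OF c]) auto
  ultimately show "Z t = Z r + g t - g r + (LBINT v:{r<..t}. f v (Z v))" by simp
qed

end

subsection \<open>Linear Volterra equations\<close>

text \<open>Summing over \<open>n\<close> equal steps, \<open>m\<close> telescopes and a factor
  \<open>(t - s) / n\<close> is left, which tends to 0. This takes the place of differentiation:
  \<open>m\<close> may be any increasing function, even one without a density.\<close>

lemma eq_if_superlinear_increments:
  fixes \<phi> m :: "real \<Rightarrow> real"
  assumes st: "s \<le> t"
    and le: "\<And>r u. s \<le> r \<Longrightarrow> r \<le> u \<Longrightarrow> u \<le> t \<Longrightarrow> \<bar>\<phi> u - \<phi> r\<bar> \<le> C * (u - r) * (m u - m r)"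
  shows "\<phi> t = \<phi> s"
proof -
  have "\<bar>\<phi> t - \<phi> s\<bar> \<le> C * (t - s) * (m t - m s) / real n" if "n > 0" for n :: nat
  proof -
    define p where "p i = s + real i * ((t - s) / n)" for i
    have step: "p (Suc i) - p i = (t - s) / n" for i
      unfolding p_def of_nat_Suc distrib_right by simp
    have p: "s \<le> p i" "p i \<le> p (Suc i)" for i
      using st by (auto simp: p_def divide_right_mono mult_right_mono)
    have p_le: "p (Suc i) \<le> t" if "i < n" for i
    proof -
      have "real (Suc i) * ((t - s) / n) \<le> real n * ((t - s) / n)"
        using that st by (intro mult_right_mono) auto
      then show ?thesis using \<open>n > 0\<close> by (simp add: p_def)
    qed
    have ends: "p 0 = s" "p n = t" using that by (auto simp: p_def)
    have "\<phi> t - \<phi> s = (\<Sum>i<n. \<phi> (p (Suc i)) - \<phi> (p i))"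
      using sum_lessThan_telescope[of "\<lambda>i. \<phi> (p i)" n] ends by simp
    also have "\<bar>\<dots>\<bar> \<le> (\<Sum>i<n. C * ((t - s) / n) * (m (p (Suc i)) - m (p i)))"
      using le[OF p p_le] step by (intro order_trans[OF sum_abs sum_mono]) auto
    also have "\<dots> = C * ((t - s) / n) * (m t - m s)"
      using sum_lessThan_telescope[of "\<lambda>i. m (p i)" n] ends
      unfolding sum_distrib_left[symmetric] by simp
    finally show ?thesis by simp
  qed
  then have "\<forall>\<^sub>F n in sequentially. \<bar>\<phi> t - \<phi> s\<bar> \<le> C * (t - s) * (m t - m s) / real n"
    by (intro eventually_mono[OF eventually_gt_at_top[of 0]])
  moreover have "(\<lambda>n. C * (t - s) * (m t - m s) / real n) \<longlonglongrightarrow> 0"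
    by (rule lim_const_over_n)
  ultimately have "\<bar>\<phi> t - \<phi> s\<bar> \<le> 0"
    by (intro tendsto_lowerbound[of _ 0 sequentially]) auto
  then show ?thesis by simp
qed

text \<open>Everything follows from \<open>1 + d \<le> exp d\<close>, used at \<open>d\<close> and
  at \<open>- d\<close>.\<close>

lemma exp_bounds:
  fixes d :: real
  shows "\<bar>exp d - 1\<bar> \<le> \<bar>d\<bar> * exp \<bar>d\<bar>" "\<bar>exp d - 1 - d\<bar> \<le> d\<^sup>2 * exp \<bar>d\<bar>"
proof -
  have "exp d * (1 - d) \<le> exp d * exp (- d)"
    using exp_ge_add_one_self[of "- d"] by (intro mult_left_mono) auto
  then have 1: "exp d - 1 \<le> d * exp d" by (simp add: algebra_simps flip: exp_add)
  have 2: "1 + d \<le> exp d" by (rule exp_ge_add_one_self)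
  show le: "\<bar>exp d - 1\<bar> \<le> \<bar>d\<bar> * exp \<bar>d\<bar>"
  proof (cases "d \<ge> 0")
    case True
    then show ?thesis using 1 by simp
  next
    case False
    then have "exp d < 1" by simp
    then have "\<bar>exp d - 1\<bar> \<le> \<bar>d\<bar> * 1" using 2 by linarith
    also have "\<dots> \<le> \<bar>d\<bar> * exp \<bar>d\<bar>" by (intro mult_left_mono) auto
    finally show ?thesis .
  qed
  have "\<bar>exp d - 1 - d\<bar> = exp d - 1 - d" using 2 by linarith
  also have "\<dots> \<le> d * (exp d - 1)" using 1 by (simp add: algebra_simps)
  also have "\<dots> \<le> \<bar>d\<bar> * \<bar>exp d - 1\<bar>" by (metis abs_ge_self abs_mult)
  also have "\<dots> \<le> \<bar>d\<bar> * (\<bar>d\<bar> * exp \<bar>d\<bar>)" by (intro mult_left_mono le) auto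
  finally show "\<bar>exp d - 1 - d\<bar> \<le> d\<^sup>2 * exp \<bar>d\<bar>"
    by (simp add: power2_eq_square flip: mult.assoc)
qed

lemma abs_set_integral_le:
  fixes w :: "'a \<Rightarrow> real"
  assumes "set_integrable M A w" "A \<in> sets M" "emeasure M A < \<infinity>" "\<And>r. r \<in> A \<Longrightarrow> \<bar>w r\<bar> \<le> B"
  shows "\<bar>LINT r:A|M. w r\<bar> \<le> B * measure M A"
proof -
  have c: "set_integrable M A (\<lambda>_. c::real)" for c
    using assms unfolding set_integrable_def
    by (auto intro!: integrable_mult_left integrable_real_indicator)
  have eq: "(LINT r:A|M. c) = c * measure M A" for c :: real
    using assms(2,3) sets.sets_into_space[OF assms(2)]
    by (simp add: set_lebesgue_integral_def Int_absorb2)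
  have "(LINT r:A|M. w r) \<le> (LINT r:A|M. B)"
    using assms(4) by (intro set_integral_mono assms(1) c) fastforce
  moreover have "(LINT r:A|M. - B) \<le> (LINT r:A|M. w r)"
    using assms(4) by (intro set_integral_mono assms(1) c) fastforce
  ultimately show ?thesis
    unfolding eq by auto
qed

lemma set_integrable_Ioc_continuous_on':
  fixes w :: "real \<Rightarrow> real"
  assumes "continuous_on {s..t} w" "sets M = sets borel" "emeasure M {s<..t} < \<infinity>"
  shows "set_integrable M {s<..t} w"
proof -
  obtain B where B: "\<And>r. r \<in> {s..t} \<Longrightarrow> \<bar>w r\<bar> \<le> B"
    using continuous_on_Icc_bounded[OF assms(1)] by blast
  have "continuous_on {s<..t} w" using assms(1) by (rule continuous_on_subset) auto
  then have meas: "(\<lambda>r. indicator {s<..t} r *\<^sub>R w r) \<in> borel_measurable borel"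
    by (intro borel_measurable_continuous_on_indicator) auto
  \<comment> \<open>The indicator is doubled because the criterion wants a globally measurable
    function, while \<open>w\<close> is continuous on \<open>{s..t}\<close> only.\<close>
  have "integrable M (\<lambda>r. indicator {s<..t} r *\<^sub>R (indicator {s<..t} r *\<^sub>R w r))"
  proof (rule integrableI_bounded_set_indicator[where B=B])
    show "(\<lambda>r. indicator {s<..t} r *\<^sub>R w r) \<in> borel_measurable M"
      using meas by (subst measurable_cong_sets[OF assms(2) refl])
    show "AE r in M. r \<in> {s<..t} \<longrightarrow> norm (indicator {s<..t} r *\<^sub>R w r) \<le> B"
      using B by (intro AE_I2) auto
  qed (use assms in auto)
  also have "(\<lambda>r. indicator {s<..t} r *\<^sub>R (indicator {s<..t} r *\<^sub>R w r)) = (\<lambda>r. indicator {s<..t} r *\<^sub>R w r)"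
    by (auto split: split_indicator)
  finally show ?thesis by (simp add: set_integrable_def)
qed

lemma set_integral_Ioc_split:
  fixes w :: "real \<Rightarrow> real"
  assumes "s \<le> r" "r \<le> t" "set_integrable M {s<..t} w" "sets M = sets borel"
  shows "(LINT v:{s<..t}|M. w v) = (LINT v:{s<..r}|M. w v) + (LINT v:{r<..t}|M. w v)"
proof -
  have "{s<..t} = {s<..r} \<union> {r<..t}" using assms by auto
  moreover have "set_integrable M {s<..r} w" "set_integrable M {r<..t} w"
    by (rule set_integrable_subset[OF assms(3)]; use assms in auto)+
  ultimately show ?thesis by (simp add: set_integral_Un)
qed

section \<open>Linear equations with a bounded measurable coefficient\<close>

context
  fixes \<alpha> :: "real \<Rightarrow> real" and K s T :: real
  assumes \<alpha>[measurable]: "\<alpha> \<in> borel_measurable borel" and \<alpha>_le: "\<And>r. \<bar>\<alpha> r\<bar> \<le> K" and sT: "s \<le> T"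
begin

text \<open>The fundamental solution of the linear equation with value 1 at time \<open>s\<close>;
  ratios \<open>propagator t / propagator r\<close> carry a unit impulse from time \<open>r\<close>
  to time \<open>t\<close>.\<close>

definition propagator :: "real \<Rightarrow> real" where
  "propagator t = exp (LBINT r:{s<..t}. \<alpha> r)"

text \<open>Bounds on \<open>[s,T]\<close> the propagator, its reciprocal and its ratios.\<close>

private definition "M = exp (K * (T - s))"

lemma propagator_pos: "propagator t > 0"
  by (simp add: propagator_def)

lemma propagator_self: "propagator s = 1"
  by (simp add: propagator_def set_lebesgue_integral_def)

private lemma K0: "K \<ge> 0" using \<alpha>_le[of 0] by auto

private lemma M1: "M \<ge> 1" using K0 sT by (simp add: M_def)

private lemma meas: "set_borel_measurable lborel {r<..u} \<alpha>"
  by (simp add: set_borel_measurable_def)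

private lemma int_le: "r \<le> u \<Longrightarrow> \<bar>LBINT v:{r<..u}. \<alpha> v\<bar> \<le> K * (u - r)"
  by (intro abs_LBINT_Ioc_le meas \<alpha>_le)

lemma propagator_split:
  assumes "s \<le> r" "r \<le> u"
  shows "propagator u = propagator r * exp (LBINT v:{r<..u}. \<alpha> v)"
  using LBINT_Ioc_split[OF assms set_integrable_Ioc_bounded[OF meas \<alpha>_le]]
  by (simp add: propagator_def exp_add)

lemma continuous_on_propagator: "continuous_on {s..T} propagator"
  unfolding propagator_def
  by (intro continuous_intros continuous_on_LBINT_Ioc[where B=K] meas \<alpha>_le)

private lemma exp_int_le:
  assumes "s \<le> r" "r \<le> u" "u \<le> T"
  shows "\<bar>exp (LBINT v:{r<..u}. \<alpha> v) - 1\<bar> \<le> K * M * (u - r)"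
    "\<bar>exp (LBINT v:{r<..u}. \<alpha> v) - 1 - (LBINT v:{r<..u}. \<alpha> v)\<bar> \<le> K\<^sup>2 * M * (u - r)\<^sup>2"
    "exp \<bar>LBINT v:{r<..u}. \<alpha> v\<bar> \<le> M"
proof -
  let ?d = "LBINT v:{r<..u}. \<alpha> v"
  have d: "\<bar>?d\<bar> \<le> K * (u - r)" using int_le assms by auto
  also have "\<dots> \<le> K * (T - s)" using assms K0 by (intro mult_left_mono) auto
  finally show e: "exp \<bar>?d\<bar> \<le> M" by (simp add: M_def)
  have "\<bar>?d\<bar> * exp \<bar>?d\<bar> \<le> (K * (u - r)) * M"
    using d e assms K0 by (intro mult_mono) auto
  then show "\<bar>exp ?d - 1\<bar> \<le> K * M * (u - r)"
    using exp_bounds(1)[of ?d] by (simp add: mult_ac)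
  have "?d\<^sup>2 \<le> (K * (u - r))\<^sup>2"
    using d by (metis abs_ge_zero power2_abs power_mono)
  then have "?d\<^sup>2 * exp \<bar>?d\<bar> \<le> (K * (u - r))\<^sup>2 * M"
    using e by (intro mult_mono) auto
  then show "\<bar>exp ?d - 1 - ?d\<bar> \<le> K\<^sup>2 * M * (u - r)\<^sup>2"
    using exp_bounds(2)[of ?d] by (simp add: mult_ac power_mult_distrib)
qed

private lemma propagator_le:
  assumes "s \<le> r" "r \<le> T"
  shows "propagator r \<le> M" "1 / propagator r \<le> M"
proof -
  let ?d = "LBINT v:{s<..r}. \<alpha> v"
  have "exp ?d \<le> exp \<bar>?d\<bar>" "exp (- ?d) \<le> exp \<bar>?d\<bar>" by auto
  then show "propagator r \<le> M" "1 / propagator r \<le> M"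
    using order_trans[OF _ exp_int_le(3)[of s r]] assms
    by (auto simp: propagator_def exp_minus divide_inverse simp del: exp_le_cancel_iff)
qed

lemma set_integrable_mult_continuous_on:
  assumes "continuous_on {s..T} w" "s \<le> r" "u \<le> T"
  shows "set_integrable lborel {r<..u} (\<lambda>v. \<alpha> v * w v)"
proof -
  have w: "continuous_on {r..u} w"
    using assms(1) by (rule continuous_on_subset) (use assms in auto)
  have "(\<lambda>v. \<alpha> v * (indicator {r<..u} v *\<^sub>R w v)) \<in> borel_measurable lborel"
    using set_borel_measurable_Ioc_continuous_on[OF w]
    unfolding set_borel_measurable_def by measurable
  also have "(\<lambda>v. \<alpha> v * (indicator {r<..u} v *\<^sub>R w v)) = (\<lambda>v. indicator {r<..u} v *\<^sub>R (\<alpha> v * w v))"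
    by (auto split: split_indicator)
  finally have m: "set_borel_measurable lborel {r<..u} (\<lambda>v. \<alpha> v * w v)"
    by (simp add: set_borel_measurable_def)
  obtain B where "\<And>v. v \<in> {r..u} \<Longrightarrow> \<bar>w v\<bar> \<le> B"
    using continuous_on_Icc_bounded[OF w] by blast
  then show ?thesis
    by (intro set_integrable_Ioc_bounded[OF m, where B = "K * B"])
      (auto simp: abs_mult intro!: mult_mono \<alpha>_le K0)
qed

text \<open>The defect of the integral equation has increments of second order in time: one
  contribution is the quadratic remainder of the exponential, the other the cost of freezing the
  propagator at the left endpoint inside the integral.\<close>

lemma volterra_propagator: "volterra (\<lambda>r u. \<alpha> r * u) s T (\<lambda>_. 1) propagator"
  unfolding volterra_def
proof (intro conjI ballI continuous_on_propagator)
  fix t assume t: "t \<in> {s..T}"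
  let ?E = propagator
  define \<phi> where "\<phi> t = ?E t - 1 - (LBINT v:{s<..t}. \<alpha> v * ?E v)" for t
  have "\<phi> t = \<phi> s"
  proof (rule eq_if_superlinear_increments[where \<phi> = \<phi> and s = s and t = t and C = "2 * K\<^sup>2 * M\<^sup>2" and m = "\<lambda>v. v"])
    fix r u assume ru: "s \<le> r" "r \<le> u" "u \<le> t"
    have uT: "u \<le> T" using ru t by auto
    let ?d = "LBINT v:{r<..u}. \<alpha> v"
    have E_r: "0 < ?E r" "?E r \<le> M" using propagator_pos propagator_le(1) ru t by auto
    have int: "set_integrable lborel {r<..u} (\<lambda>v. \<alpha> v * w v)" if "continuous_on {s..T} w" for w
      using set_integrable_mult_continuous_on[OF that] ru t by auto
    have intd: "set_integrable lborel {r<..u} (\<lambda>v. \<alpha> v * (?E v - ?E r))"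
      by (intro int continuous_intros continuous_on_propagator)
    have c: "(LBINT v:{r<..u}. \<alpha> v * ?E r) = ?E r * ?d"
      by (simp add: mult.commute)
    have "(LBINT v:{r<..u}. \<alpha> v * ?E v) = (LBINT v:{r<..u}. \<alpha> v * (?E v - ?E r) + \<alpha> v * ?E r)"
      by (simp add: algebra_simps)
    also have "\<dots> = (LBINT v:{r<..u}. \<alpha> v * (?E v - ?E r)) + ?E r * ?d"
      unfolding c[symmetric] by (intro set_integral_add(2) intd int continuous_intros)
    finally have split: "(LBINT v:{r<..u}. \<alpha> v * ?E v) = (LBINT v:{r<..u}. \<alpha> v * (?E v - ?E r)) + ?E r * ?d" .
    have "(LBINT v:{s<..u}. \<alpha> v * ?E v) = (LBINT v:{s<..r}. \<alpha> v * ?E v) + (LBINT v:{r<..u}. \<alpha> v * ?E v)"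
      using ru t by (intro LBINT_Ioc_split set_integrable_mult_continuous_on continuous_on_propagator) auto
    then have eq: "\<phi> u - \<phi> r = ?E r * (exp ?d - 1 - ?d) - (LBINT v:{r<..u}. \<alpha> v * (?E v - ?E r))"
      unfolding \<phi>_def split using propagator_split[of r u] ru by (simp add: algebra_simps)
    have "\<bar>?E r * (exp ?d - 1 - ?d)\<bar> \<le> M * (K\<^sup>2 * M * (u - r)\<^sup>2)"
      unfolding abs_mult using E_r exp_int_le(2)[OF ru(1,2) uT] M1 by (intro mult_mono) auto
    moreover have "\<bar>LBINT v:{r<..u}. \<alpha> v * (?E v - ?E r)\<bar> \<le> (K * (M * (K * M * (u - r)))) * (u - r)"
    proof (rule abs_LBINT_Ioc_le[OF ru(2)])
      show "set_borel_measurable lborel {r<..u} (\<lambda>v. \<alpha> v * (?E v - ?E r))"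
        using intd unfolding set_integrable_def set_borel_measurable_def by auto
      fix v assume v: "v \<in> {r<..u}"
      have "?E v - ?E r = ?E r * (exp (LBINT v:{r<..v}. \<alpha> v) - 1)"
        using propagator_split[of r v] v ru by (simp add: algebra_simps)
      also have "\<bar>\<dots>\<bar> \<le> M * (K * M * (v - r))"
        unfolding abs_mult using E_r exp_int_le(1)[of r v] v ru uT M1 by (intro mult_mono) auto
      also have "\<dots> \<le> M * (K * M * (u - r))"
        using M1 K0 v by (intro mult_left_mono) auto
      finally show "\<bar>\<alpha> v * (?E v - ?E r)\<bar> \<le> K * (M * (K * M * (u - r)))"
        unfolding abs_mult using \<alpha>_le K0 by (intro mult_mono) auto
    qed
    ultimately have "\<bar>\<phi> u - \<phi> r\<bar> \<le> M * (K\<^sup>2 * M * (u - r)\<^sup>2) + (K * (M * (K * M * (u - r)))) * (u - r)"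
      unfolding eq by linarith
    then show "\<bar>\<phi> u - \<phi> r\<bar> \<le> 2 * K\<^sup>2 * M\<^sup>2 * (u - r) * (u - r)"
      by (simp add: power2_eq_square algebra_simps)
  qed (use t in auto)
  then show "?E t = 1 + (LBINT r:{s<..t}. \<alpha> r * ?E r)"
    by (simp add: \<phi>_def propagator_self set_lebesgue_integral_def)
qed

lemma propagator_diff:
  assumes "s \<le> r" "r \<le> u" "u \<le> T"
  shows "propagator u - propagator r = (LBINT v:{r<..u}. \<alpha> v * propagator v)"
proof -
  have "propagator t = 1 + (LBINT v:{s<..t}. \<alpha> v * propagator v)" if "t \<in> {s..T}" for t
    using volterra_propagator that by (simp add: volterra_def)
  from this[of u] this[of r] show ?thesis
    using assms LBINT_Ioc_split[of s r u "\<lambda>v. \<alpha> v * propagator v"]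
      set_integrable_mult_continuous_on[OF continuous_on_propagator] by auto
qed

lemma volterra_propagator_restart:
  assumes "r \<in> {s..T}"
  shows "volterra (\<lambda>v u. \<alpha> v * u) r T (\<lambda>_. 1) (\<lambda>t. propagator t / propagator r)"
  unfolding volterra_def
proof (intro conjI ballI)
  show "continuous_on {r..T} (\<lambda>t. propagator t / propagator r)"
    using propagator_pos[of r] assms
    by (intro continuous_intros continuous_on_subset[OF continuous_on_propagator]) auto
  fix t assume "t \<in> {r..T}"
  then have "propagator t - propagator r = (LBINT v:{r<..t}. \<alpha> v * propagator v)"
    using assms by (intro propagator_diff) auto
  moreover have "(LBINT v:{r<..t}. \<alpha> v * (propagator v / propagator r))
      = (LBINT v:{r<..t}. \<alpha> v * propagator v) / propagator r"
    by simp
  ultimately show "propagator t / propagator r = 1 + (LBINT v:{r<..t}. \<alpha> v * (propagator v / propagator r))"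
    using propagator_pos[of r] by (simp add: field_simps)
qed

text \<open>
  Duhamel's formula. Both \<open>\<integral> \<alpha> E\<close> and \<open>dm\<close> contribute to an increment of the defect only through
  products of an increment of time with an increment of \<open>m\<close>, so the defect vanishes.
\<close>
lemma volterra_duhamel:
  fixes \<mu> :: "real measure" and m :: "real \<Rightarrow> real"
  assumes sets: "sets \<mu> = sets borel"
    and em: "\<And>r u. s \<le> r \<Longrightarrow> r \<le> u \<Longrightarrow> u \<le> T \<Longrightarrow> emeasure \<mu> {r<..u} = ennreal (m u - m r)"
    and mono: "\<And>r u. s \<le> r \<Longrightarrow> r \<le> u \<Longrightarrow> u \<le> T \<Longrightarrow> m r \<le> m u"
    and cont: "continuous_on {s..T} m"
  shows "volterra (\<lambda>v u. \<alpha> v * u) s T (\<lambda>t. m t - m s)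
    (\<lambda>t. LINT r:{s<..t}|\<mu>. propagator t / propagator r)"
proof -
  let ?E = propagator
  \<comment> \<open>Taking \<open>t\<close> out of the integrand separates the two kinds of
    regularity: \<open>?E\<close> is controlled by time, \<open>J\<close> by
    \<open>m\<close>.\<close>
  define J where "J t = (LINT r:{s<..t}|\<mu>. 1 / ?E r)" for t
  define U where "U t = ?E t * J t" for t
  have U_eq: "(LINT r:{s<..t}|\<mu>. ?E t / ?E r) = U t" for t
    by (simp add: U_def J_def flip: set_integral_mult_right)
  have msr: "measure \<mu> {r<..u} = m u - m r" if "s \<le> r" "r \<le> u" "u \<le> T" for r u
    using em[OF that] mono[OF that] by (simp add: measure_def)
  have fin: "emeasure \<mu> {r<..u} < \<infinity>" if "s \<le> r" "r \<le> u" "u \<le> T" for r u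
    using em[OF that] by simp
  have c_inv: "continuous_on {s..T} (\<lambda>r. 1 / ?E r)"
    using propagator_pos by (intro continuous_intros continuous_on_propagator) (auto simp: less_imp_neq[THEN not_sym])
  have int: "set_integrable \<mu> {r<..u} w" if "continuous_on {s..T} w" "s \<le> r" "r \<le> u" "u \<le> T" for w :: "real \<Rightarrow> real" and r u
  proof (rule set_integrable_Ioc_continuous_on'[OF _ sets])
    show "continuous_on {r..u} w" using that(1) by (rule continuous_on_subset) (use that in auto)
    show "emeasure \<mu> {r<..u} < \<infinity>" using that by (intro fin) auto
  qed
  have J_diff: "J u - J r = (LINT v:{r<..u}|\<mu>. 1 / ?E v)" if "s \<le> r" "r \<le> u" "u \<le> T" for r u
    using set_integral_Ioc_split[of s r u \<mu> "\<lambda>v. 1 / ?E v"] int[OF c_inv, of s u] that sets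
    by (simp add: J_def)
  have J_le: "\<bar>J u - J r\<bar> \<le> M * (m u - m r)" if "s \<le> r" "r \<le> u" "u \<le> T" for r u
    unfolding J_diff[OF that] msr[OF that, symmetric]
    using that propagator_le(2) propagator_pos
    by (intro abs_set_integral_le int[OF c_inv] fin) (auto simp: sets abs_of_pos[OF propagator_pos])
  have J_cont: "continuous_on {s..T} J"
    unfolding continuous_on_def
  proof
    fix r assume r: "r \<in> {s..T}"
    have "((\<lambda>u. M * \<bar>m u - m r\<bar>) \<longlongrightarrow> M * \<bar>m r - m r\<bar>) (at r within {s..T})"
      using cont r unfolding continuous_on_def by (intro tendsto_intros) auto
    then have lim: "((\<lambda>u. M * \<bar>m u - m r\<bar>) \<longlongrightarrow> 0) (at r within {s..T})" by simp
    have "\<bar>J u - J r\<bar> \<le> M * \<bar>m u - m r\<bar>" if "u \<in> {s..T}" for u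
      using J_le[of r u] J_le[of u r] mono[of r u] mono[of u r] that r
      by (cases "r \<le> u") (auto simp: abs_minus_commute)
    then have "\<forall>\<^sub>F u in at r within {s..T}. norm (J u - J r) \<le> M * \<bar>m u - m r\<bar>"
      by (auto simp: eventually_at_filter)
    then show "(J \<longlongrightarrow> J r) (at r within {s..T})"
      by (intro LIM_zero_cancel[OF Lim_null_comparison[OF _ lim]])
  qed
  have U_cont: "continuous_on {s..T} U"
    unfolding U_def by (intro continuous_intros continuous_on_propagator J_cont)
  have "volterra (\<lambda>v u. \<alpha> v * u) s T (\<lambda>t. m t - m s) U"
    unfolding volterra_def
  proof (intro conjI U_cont ballI)
    fix t assume t: "t \<in> {s..T}"
    define \<phi> where "\<phi> t = U t - (m t - m s) - (LBINT v:{s<..t}. \<alpha> v * U v)" for t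
    have "\<phi> t = \<phi> s"
    proof (rule eq_if_superlinear_increments[where \<phi> = \<phi> and s = s and t = t and C = "K * M + K * M * M" and m = m])
      fix r u assume ru: "s \<le> r" "r \<le> u" "u \<le> t"
      have uT: "u \<le> T" using ru t by auto
      \<comment> \<open>\<open>?A\<close> is the error of replacing \<open>?E u / ?E v\<close> by 1
        under \<mu>, \<open>?B\<close> that of freezing \<open>J\<close> at \<open>r\<close> in the
        time integral. The product rule
        \<open>U u - U r = ?E u * (J u - J r) + (?E u - ?E r) * J r\<close> makes their difference
        the increment of the defect.\<close>
      let ?A = "LINT v:{r<..u}|\<mu>. ?E u / ?E v - 1"
      let ?B = "LBINT v:{r<..u}. \<alpha> v * (?E v * (J v - J r))"
      have cE: "continuous_on {s..T} (\<lambda>v. ?E u / ?E v)"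
        using propagator_pos by (intro continuous_intros continuous_on_propagator) (auto simp: less_imp_neq[THEN not_sym])
      have "?A = (LINT v:{r<..u}|\<mu>. ?E u * (1 / ?E v)) - (LINT v:{r<..u}|\<mu>. 1)"
        using ru uT cE by (subst set_integral_diff(2)[symmetric]) (auto intro!: int)
      also have "(LINT v:{r<..u}|\<mu>. 1) = m u - m r"
        using fin[OF ru(1,2) uT] msr[OF ru(1,2) uT] sets.sets_into_space[of "{r<..u}" \<mu>] sets
        by (simp add: set_lebesgue_integral_def Int_absorb2)
      also have "(LINT v:{r<..u}|\<mu>. ?E u * (1 / ?E v)) = ?E u * (J u - J r)"
        using J_diff[OF ru(1,2) uT] by (simp only: set_integral_mult_right)
      finally have A: "?A = ?E u * (J u - J r) - (m u - m r)" .
      have intB: "set_integrable lborel {r<..u} (\<lambda>v. \<alpha> v * (?E v * (J v - J r)))"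
        using ru uT by (intro set_integrable_mult_continuous_on continuous_intros continuous_on_propagator J_cont) auto
      have "?B = (LBINT v:{r<..u}. \<alpha> v * U v - (\<alpha> v * ?E v) * J r)"
        by (simp add: U_def algebra_simps)
      also have "\<dots> = (LBINT v:{r<..u}. \<alpha> v * U v) - (LBINT v:{r<..u}. (\<alpha> v * ?E v) * J r)"
        using ru uT by (intro set_integral_diff(2) set_integrable_mult_left set_integrable_mult_continuous_on U_cont
            continuous_on_propagator) auto
      also have "(LBINT v:{r<..u}. (\<alpha> v * ?E v) * J r) = (?E u - ?E r) * J r"
        using propagator_diff[OF ru(1,2) uT] by simp
      finally have B: "?B = (LBINT v:{r<..u}. \<alpha> v * U v) - (?E u - ?E r) * J r" .
      have "(LBINT v:{s<..u}. \<alpha> v * U v) = (LBINT v:{s<..r}. \<alpha> v * U v) + (LBINT v:{r<..u}. \<alpha> v * U v)"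
        using ru uT by (intro LBINT_Ioc_split set_integrable_mult_continuous_on U_cont) auto
      then have eq: "\<phi> u - \<phi> r = ?A - ?B"
        unfolding A B \<phi>_def by (simp add: U_def algebra_simps)
      have "\<bar>?A\<bar> \<le> (K * M * (u - r)) * measure \<mu> {r<..u}"
      proof (rule abs_set_integral_le)
        show "set_integrable \<mu> {r<..u} (\<lambda>v. ?E u / ?E v - 1)"
          using ru uT by (intro int continuous_on_diff cE continuous_on_const) auto
        fix v assume v: "v \<in> {r<..u}"
        have "\<bar>?E u / ?E v - 1\<bar> = \<bar>exp (LBINT w:{v<..u}. \<alpha> w) - 1\<bar>"
          using propagator_split[of v u] propagator_pos[of v] v ru by simp
        also have "\<dots> \<le> K * M * (u - v)"
          using v ru uT by (intro exp_int_le(1)) auto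
        also have "\<dots> \<le> K * M * (u - r)" using v M1 K0 by (intro mult_left_mono) auto
        finally show "\<bar>?E u / ?E v - 1\<bar> \<le> K * M * (u - r)" .
      qed (use fin ru uT in \<open>auto simp: sets\<close>)
      moreover have "\<bar>?B\<bar> \<le> K * (M * (M * (m u - m r))) * (u - r)"
      proof (rule abs_LBINT_Ioc_le[OF ru(2)])
        show "set_borel_measurable lborel {r<..u} (\<lambda>v. \<alpha> v * (?E v * (J v - J r)))"
          using intB unfolding set_integrable_def set_borel_measurable_def by auto
        fix v assume v: "v \<in> {r<..u}"
        have "\<bar>J v - J r\<bar> \<le> M * (m v - m r)" using v ru uT by (intro J_le) auto
        also have "\<dots> \<le> M * (m u - m r)"
          using M1 mono[of v u] v ru uT by (intro mult_left_mono) auto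
        finally have "\<bar>J v - J r\<bar> \<le> M * (m u - m r)" .
        then show "\<bar>\<alpha> v * (?E v * (J v - J r))\<bar> \<le> K * (M * (M * (m u - m r)))"
          unfolding abs_mult using \<alpha>_le K0 M1 propagator_pos[of v] propagator_le(1)[of v] v ru uT
          by (intro mult_mono) auto
      qed
      ultimately have "\<bar>\<phi> u - \<phi> r\<bar> \<le> (K * M * (u - r)) * (m u - m r) + K * (M * (M * (m u - m r))) * (u - r)"
        unfolding eq msr[OF ru(1,2) uT] by linarith
      then show "\<bar>\<phi> u - \<phi> r\<bar> \<le> (K * M + K * M * M) * (u - r) * (m u - m r)"
        by (simp add: algebra_simps)
    qed (use t in auto)
    then show "U t = m t - m s + (LBINT v:{s<..t}. \<alpha> v * U v)"
      by (simp add: \<phi>_def U_def J_def set_lebesgue_integral_def)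
  qed
  then show ?thesis unfolding U_eq .
qed

text \<open>Serves twice: to pass from the Jordan measures to the signed measure, and to reduce
  uniqueness to zero forcing.\<close>

lemma volterra_linear_diff:
  assumes "volterra (\<lambda>v u. \<alpha> v * u) s T k U" "volterra (\<lambda>v u. \<alpha> v * u) s T l V"
  shows "volterra (\<lambda>v u. \<alpha> v * u) s T (\<lambda>t. k t - l t) (\<lambda>t. U t - V t)"
proof -
  have c: "continuous_on {s..T} U" "continuous_on {s..T} V"
    using assms by (auto simp: volterra_def)
  have "(LBINT v:{s<..t}. \<alpha> v * (U v - V v)) = (LBINT v:{s<..t}. \<alpha> v * U v) - (LBINT v:{s<..t}. \<alpha> v * V v)"
    if "t \<in> {s..T}" for t
    using set_integral_diff(2)[OF set_integrable_mult_continuous_on[OF c(1), of s t] set_integrable_mult_continuous_on[OF c(2), of s t]] that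
    by (simp add: algebra_simps)
  then show ?thesis
    using assms by (auto simp: volterra_def intro: continuous_on_diff)
qed

lemma volterra_linear_unique:
  assumes U: "volterra (\<lambda>v u. \<alpha> v * u) s T k U" and V: "volterra (\<lambda>v u. \<alpha> v * u) s T k V"
    and t: "t \<in> {s..T}"
  shows "U t = V t"
proof -
  have W: "volterra (\<lambda>v u. \<alpha> v * u) s T (\<lambda>t. k t - k t) (\<lambda>t. U t - V t)"
    by (rule volterra_linear_diff[OF U V])
  then have c: "continuous_on {s..T} (\<lambda>t. U t - V t)" by (simp add: volterra_def)
  \<comment> \<open>\<open>gronwall\<close> wants a positive rate, and here \<open>K\<close> may be
    0; hence \<open>K + 1\<close>.\<close>
  have "\<bar>U t - V t\<bar> \<le> 2 * 0 * exp (2 * (K + 1) * (t - s))"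
  proof (rule gronwall[where w = "\<lambda>t. \<bar>U t - V t\<bar>" and T=T])
    show "continuous_on {s..T} (\<lambda>t. \<bar>U t - V t\<bar>)" by (intro continuous_intros c)
    fix t assume t: "t \<in> {s..T}"
    have int: "set_integrable lborel {s<..t} (\<lambda>v. \<alpha> v * (U v - V v))"
      using t by (intro set_integrable_mult_continuous_on c) auto
    have "\<bar>U t - V t\<bar> \<le> (LBINT v:{s<..t}. \<bar>\<alpha> v * (U v - V v)\<bar>)"
      using W t set_integral_norm_bound[OF int] by (simp add: volterra_def)
    also have "\<dots> \<le> (LBINT v:{s<..t}. (K + 1) * \<bar>U v - V v\<bar>)"
    proof (intro set_integral_mono set_integrable_abs int)
      have "continuous_on {s..t} (\<lambda>v. \<bar>U v - V v\<bar>)"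
        using t by (intro continuous_intros continuous_on_subset[OF c]) auto
      then show "set_integrable lborel {s<..t} (\<lambda>v. (K + 1) * \<bar>U v - V v\<bar>)"
        by (intro set_integrable_mult_right set_integrable_Ioc_continuous_on)
      show "\<bar>\<alpha> v * (U v - V v)\<bar> \<le> (K + 1) * \<bar>U v - V v\<bar>" for v
        unfolding abs_mult using \<alpha>_le[of v] by (intro mult_right_mono) auto
    qed
    finally show "\<bar>U t - V t\<bar> \<le> 0 + (K + 1) * (LBINT v:{s<..t}. \<bar>U v - V v\<bar>)" by simp
  qed (use K0 t in auto)
  then show ?thesis by simp
qed

end

subsection \<open>The Lamperti transform\<close>

text \<open>The remainder is \<open>(f' w - f' z) * (z' - z)\<close> for an intermediate point
  \<open>w\<close>, and \<open>f'\<close> is itself \<open>B\<close>-Lipschitz.\<close>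

lemma
  fixes f f' f'' :: "real \<Rightarrow> real"
  assumes "\<And>z. (f has_real_derivative f' z) (at z)" "\<And>z. (f' has_real_derivative f'' z) (at z)"
    and "\<And>z. \<bar>f' z\<bar> \<le> B" "\<And>z. \<bar>f'' z\<bar> \<le> B"
  shows C2_Lipschitz: "\<bar>f z' - f z\<bar> \<le> B * \<bar>z' - z\<bar>"
    and C2_remainder: "\<bar>f z' - f z - f' z * (z' - z)\<bar> \<le> B * (z' - z)\<^sup>2"
proof -
  \<comment> \<open>The intermediate point is located only by its distance from \<open>z\<close>,
    which covers both orders of \<open>z\<close> and \<open>z'\<close>.\<close>
  have mv: "\<exists>w. g z' - g z = (z' - z) * g' w \<and> \<bar>w - z\<bar> \<le> \<bar>z' - z\<bar>"
    if "\<And>z. (g has_real_derivative g' z) (at z)" for g g' :: "real \<Rightarrow> real" and z z'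
  proof -
    consider "z < z'" | "z' < z" | "z = z'" by linarith
    then show ?thesis
    proof cases
      case 1
      then show ?thesis using MVT2[OF 1, of g g'] that by fastforce
    next
      case 2
      have "\<exists>w>z'. w < z \<and> g z - g z' = (z - z') * g' w"
        using that by (intro MVT2[OF 2])
      then obtain w where "w > z'" "w < z" "g z - g z' = (z - z') * g' w"
        by blast
      then have "g z' - g z = (z' - z) * g' w \<and> \<bar>w - z\<bar> \<le> \<bar>z' - z\<bar>"
        by (simp add: algebra_simps)
      then show ?thesis by blast
    qed auto
  qed
  have lip: "\<bar>g z' - g z\<bar> \<le> B * \<bar>z' - z\<bar>"
    if "\<And>z. (g has_real_derivative g' z) (at z)" "\<And>z. \<bar>g' z\<bar> \<le> B" for g g' :: "real \<Rightarrow> real" and z z'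
    using mv[OF that(1), of z' z] that(2) by (metis abs_mult abs_ge_zero mult.commute mult_right_mono)
  show "\<bar>f z' - f z\<bar> \<le> B * \<bar>z' - z\<bar>" using lip[OF assms(1,3)] .
  obtain w where w: "f z' - f z = (z' - z) * f' w" "\<bar>w - z\<bar> \<le> \<bar>z' - z\<bar>"
    using mv[OF assms(1)] by blast
  have "f z' - f z - f' z * (z' - z) = (f' w - f' z) * (z' - z)"
    using w(1) by (simp add: algebra_simps)
  moreover have "\<bar>(f' w - f' z) * (z' - z)\<bar> \<le> (B * \<bar>w - z\<bar>) * \<bar>z' - z\<bar>"
    unfolding abs_mult by (intro mult_right_mono lip[OF assms(2,4)]) auto
  moreover have "B \<ge> 0" using assms(3)[of 0] by auto
  then have "(B * \<bar>w - z\<bar>) * \<bar>z' - z\<bar> \<le> (B * \<bar>z' - z\<bar>) * \<bar>z' - z\<bar>"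
    using w(2) by (intro mult_right_mono mult_left_mono) auto
  ultimately show "\<bar>f z' - f z - f' z * (z' - z)\<bar> \<le> B * (z' - z)\<^sup>2"
    by (simp add: power2_eq_square mult.assoc flip: abs_mult)
qed

lemma abs_mult_le: "\<bar>a\<bar> \<le> A \<Longrightarrow> \<bar>c\<bar> \<le> C \<Longrightarrow> \<bar>a * c\<bar> \<le> A * C" for a c A C :: real
  unfolding abs_mult by (intro mult_mono) auto

lemma abs_add_le: "\<bar>a\<bar> \<le> A \<Longrightarrow> \<bar>c\<bar> \<le> C \<Longrightarrow> \<bar>a + c\<bar> \<le> A + C" for a c A C :: real
  by linarith

lemma abs_diff_le: "\<bar>a\<bar> \<le> A \<Longrightarrow> \<bar>c\<bar> \<le> C \<Longrightarrow> \<bar>a - c\<bar> \<le> A + C" for a c A C :: real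
  by linarith

text \<open>After division by \<open>\<eta> - \<xi>\<close> the error is a bounded quotient times
  \<open>F \<eta> - F \<xi>\<close>, hence vanishes in the limit. It is used with \<open>F\<close>
  the Lamperti map, for the starting point, and with the identity, for \<epsilon>.\<close>

lemma has_derivative_of_quadratic_error:
  fixes P F :: "real \<Rightarrow> real"
  assumes F: "(F has_real_derivative D) (at \<xi>)"
    and le: "\<And>\<eta>. \<bar>P \<eta> - P \<xi> - (F \<eta> - F \<xi>) * U\<bar> \<le> C * (F \<eta> - F \<xi>)\<^sup>2"
  shows "(P has_real_derivative D * U) (at \<xi>)"
proof -
  have q: "((\<lambda>\<eta>. (F \<eta> - F \<xi>) / (\<eta> - \<xi>)) \<longlongrightarrow> D) (at \<xi>)"
    using F by (simp add: has_field_derivative_iff)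
  have "((\<lambda>\<eta>. F \<eta> - F \<xi>) \<longlongrightarrow> 0) (at \<xi>)"
    using DERIV_isCont[OF F] by (simp add: isCont_def LIM_zero)
  then have "((\<lambda>\<eta>. C * \<bar>(F \<eta> - F \<xi>) / (\<eta> - \<xi>)\<bar> * \<bar>F \<eta> - F \<xi>\<bar>) \<longlongrightarrow> C * \<bar>D\<bar> * \<bar>0\<bar>) (at \<xi>)"
    by (intro tendsto_intros q)
  then have lim: "((\<lambda>\<eta>. C * \<bar>(F \<eta> - F \<xi>) / (\<eta> - \<xi>)\<bar> * \<bar>F \<eta> - F \<xi>\<bar>) \<longlongrightarrow> 0) (at \<xi>)"
    by simp
  have "\<forall>\<^sub>F \<eta> in at \<xi>. norm ((P \<eta> - P \<xi>) / (\<eta> - \<xi>) - (F \<eta> - F \<xi>) / (\<eta> - \<xi>) * U)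
      \<le> C * \<bar>(F \<eta> - F \<xi>) / (\<eta> - \<xi>)\<bar> * \<bar>F \<eta> - F \<xi>\<bar>"
  proof (rule always_eventually, rule allI)
    fix \<eta>
    have "(P \<eta> - P \<xi>) / (\<eta> - \<xi>) - (F \<eta> - F \<xi>) / (\<eta> - \<xi>) * U
        = (P \<eta> - P \<xi> - (F \<eta> - F \<xi>) * U) / (\<eta> - \<xi>)"
      by (simp add: diff_divide_distrib left_diff_distrib)
    then have "norm ((P \<eta> - P \<xi>) / (\<eta> - \<xi>) - (F \<eta> - F \<xi>) / (\<eta> - \<xi>) * U)
        = \<bar>P \<eta> - P \<xi> - (F \<eta> - F \<xi>) * U\<bar> / \<bar>\<eta> - \<xi>\<bar>"
      by (simp only: real_norm_def abs_divide)
    also have "\<dots> \<le> C * (F \<eta> - F \<xi>)\<^sup>2 / \<bar>\<eta> - \<xi>\<bar>"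
      by (intro divide_right_mono le) auto
    also have "\<dots> = C * \<bar>(F \<eta> - F \<xi>) / (\<eta> - \<xi>)\<bar> * \<bar>F \<eta> - F \<xi>\<bar>"
      by (simp add: power2_eq_square abs_divide flip: abs_mult)
    finally show "norm ((P \<eta> - P \<xi>) / (\<eta> - \<xi>) - (F \<eta> - F \<xi>) / (\<eta> - \<xi>) * U)
        \<le> C * \<bar>(F \<eta> - F \<xi>) / (\<eta> - \<xi>)\<bar> * \<bar>F \<eta> - F \<xi>\<bar>" .
  qed
  from Lim_null_comparison[OF this lim]
  have "((\<lambda>\<eta>. ((P \<eta> - P \<xi>) / (\<eta> - \<xi>) - (F \<eta> - F \<xi>) / (\<eta> - \<xi>) * U)
      + (F \<eta> - F \<xi>) / (\<eta> - \<xi>) * U) \<longlongrightarrow> 0 + D * U) (at \<xi>)"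
    by (intro tendsto_intros q)
  then show ?thesis by (simp add: has_field_derivative_iff)
qed

text \<open>The sum of the bounds in \<open>coeff_bounds\<close>; that it is free of \<open>\<theta>\<close> makes the linearisation error uniform.\<close>
definition coeff_bound :: "real \<Rightarrow> real \<Rightarrow> real \<Rightarrow> real" where
  "coeff_bound L \<sigma>min \<sigma>max = 1 + L * (1 / \<sigma>min) + (L + L * L * (1 / \<sigma>min))
     + (L + (L * L + L * L) * (1 / \<sigma>min) + L * L * L * (1 / \<sigma>min) * (1 / \<sigma>min)) * \<sigma>max
     + 1 / 2 * L + 1 / 2 * (L * \<sigma>max) + 1 / 2 * ((L * \<sigma>max + L * L) * \<sigma>max) + \<sigma>max + L * \<sigma>max"

text \<open>The coefficients at one parameter, with derivatives as named functions rather than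
  iterated \<open>deriv\<close> terms. All constants are free of the parameter.\<close>

locale lamperti =
  fixes b b1 b2 \<sigma> \<sigma>1 \<sigma>2 \<sigma>3 :: "real \<Rightarrow> real" and L \<sigma>min \<sigma>max :: real
  assumes b_deriv: "\<And>y. (b has_real_derivative b1 y) (at y)" "\<And>y. (b1 has_real_derivative b2 y) (at y)"
    and \<sigma>_deriv: "\<And>y. (\<sigma> has_real_derivative \<sigma>1 y) (at y)"
      "\<And>y. (\<sigma>1 has_real_derivative \<sigma>2 y) (at y)" "\<And>y. (\<sigma>2 has_real_derivative \<sigma>3 y) (at y)"
    and b_le: "\<And>y. \<bar>b y\<bar> \<le> L" "\<And>y. \<bar>b1 y\<bar> \<le> L" "\<And>y. \<bar>b2 y\<bar> \<le> L"
    and \<sigma>_le: "\<And>y. \<bar>\<sigma>1 y\<bar> \<le> L" "\<And>y. \<bar>\<sigma>2 y\<bar> \<le> L" "\<And>y. \<bar>\<sigma>3 y\<bar> \<le> L"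
    and \<sigma>_bounds: "0 < \<sigma>min" "\<And>y. \<sigma>min \<le> \<sigma> y" "\<And>y. \<sigma> y \<le> \<sigma>max"
begin

abbreviation "F \<equiv> lampF \<sigma>"
abbreviation "G \<equiv> lampG \<sigma>"
abbreviation "B \<equiv> coeff_bound L \<sigma>min \<sigma>max"

lemma \<sigma>_pos: "0 < \<sigma> y"
  using \<sigma>_bounds(1) \<sigma>_bounds(2)[of y] by linarith

lemma \<sigma>_nonzero: "\<sigma> y \<noteq> 0"
  using \<sigma>_pos[of y] by simp

lemma \<sigma>max_pos: "0 < \<sigma>max"
  using \<sigma>_pos[of 0] \<sigma>_bounds(3)[of 0] by linarith

lemma L_nonneg: "0 \<le> L"
  using b_le(1)[of 0] by auto

lemma F_deriv: "(F has_real_derivative 1 / \<sigma> y) (at y)"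
proof -
  \<comment> \<open>\<open>[a,c]\<close> contains 0, the base point of the integral, and has
    \<open>y\<close> in its interior, so the derivative within it is two-sided.\<close>
  define a where "a = - \<bar>y\<bar> - 1"
  define c where "c = \<bar>y\<bar> + 1"
  have cont: "continuous_on {a..c} (\<lambda>r. 1 / \<sigma> r)"
    using DERIV_isCont[OF \<sigma>_deriv(1)] \<sigma>_nonzero
    by (intro continuous_intros continuous_at_imp_continuous_on) auto
  have "((\<lambda>u. LBINT r=0..u. 1 / \<sigma> r) has_vector_derivative 1 / \<sigma> y) (at y within {a..c})"
    using interval_integral_FTC2[OF _ _ cont, of 0 y] by (simp add: a_def c_def zero_ereal_def)
  moreover have "at y within {a..c} = at y"
    by (rule at_within_interior) (auto simp: a_def c_def)
  ultimately show ?thesis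
    by (simp add: lampF_def[abs_def] has_real_derivative_iff_has_vector_derivative)
qed

text \<open>Since \<open>1 / \<sigma>\<close> is at least \<open>1 / \<sigma>max\<close>. This
  linear growth gives injectivity and surjectivity of \<open>F\<close> and the Lipschitz bound for
  \<open>G\<close>.\<close>

lemma F_diff_ge:
  assumes "y' \<le> y"
  shows "(y - y') / \<sigma>max \<le> F y - F y'"
proof (cases "y' = y")
  case False
  then have "y' < y" using assms by simp
  then obtain w where "F y - F y' = (y - y') * (1 / \<sigma> w)"
    using MVT2[of y' y F "\<lambda>y. 1 / \<sigma> y"] F_deriv by blast
  moreover have "(y - y') * (1 / \<sigma>max) \<le> (y - y') * (1 / \<sigma> w)"
    using assms \<sigma>_pos[of w] \<sigma>_bounds(3)[of w] by (intro mult_left_mono frac_le) auto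
  ultimately show ?thesis by simp
qed simp

lemma bij_F: "bij F"
proof (rule bijI)
  show "inj F"
  proof (rule injI)
    fix y y' assume "F y = F y'"
    then show "y = y'"
      using F_diff_ge[of y y'] F_diff_ge[of y' y] \<sigma>max_pos
      by (cases y y' rule: linorder_cases) (auto simp: divide_le_eq)
  qed
  have F0: "F 0 = 0" by (simp add: lampF_def flip: zero_ereal_def)
  show "surj F"
  proof (rule surjI[of _ "\<lambda>z. SOME y. F y = z"], rule someI_ex)
    fix z
    \<comment> \<open>Chosen so that the growth bound yields \<open>\<bar>z\<bar> \<le> F c\<close>
      and \<open>F (- c) \<le> - \<bar>z\<bar>\<close>.\<close>
    define c where "c = \<bar>z\<bar> * \<sigma>max"
    have "c \<ge> 0" using \<sigma>max_pos by (simp add: c_def)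
    then have "\<bar>z\<bar> \<le> F c" "F (- c) \<le> - \<bar>z\<bar>"
      using F_diff_ge[of 0 c] F_diff_ge[of "- c" 0] F0 \<sigma>max_pos by (auto simp: c_def)
    then have "z \<le> F c" "F (- c) \<le> z" by linarith+
    then show "\<exists>y. F y = z"
      using IVT'[of F "- c" z c] \<open>c \<ge> 0\<close> DERIV_isCont[OF F_deriv]
      by (auto intro: continuous_at_imp_continuous_on)
  qed
qed

lemma F_G [simp]: "F (G z) = z" and G_F [simp]: "G (F y) = y"
  using bij_F unfolding lampG_def by (auto simp: bij_is_surj bij_is_inj surj_f_inv_f)

lemma G_Lipschitz: "\<bar>G z - G z'\<bar> \<le> \<sigma>max * \<bar>z - z'\<bar>"
proof -
  have *: "\<bar>G u - G v\<bar> \<le> \<sigma>max * \<bar>u - v\<bar>" if "G v \<le> G u" for u v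
  proof -
    have "G u - G v \<le> \<sigma>max * (u - v)"
      using F_diff_ge[OF that] \<sigma>max_pos by (simp add: divide_le_eq mult.commute)
    also have "\<dots> \<le> \<sigma>max * \<bar>u - v\<bar>" using \<sigma>max_pos by (intro mult_left_mono) auto
    finally show ?thesis using that by simp
  qed
  show ?thesis
    using *[of z z'] *[of z' z] by (cases "G z \<le> G z'") (auto simp: abs_minus_commute)
qed

lemma G_deriv: "(G has_real_derivative \<sigma> (G z)) (at z)"
proof -
  have "\<sigma>max-lipschitz_on UNIV G"
    using G_Lipschitz \<sigma>max_pos by (intro lipschitz_onI) (auto simp: dist_real_def)
  then have "isCont G z"
    using lipschitz_on_continuous_on continuous_on_eq_continuous_at by blast
  then have "(G has_real_derivative inverse (1 / \<sigma> (G z))) (at z)"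
    using \<sigma>_nonzero F_deriv
    by (intro DERIV_inverse_function[where f = F and a = "z - 1" and b = "z + 1"]) auto
  then show ?thesis by simp
qed

lemma G_deriv2: "((\<lambda>z. \<sigma> (G z)) has_real_derivative \<sigma>1 (G z) * \<sigma> (G z)) (at z)"
  using DERIV_chain2[OF \<sigma>_deriv(1) G_deriv] .

text \<open>First and second derivatives of the transformed coefficients; the factor
  \<open>\<sigma> (G z)\<close> is the derivative of \<open>G\<close>. Reciprocals appear as
  separate factors so that \<open>coeff_bounds\<close> can estimate product by product.\<close>

definition "b_hat1 z = b1 (G z) - b (G z) * \<sigma>1 (G z) * (1 / \<sigma> (G z))"
definition "b_hat2 z = (b2 (G z) - (b1 (G z) * \<sigma>1 (G z) + b (G z) * \<sigma>2 (G z)) * (1 / \<sigma> (G z))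
  + b (G z) * \<sigma>1 (G z) * \<sigma>1 (G z) * (1 / \<sigma> (G z)) * (1 / \<sigma> (G z))) * \<sigma> (G z)"
definition "c_hat1 z = - (1 / 2) * (\<sigma>2 (G z) * \<sigma> (G z))"
definition "c_hat2 z = - (1 / 2) * ((\<sigma>3 (G z) * \<sigma> (G z) + \<sigma>2 (G z) * \<sigma>1 (G z)) * \<sigma> (G z))"

lemma b_hat_deriv: "(b_hat b \<sigma> has_real_derivative b_hat1 z) (at z)"
  unfolding b_hat_def[abs_def] b_hat1_def
  using \<sigma>_nonzero[of "G z"]
  by (auto intro!: derivative_eq_intros DERIV_chain2[OF b_deriv(1) G_deriv] G_deriv2
      simp: field_simps power2_eq_square)

lemma b_hat1_deriv: "(b_hat1 has_real_derivative b_hat2 z) (at z)"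
  unfolding b_hat1_def[abs_def] b_hat2_def
  using \<sigma>_nonzero[of "G z"]
  by (auto intro!: derivative_eq_intros DERIV_chain2[OF b_deriv(1) G_deriv]
      DERIV_chain2[OF b_deriv(2) G_deriv] DERIV_chain2[OF \<sigma>_deriv(2) G_deriv] G_deriv2
      simp: field_simps power2_eq_square)

lemma c_hat_eq: "c_hat \<sigma> = (\<lambda>z. - (1 / 2) * \<sigma>1 (G z))"
  unfolding c_hat_def using DERIV_imp_deriv[OF \<sigma>_deriv(1)] by simp

lemma c_hat_deriv: "(c_hat \<sigma> has_real_derivative c_hat1 z) (at z)"
  unfolding c_hat_eq c_hat1_def
  by (auto intro!: derivative_eq_intros DERIV_chain2[OF \<sigma>_deriv(2) G_deriv])

lemma c_hat1_deriv: "(c_hat1 has_real_derivative c_hat2 z) (at z)"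
  unfolding c_hat1_def[abs_def] c_hat2_def
  by (auto intro!: derivative_eq_intros DERIV_chain2[OF \<sigma>_deriv(3) G_deriv] G_deriv2
      simp: algebra_simps)

lemma coeff_bounds:
  "\<bar>b_hat b \<sigma> z\<bar> \<le> B" "\<bar>b_hat1 z\<bar> \<le> B" "\<bar>b_hat2 z\<bar> \<le> B"
  "\<bar>c_hat \<sigma> z\<bar> \<le> B" "\<bar>c_hat1 z\<bar> \<le> B" "\<bar>c_hat2 z\<bar> \<le> B"
  "\<bar>\<sigma> (G z)\<bar> \<le> B" "\<bar>\<sigma>1 (G z) * \<sigma> (G z)\<bar> \<le> B" "0 < B"
proof -
  have s: "\<bar>\<sigma> y\<bar> \<le> \<sigma>max" "\<bar>1 / \<sigma> y\<bar> \<le> 1 / \<sigma>min" for y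
    using \<sigma>_pos[of y] \<sigma>_bounds(1,2,3) by (auto intro!: frac_le)
  note rules = abs_mult_le abs_add_le abs_diff_le b_le \<sigma>_le s
  have nn: "0 \<le> L" "0 \<le> 1 / \<sigma>min" "0 \<le> \<sigma>max"
    using L_nonneg \<sigma>_bounds(1) \<sigma>max_pos by auto
  have h: "\<bar>- (1 / 2 :: real)\<bar> \<le> 1 / 2" by simp
  define x1 where "x1 = L * (1 / \<sigma>min)"
  define x2 where "x2 = L + L * L * (1 / \<sigma>min)"
  define x3 where "x3 = (L + (L * L + L * L) * (1 / \<sigma>min) + L * L * L * (1 / \<sigma>min) * (1 / \<sigma>min)) * \<sigma>max"
  define x4 where "x4 = 1 / 2 * L"
  define x5 where "x5 = 1 / 2 * (L * \<sigma>max)"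
  define x6 where "x6 = 1 / 2 * ((L * \<sigma>max + L * L) * \<sigma>max)"
  define x8 where "x8 = L * \<sigma>max"
  have B: "B = 1 + x1 + x2 + x3 + x4 + x5 + x6 + \<sigma>max + x8"
    unfolding coeff_bound_def x1_def x2_def x3_def x4_def x5_def x6_def x8_def ..
  have t: "\<bar>b_hat b \<sigma> z\<bar> \<le> x1" "\<bar>b_hat1 z\<bar> \<le> x2" "\<bar>b_hat2 z\<bar> \<le> x3"
    "\<bar>c_hat \<sigma> z\<bar> \<le> x4" "\<bar>c_hat1 z\<bar> \<le> x5" "\<bar>c_hat2 z\<bar> \<le> x6"
    "\<bar>\<sigma> (G z)\<bar> \<le> \<sigma>max" "\<bar>\<sigma>1 (G z) * \<sigma> (G z)\<bar> \<le> x8"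
  proof -
    show "\<bar>b_hat b \<sigma> z\<bar> \<le> x1"
      using abs_mult_le[OF b_le(1) s(2), of "G z" "G z"] by (simp add: b_hat_def x1_def)
    show "\<bar>b_hat1 z\<bar> \<le> x2" unfolding b_hat1_def x2_def by (intro rules)
    show "\<bar>b_hat2 z\<bar> \<le> x3" unfolding b_hat2_def x3_def by (intro rules)
    show "\<bar>c_hat \<sigma> z\<bar> \<le> x4" unfolding c_hat_eq x4_def by (intro rules h)
    show "\<bar>c_hat1 z\<bar> \<le> x5" unfolding c_hat1_def x5_def by (intro rules h)
    show "\<bar>c_hat2 z\<bar> \<le> x6" unfolding c_hat2_def x6_def by (intro rules h)
    show "\<bar>\<sigma> (G z)\<bar> \<le> \<sigma>max" by (rule s)
    show "\<bar>\<sigma>1 (G z) * \<sigma> (G z)\<bar> \<le> x8" unfolding x8_def by (intro rules)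
  qed
  \<comment> \<open>Each summand dominates an absolute value and is thus nonnegative, so the full
    sum dominates each of them.\<close>
  have p: "0 \<le> x1" "0 \<le> x2" "0 \<le> x3" "0 \<le> x4" "0 \<le> x5" "0 \<le> x6" "0 \<le> \<sigma>max" "0 \<le> x8"
    using t by (meson abs_ge_zero order_trans)+
  have le: "x1 \<le> B" "x2 \<le> B" "x3 \<le> B" "x4 \<le> B" "x5 \<le> B" "x6 \<le> B" "\<sigma>max \<le> B" "x8 \<le> B" "0 < B"
    unfolding B using p by linarith+
  show "\<bar>b_hat b \<sigma> z\<bar> \<le> B" "\<bar>b_hat1 z\<bar> \<le> B" "\<bar>b_hat2 z\<bar> \<le> B"
    "\<bar>c_hat \<sigma> z\<bar> \<le> B" "\<bar>c_hat1 z\<bar> \<le> B" "\<bar>c_hat2 z\<bar> \<le> B"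
    "\<bar>\<sigma> (G z)\<bar> \<le> B" "\<bar>\<sigma>1 (G z) * \<sigma> (G z)\<bar> \<le> B" "0 < B"
    by (rule order_trans[OF t(1) le(1)] order_trans[OF t(2) le(2)] order_trans[OF t(3) le(3)]
      order_trans[OF t(4) le(4)] order_trans[OF t(5) le(5)] order_trans[OF t(6) le(6)]
      order_trans[OF t(7) le(7)] order_trans[OF t(8) le(8)] le(9))+
qed

lemma G_remainder: "\<bar>G z' - G z - \<sigma> (G z) * (z' - z)\<bar> \<le> B * (z' - z)\<^sup>2"
  by (rule C2_remainder[OF G_deriv G_deriv2 coeff_bounds(7,8)])

end

subsection \<open>Integrals against finite-variation paths\<close>

lemma bv_integrable_on_continuous_on:
  assumes T: "0 \<le> T" and h: "h \<in> bv_paths T" and st: "0 \<le> s" "s \<le> t" "t \<le> T"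
    and k: "continuous_on {s..t} k"
  shows "bv_integrable_on T h {s<..t} k"
proof -
  have "set_integrable (stieltjes_measure T m) {s<..t} k"
    if m: "continuous_on {0..T} m" "\<And>r s. 0 \<le> r \<Longrightarrow> r \<le> s \<Longrightarrow> s \<le> T \<Longrightarrow> m r \<le> m s" for m
    using emeasure_stieltjes_Ioc[of T m s t] m st T
    by (intro set_integrable_Ioc_continuous_on' k) auto
  then show ?thesis
    unfolding bv_integrable_on_def using jordan_decomposition[OF T h] by auto
qed

text \<open>Both Jordan integrals are estimated by mass times \<open>C\<close>, and the two masses
  add up to \<open>Var h s t\<close>.\<close>

lemma abs_bv_integral_le:
  assumes T: "0 \<le> T" and h: "h \<in> bv_paths T" and st: "0 \<le> s" "s \<le> t" "t \<le> T"
    and k: "bv_integrable_on T h {s<..t} k" and le: "\<And>r. r \<in> {s<..t} \<Longrightarrow> \<bar>k r\<bar> \<le> C"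
  shows "\<bar>bv_integral T h {s<..t} k\<bar> \<le> C * Var h s t"
proof -
  have *: "\<bar>LINT r:{s<..t}|stieltjes_measure T m. k r\<bar> \<le> C * (m t - m s)"
    if int: "set_integrable (stieltjes_measure T m) {s<..t} k"
      and m: "continuous_on {0..T} m" "\<And>r s. 0 \<le> r \<Longrightarrow> r \<le> s \<Longrightarrow> s \<le> T \<Longrightarrow> m r \<le> m s" for m
  proof -
    have "\<bar>LINT r:{s<..t}|stieltjes_measure T m. k r\<bar> \<le> C * measure (stieltjes_measure T m) {s<..t}"
      using emeasure_stieltjes_Ioc[of T m s t] m st T by (intro abs_set_integral_le int le) auto
    also have "measure (stieltjes_measure T m) {s<..t} = m t - m s"
      using m st T by (intro measure_stieltjes_Ioc) auto
    finally show ?thesis .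
  qed
  note J = jordan_decomposition[OF T h]
  have "\<bar>bv_integral T h {s<..t} k\<bar> \<le> C * (pos_var h t - pos_var h s) + C * (neg_var h t - neg_var h s)"
    using k unfolding bv_integral_def bv_integrable_on_def
    by (intro abs_diff_le *) (use J in auto)
  also have "\<dots> = C * Var h s t"
    using J(5)[of s t] st by (simp flip: distrib_left)
  finally show ?thesis .
qed

subsection \<open>The flow along a fixed clock\<close>

text \<open>The constant of \<open>volterra_linearisation\<close> with \<open>D = T\<close>.\<close>

definition response_error :: "real \<Rightarrow> real \<Rightarrow> real \<Rightarrow> real" where
  "response_error K T H = 2 * (K * (2 * H * exp (2 * K * T))\<^sup>2 * T) * exp (2 * K * T)"

lemma shift_0: "shift x h 0 = x"
  by (simp add: shift_def)

text \<open>\<open>bracket_shift\<close> equates the two brackets on \<open>{0..T}\<close> only; the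
  clamping makes that enough.\<close>

lemma stieltjes_measure_cong:
  assumes "0 \<le> T" "\<And>r. r \<in> {0..T} \<Longrightarrow> q r = q' r"
  shows "stieltjes_measure T q = stieltjes_measure T q'"
proof -
  have "(\<lambda>r. q (max 0 (min T r))) = (\<lambda>r. q' (max 0 (min T r)))"
    using assms by auto
  then show ?thesis by (simp add: stieltjes_measure_def)
qed

lemma lampZ_cong:
  assumes "stieltjes_measure T q = stieltjes_measure T q'"
  shows "lampZ T b \<sigma> s y x q = lampZ T b \<sigma> s y x q'"
  unfolding lampZ_def lamperti_solution_def assms ..

text \<open>The clock is kept abstract and enters through its density, so it can stay fixed while
  the path moves.\<close>

locale driven = lamperti b b1 b2 \<sigma> \<sigma>1 \<sigma>2 \<sigma>3 L \<sigma>min \<sigma>max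
  for b b1 b2 \<sigma> \<sigma>1 \<sigma>2 \<sigma>3 :: "real \<Rightarrow> real" and L \<sigma>min \<sigma>max :: real +
  fixes T \<Lambda> :: real and q \<rho> :: "real \<Rightarrow> real"
  assumes T: "0 < T" and \<Lambda>: "0 \<le> \<Lambda>"
    and \<rho>_measurable [measurable]: "\<rho> \<in> borel_measurable borel"
    and \<rho>_bounds: "\<And>r. 0 \<le> \<rho> r" "\<And>r. \<rho> r \<le> \<Lambda>"
    and clock_eq: "stieltjes_measure T q = density lborel (\<lambda>r. ennreal (\<rho> r))"
begin

definition "f r z = b_hat b \<sigma> z + \<rho> r * c_hat \<sigma> z"
definition "f' r z = b_hat1 z + \<rho> r * c_hat1 z"

abbreviation "K \<equiv> B + \<Lambda> * B"

lemma \<rho>_abs_le: "\<bar>\<rho> r\<bar> \<le> \<Lambda>"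
  using \<rho>_bounds[of r] by simp

lemma continuous_coeffs:
  "continuous_on A (b_hat b \<sigma>)" "continuous_on A (c_hat \<sigma>)"
  "continuous_on A b_hat1" "continuous_on A c_hat1"
  by (intro continuous_at_imp_continuous_on ballI DERIV_isCont;
      rule b_hat_deriv c_hat_deriv b_hat1_deriv c_hat1_deriv)+

sublocale drift f f' K
proof
  have [measurable]: "b_hat b \<sigma> \<in> borel_measurable borel" "c_hat \<sigma> \<in> borel_measurable borel"
    "b_hat1 \<in> borel_measurable borel" "c_hat1 \<in> borel_measurable borel"
    by (intro borel_measurable_continuous_onI continuous_coeffs)+
  show "0 < K" using coeff_bounds(9) \<Lambda> by (simp add: add_pos_nonneg)
  show "(\<lambda>r. f r (w r)) \<in> borel_measurable borel" "(\<lambda>r. f' r (w r)) \<in> borel_measurable borel"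
    if [measurable]: "w \<in> borel_measurable borel" for w
    unfolding f_def f'_def by measurable
  show "\<bar>f r z\<bar> \<le> K" "\<bar>f' r z\<bar> \<le> K" for r z
    unfolding f_def f'_def by (intro abs_add_le abs_mult_le \<rho>_abs_le coeff_bounds)+
  fix r z z'
  have b: "\<bar>b_hat b \<sigma> z' - b_hat b \<sigma> z\<bar> \<le> B * \<bar>z' - z\<bar>"
    "\<bar>b_hat b \<sigma> z' - b_hat b \<sigma> z - b_hat1 z * (z' - z)\<bar> \<le> B * (z' - z)\<^sup>2"
    by (rule C2_Lipschitz C2_remainder; rule b_hat_deriv b_hat1_deriv coeff_bounds)+
  have c: "\<bar>c_hat \<sigma> z' - c_hat \<sigma> z\<bar> \<le> B * \<bar>z' - z\<bar>"
    "\<bar>c_hat \<sigma> z' - c_hat \<sigma> z - c_hat1 z * (z' - z)\<bar> \<le> B * (z' - z)\<^sup>2"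
    by (rule C2_Lipschitz C2_remainder; rule c_hat_deriv c_hat1_deriv coeff_bounds)+
  have "f r z' - f r z = (b_hat b \<sigma> z' - b_hat b \<sigma> z) + \<rho> r * (c_hat \<sigma> z' - c_hat \<sigma> z)"
    by (simp add: f_def algebra_simps)
  then show "\<bar>f r z' - f r z\<bar> \<le> K * \<bar>z' - z\<bar>"
    using abs_add_le[OF b(1) abs_mult_le[OF \<rho>_abs_le[of r] c(1)]] by (simp add: algebra_simps)
  have "f r z' - f r z - f' r z * (z' - z) = (b_hat b \<sigma> z' - b_hat b \<sigma> z - b_hat1 z * (z' - z))
      + \<rho> r * (c_hat \<sigma> z' - c_hat \<sigma> z - c_hat1 z * (z' - z))"
    by (simp add: f_def f'_def algebra_simps)
  then show "\<bar>f r z' - f r z - f' r z * (z' - z)\<bar> \<le> K * (z' - z)\<^sup>2"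
    using abs_add_le[OF b(2) abs_mult_le[OF \<rho>_abs_le[of r] c(2)]] by (simp add: algebra_simps)
qed

lemma integral_clock:
  assumes st: "s \<le> t" and w: "continuous_on {s..t} w" and v: "continuous_on {s..t} v"
  shows "(LBINT r=s..t. w r) + (LINT r:{s<..t}|stieltjes_measure T q. v r)
    = (LBINT r:{s<..t}. w r + \<rho> r * v r)"
proof -
  have "(LINT r:{s<..t}|stieltjes_measure T q. v r) = (LBINT r:{s<..t}. \<rho> r * v r)"
    unfolding clock_eq
    by (intro set_integral_density_real \<rho>_measurable \<rho>_bounds set_borel_measurable_Ioc_continuous_on v)
  moreover have "(LBINT r:{s<..t}. w r + \<rho> r * v r) = (LBINT r:{s<..t}. w r) + (LBINT r:{s<..t}. \<rho> r * v r)"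
    by (intro set_integral_add(2) set_integrable_Ioc_continuous_on w
        set_integrable_mult_continuous_on[OF \<rho>_measurable \<rho>_abs_le st v]) auto
  ultimately show ?thesis by (simp add: interval_integral_Ioc[OF st])
qed

lemma lamperti_solution_iff:
  "lamperti_solution T b \<sigma> s y x q Z \<longleftrightarrow> volterra f s T (\<lambda>t. F y + x t - x s) Z"
proof -
  have "(LBINT r=s..t. b_hat b \<sigma> (Z r)) + (LINT r:{s<..t}|stieltjes_measure T q. c_hat \<sigma> (Z r))
      = (LBINT r:{s<..t}. f r (Z r))" if "continuous_on {s..T} Z" "t \<in> {s..T}" for t
  proof -
    have "continuous_on {s..t} Z" using that(1) by (rule continuous_on_subset) (use that in auto)
    then show ?thesis
      unfolding f_def using that
      by (intro integral_clock continuous_on_compose2[OF continuous_coeffs(1)[of UNIV]]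
          continuous_on_compose2[OF continuous_coeffs(2)[of UNIV]]) auto
  qed
  then show ?thesis
    unfolding lamperti_solution_def volterra_def by (auto simp: add.assoc)
qed

text \<open>Justifies the definite description: Picard gives existence, stability gives uniqueness
  on \<open>{s..T}\<close>, and extensionality fixes the values elsewhere.\<close>

lemma lampZ_solves:
  assumes s: "s \<in> {0..T}" and x: "continuous_on {0..T} x"
  shows "volterra f s T (\<lambda>t. F y + x t - x s) (lampZ T b \<sigma> s y x q)"
proof -
  let ?g = "\<lambda>t. F y + x t - x s"
  have restr: "volterra f s T ?g (restrict Z {s..T}) \<longleftrightarrow> volterra f s T ?g Z" for Z
    by (rule volterra_eq_on) simp
  have "continuous_on {s..T} ?g"
    by (intro continuous_intros continuous_on_subset[OF x]) (use s in auto)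
  then obtain Z where "volterra f s T ?g Z"
    using volterra_exists[of s T ?g] s by auto
  then have Z: "volterra f s T ?g (restrict Z {s..T})" by (simp add: restr)
  have "\<exists>!Z. Z \<in> extensional {s..T} \<and> lamperti_solution T b \<sigma> s y x q Z"
  proof (rule ex1I[of _ "restrict Z {s..T}"])
    show "restrict Z {s..T} \<in> extensional {s..T} \<and> lamperti_solution T b \<sigma> s y x q (restrict Z {s..T})"
      unfolding lamperti_solution_iff using Z by simp
    fix Y assume Y: "Y \<in> extensional {s..T} \<and> lamperti_solution T b \<sigma> s y x q Y"
    show "Y = restrict Z {s..T}"
    proof (rule extensionalityI[of _ "{s..T}"])
      show "Y t = restrict Z {s..T} t" if "t \<in> {s..T}" for t
        using volterra_unique[OF Z _ that] Y unfolding lamperti_solution_iff by auto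
    qed (use Y in auto)
  qed
  then have "lamperti_solution T b \<sigma> s y x q (lampZ T b \<sigma> s y x q)"
    unfolding lampZ_def by (rule theI'[THEN conjunct2])
  then show ?thesis unfolding lamperti_solution_iff .
qed

text \<open>Moving the starting point from \<open>y\<close> to \<eta> adds the constant
  \<open>F \<eta> - F y\<close> to the forcing, so this is the linearisation with step
  \<open>F \<eta> - F y\<close> and direction 1. The outer factors are the derivatives of
  \<open>G\<close> and of \<open>F\<close>.\<close>

lemma flow_has_derivative:
  assumes s: "s \<in> {0..T}" and x: "continuous_on {0..T} x" and t: "t \<in> {s..T}"
    and U: "volterra (\<lambda>r u. f' r (lampZ T b \<sigma> s y x q r) * u) s T (\<lambda>_. 1) U"
  shows "((\<lambda>\<xi>. flow T b \<sigma> s t x q \<xi>) has_real_derivative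
    \<sigma> (G (lampZ T b \<sigma> s y x q t)) * (1 / \<sigma> y * U t)) (at y)"
proof -
  let ?Z = "\<lambda>y. lampZ T b \<sigma> s y x q"
  have "((\<lambda>\<xi>. ?Z \<xi> t) has_real_derivative 1 / \<sigma> y * U t) (at y)"
  proof (rule has_derivative_of_quadratic_error[OF F_deriv])
    fix \<eta>
    have "(\<lambda>t. F y + x t - x s + (F \<eta> - F y) * 1) = (\<lambda>t. F \<eta> + x t - x s)" by auto
    then have "volterra f s T (\<lambda>t. F y + x t - x s + (F \<eta> - F y) * 1) (?Z \<eta>)"
      using lampZ_solves[OF s x] by simp
    from volterra_linearisation[OF lampZ_solves[OF s x] this U, of 1 T t]
    show "\<bar>?Z \<eta> t - ?Z y t - (F \<eta> - F y) * U t\<bar>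
        \<le> 2 * (K * (2 * 1 * exp (2 * K * T))\<^sup>2 * T) * exp (2 * K * T) * (F \<eta> - F y)\<^sup>2"
      using s t by auto
  qed
  from DERIV_chain2[OF G_deriv this]
  show ?thesis unfolding flow_def .
qed

section \<open>Response of one trajectory to a perturbation, with the clock held fixed\<close>

context
  fixes x h :: "real \<Rightarrow> real" and s y :: real
  assumes x: "continuous_on {0..T} x" and h: "h \<in> bv_paths T" and s: "s \<in> {0..T}"
begin

definition "Z = lampZ T b \<sigma> s y x q"
text \<open>The linear coefficient along \<open>Z\<close>, extended by \<open>clip\<close> to be
  bounded and measurable on the whole line.\<close>

definition "\<alpha> r = f' r (clip s T Z r)"
definition "E = propagator \<alpha> s"
text \<open>Duhamel's formula for the signed measure dh, taken as the definition, so that the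
  integral representation is immediate and the linearised equation is what remains to be
  proved.\<close>

definition "U t = (LINT r:{s<..t}|stieltjes_measure T (pos_var h). E t / E r)
  - (LINT r:{s<..t}|stieltjes_measure T (neg_var h). E t / E r)"

lemma sT: "s \<le> T" using s by simp

lemma Z_solves: "volterra f s T (\<lambda>t. F y + x t - x s) Z"
  unfolding Z_def by (rule lampZ_solves[OF s x])

lemma Z_continuous: "continuous_on {s..T} Z"
  using Z_solves by (simp add: volterra_def)

lemma \<alpha>_props: "\<alpha> \<in> borel_measurable borel" "\<And>r. \<bar>\<alpha> r\<bar> \<le> K"
  unfolding \<alpha>_def by (intro measurable measurable_clip sT Z_continuous bounded)+

lemma \<alpha>_eq: "r \<in> {s..T} \<Longrightarrow> \<alpha> r = f' r (Z r)"
  by (simp add: \<alpha>_def clip_eq)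

lemma volterra_\<alpha>: "r \<in> {s..T} \<Longrightarrow>
    volterra (\<lambda>r u. f' r (Z r) * u) r T g W \<longleftrightarrow> volterra (\<lambda>r u. \<alpha> r * u) r T g W"
  by (intro volterra_cong) (auto simp: \<alpha>_eq)

lemma E_pos: "E r > 0"
  unfolding E_def by (rule propagator_pos[OF \<alpha>_props sT])

lemma E_continuous: "continuous_on {s..T} E"
  unfolding E_def by (rule continuous_on_propagator[OF \<alpha>_props sT])

lemma E_ratio_continuous: "continuous_on {s..T} (\<lambda>r. E t / E r)"
  using E_pos by (intro continuous_intros E_continuous) (auto simp: less_imp_neq[THEN not_sym])

lemma U_solves: "volterra (\<lambda>r u. f' r (Z r) * u) s T (\<lambda>t. h t - h s) U"
proof -
  have duhamel: "volterra (\<lambda>r u. \<alpha> r * u) s T (\<lambda>t. m t - m s)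
      (\<lambda>t. LINT r:{s<..t}|stieltjes_measure T m. E t / E r)"
    if m: "continuous_on {0..T} m" "\<And>r s. 0 \<le> r \<Longrightarrow> r \<le> s \<Longrightarrow> s \<le> T \<Longrightarrow> m r \<le> m s" for m
    unfolding E_def
  proof (rule volterra_duhamel[OF \<alpha>_props sT])
    fix r u assume "s \<le> r" "r \<le> u" "u \<le> T"
    then show "emeasure (stieltjes_measure T m) {r<..u} = ennreal (m u - m r)" "m r \<le> m u"
      using s T by (auto intro!: emeasure_stieltjes_Ioc m)
  qed (use m s in \<open>auto intro: continuous_on_subset\<close>)
  have "volterra (\<lambda>r u. \<alpha> r * u) s T
      (\<lambda>t. (pos_var h t - pos_var h s) - (neg_var h t - neg_var h s)) U"
    unfolding U_def[abs_def] using jordan_decomposition[OF _ h] T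
    by (intro volterra_linear_diff[OF \<alpha>_props sT] duhamel) auto
  also have "(\<lambda>t. (pos_var h t - pos_var h s) - (neg_var h t - neg_var h s)) = (\<lambda>t. h t - h s)"
    using pos_var_minus_neg_var[of h] by (auto simp: fun_eq_iff algebra_simps)
  finally show ?thesis using volterra_\<alpha> s by auto
qed

lemma U_unique:
  assumes "volterra (\<lambda>r u. f' r (Z r) * u) s T (\<lambda>t. h t - h s) V" "t \<in> {s..T}"
  shows "V t = U t"
proof -
  have "volterra (\<lambda>r u. \<alpha> r * u) s T (\<lambda>t. h t - h s) V" "volterra (\<lambda>r u. \<alpha> r * u) s T (\<lambda>t. h t - h s) U"
    using assms(1) U_solves volterra_\<alpha> s by auto
  then show ?thesis
    by (rule volterra_linear_unique[OF \<alpha>_props sT]) fact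
qed

text \<open>The direction is \<open>h - h s\<close>, whence the bound \<open>2 * H\<close>. Both
  constants are independent of \<open>x\<close>, \<open>s\<close>, \<open>t\<close> and
  \<open>y\<close>.\<close>

lemma Z_response:
  assumes H: "\<And>t. t \<in> {0..T} \<Longrightarrow> \<bar>h t\<bar> \<le> H" and t: "t \<in> {s..T}"
  shows "\<bar>lampZ T b \<sigma> s y (shift x h \<epsilon>) q t - Z t - \<epsilon> * U t\<bar> \<le> response_error K T (2 * H) * \<epsilon>\<^sup>2"
    and "\<bar>lampZ T b \<sigma> s y (shift x h \<epsilon>) q t - Z t\<bar> \<le> (4 * H * exp (2 * K * T)) * \<bar>\<epsilon>\<bar>"
proof -
  have hc: "continuous_on {0..T} h" using h by (simp add: bv_paths_def paths_def)
  have "continuous_on {0..T} (shift x h \<epsilon>)"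
    unfolding shift_def by (intro continuous_intros x hc)
  from lampZ_solves[OF s this, of y]
  have Z': "volterra f s T (\<lambda>t. F y + x t - x s + \<epsilon> * (h t - h s)) (lampZ T b \<sigma> s y (shift x h \<epsilon>) q)"
    by (simp add: shift_def algebra_simps)
  have H': "\<bar>h t - h s\<bar> \<le> 2 * H" if "t \<in> {s..T}" for t
    using H[of t] H[of s] that s by auto
  show "\<bar>lampZ T b \<sigma> s y (shift x h \<epsilon>) q t - Z t - \<epsilon> * U t\<bar> \<le> response_error K T (2 * H) * \<epsilon>\<^sup>2"
    unfolding response_error_def
    using s by (intro volterra_linearisation[OF Z_solves Z' U_solves H' _ t]) auto
  have "\<bar>lampZ T b \<sigma> s y (shift x h \<epsilon>) q t - Z t\<bar> \<le> 2 * (\<bar>\<epsilon>\<bar> * (2 * H)) * exp (2 * K * (t - s))"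
    using H' by (intro volterra_stability[OF Z_solves Z' _ t]) (auto simp: abs_mult intro!: mult_left_mono)
  also have "\<dots> \<le> 2 * (\<bar>\<epsilon>\<bar> * (2 * H)) * exp (2 * K * T)"
    using H'[OF t] s t K by (intro mult_left_mono) auto
  finally show "\<bar>lampZ T b \<sigma> s y (shift x h \<epsilon>) q t - Z t\<bar> \<le> (4 * H * exp (2 * K * T)) * \<bar>\<epsilon>\<bar>"
    by (simp add: mult_ac)
qed

text \<open>Taylor expansion of \<open>G\<close> at \<open>Z t\<close>: the first summand of the
  constant is its remainder, through the size of the displacement of \<open>Z\<close>; the second is
  the linearisation error of \<open>Z\<close>, multiplied by the derivative of
  \<open>G\<close>.\<close>

lemma flow_response:
  assumes H: "\<And>t. t \<in> {0..T} \<Longrightarrow> \<bar>h t\<bar> \<le> H" and t: "t \<in> {s..T}"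
  shows "\<bar>flow T b \<sigma> s t (shift x h \<epsilon>) q y - flow T b \<sigma> s t x q y - \<epsilon> * (\<sigma> (G (Z t)) * U t)\<bar>
    \<le> (B * (4 * H * exp (2 * K * T))\<^sup>2 + B * response_error K T (2 * H)) * \<epsilon>\<^sup>2"
proof -
  let ?Z' = "lampZ T b \<sigma> s y (shift x h \<epsilon>) q t"
  have "\<bar>?Z' - Z t\<bar>\<^sup>2 \<le> ((4 * H * exp (2 * K * T)) * \<bar>\<epsilon>\<bar>)\<^sup>2"
    by (intro power_mono Z_response(2)[OF H t]) auto
  then have "B * (?Z' - Z t)\<^sup>2 \<le> B * ((4 * H * exp (2 * K * T))\<^sup>2 * \<epsilon>\<^sup>2)"
    using coeff_bounds(9) by (simp add: power_mult_distrib)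
  moreover have "\<bar>G ?Z' - G (Z t) - \<sigma> (G (Z t)) * (?Z' - Z t)\<bar> \<le> B * (?Z' - Z t)\<^sup>2"
    by (rule G_remainder)
  moreover have "\<bar>\<sigma> (G (Z t)) * (?Z' - Z t - \<epsilon> * U t)\<bar> \<le> B * (response_error K T (2 * H) * \<epsilon>\<^sup>2)"
    by (intro abs_mult_le coeff_bounds Z_response(1)[OF H t]) auto
  moreover have "G ?Z' - G (Z t) - \<epsilon> * (\<sigma> (G (Z t)) * U t)
      = (G ?Z' - G (Z t) - \<sigma> (G (Z t)) * (?Z' - Z t)) + \<sigma> (G (Z t)) * (?Z' - Z t - \<epsilon> * U t)"
    by (simp add: algebra_simps)
  ultimately have "\<bar>G ?Z' - G (Z t) - \<epsilon> * (\<sigma> (G (Z t)) * U t)\<bar>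
      \<le> B * ((4 * H * exp (2 * K * T))\<^sup>2 * \<epsilon>\<^sup>2) + B * (response_error K T (2 * H) * \<epsilon>\<^sup>2)"
    by linarith
  then show ?thesis unfolding flow_def Z_def by (simp add: algebra_simps)
qed

text \<open>By the flow property \<open>Z\<close> is also the solution started at time \<open>r\<close> from \<open>Y\<^sub>r = G (Z\<^sub>r)\<close>.\<close>
lemma kernel_eq:
  assumes r: "r \<in> {s..T}" and t: "t \<in> {r..T}"
  shows "\<sigma> (G (Z r)) * deriv (\<lambda>\<xi>. flow T b \<sigma> r t x q \<xi>) (G (Z r)) = \<sigma> (G (Z t)) * (E t / E r)"
proof -
  let ?Y = "lampZ T b \<sigma> r (G (Z r)) x q"
  have r0: "r \<in> {0..T}" using r s by auto
  have "volterra f r T (\<lambda>t. Z r + (F y + x t - x s) - (F y + x r - x s)) Z"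
    by (rule volterra_restart[OF Z_solves r])
  then have Z: "volterra f r T (\<lambda>t. F (G (Z r)) + x t - x r) Z" by (simp add: add_diff_eq)
  have YZ: "?Y u = Z u" if "u \<in> {r..T}" for u
    using volterra_unique[OF Z lampZ_solves[OF r0 x] that] .
  have "volterra (\<lambda>v u. \<alpha> v * u) r T (\<lambda>_. 1) (\<lambda>t. E t / E r)"
    unfolding E_def by (rule volterra_propagator_restart[OF \<alpha>_props sT r])
  moreover have "\<alpha> v = f' v (?Y v)" if "v \<in> {r<..T}" for v
    using that r YZ[of v] by (simp add: \<alpha>_eq)
  ultimately have "volterra (\<lambda>v u. f' v (?Y v) * u) r T (\<lambda>_. 1) (\<lambda>t. E t / E r)"
    by (subst volterra_cong[where f' = "\<lambda>v u. \<alpha> v * u" and g' = "\<lambda>_. 1"]) auto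
  from flow_has_derivative[OF r0 x t this]
  have "deriv (\<lambda>\<xi>. flow T b \<sigma> r t x q \<xi>) (G (Z r)) = \<sigma> (G (Z t)) * (1 / \<sigma> (G (Z r)) * (E t / E r))"
    using YZ[OF t] by (simp add: DERIV_imp_deriv)
  \<comment> \<open>The factor \<sigma> in the kernel cancels the derivative of \<open>F\<close> at
    the starting point.\<close>
  then show ?thesis using \<sigma>_nonzero[of "G (Z r)"] by simp
qed

lemma U_eq_integral:
  "\<sigma> (G (Z t)) * U t = bv_integral T h {s<..t} (\<lambda>r. \<sigma> (G (Z t)) * (E t / E r))"
  unfolding bv_integral_def U_def set_integral_mult_right by (simp add: right_diff_distrib)

section \<open>The raw flow: the clock is the bracket of the path\<close>

context
  assumes \<Lambda>_pos: "0 < \<Lambda>" and q: "q = bracket T \<Lambda> x"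
begin

lemma raw_Z_eq: "raw_Z T \<Lambda> b \<sigma> s t x y = Z t"
  unfolding raw_Z_def q[symmetric] Z_def ..

lemma raw_flow_eq: "raw_flow T \<Lambda> b \<sigma> r t x z = flow T b \<sigma> r t x q z"
  unfolding raw_flow_def q[symmetric] ..

lemma flow_Z: "flow T b \<sigma> s t x q y = G (Z t)"
  unfolding flow_def Z_def ..

lemma lampZ_shift:
  "lampZ T b \<sigma> s y (shift x h \<epsilon>) (bracket T \<Lambda> (shift x h \<epsilon>)) = lampZ T b \<sigma> s y (shift x h \<epsilon>) q"
  unfolding q using bracket_shift[OF T \<Lambda>_pos x h] T
  by (intro lampZ_cong stieltjes_measure_cong) auto

lemma linearised_solution_iff:
  "linearised_solution T \<Lambda> b \<sigma> h s x y V \<longleftrightarrow>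
    volterra (\<lambda>r u. f' r (Z r) * u) s T (\<lambda>t. h t - h s) V"
proof -
  have "(LBINT r=s..t. deriv (b_hat b \<sigma>) (Z r) * V r)
      + (LINT r:{s<..t}|stieltjes_measure T q. deriv (c_hat \<sigma>) (Z r) * V r)
      = (LBINT r:{s<..t}. f' r (Z r) * V r)" if "continuous_on {s..T} V" "t \<in> {s..T}" for t
  proof -
    have c: "continuous_on {s..t} V" "continuous_on {s..t} Z"
      using that by (auto intro: continuous_on_subset[OF that(1)] continuous_on_subset[OF Z_continuous])
    have "(LBINT r=s..t. b_hat1 (Z r) * V r)
      + (LINT r:{s<..t}|stieltjes_measure T q. c_hat1 (Z r) * V r)
      = (LBINT r:{s<..t}. b_hat1 (Z r) * V r + \<rho> r * (c_hat1 (Z r) * V r))"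
      using that c
      by (intro integral_clock continuous_on_mult continuous_on_compose2[OF continuous_coeffs(3)[of UNIV]]
          continuous_on_compose2[OF continuous_coeffs(4)[of UNIV]]) auto
    then show ?thesis
      using DERIV_imp_deriv[OF b_hat_deriv] DERIV_imp_deriv[OF c_hat_deriv]
      by (simp add: f'_def distrib_right mult.assoc)
  qed
  then show ?thesis
    unfolding linearised_solution_def volterra_def raw_Z_eq q[symmetric] by (auto simp: add.assoc)
qed

lemma bounded_h: obtains H where "\<And>t. t \<in> {0..T} \<Longrightarrow> \<bar>h t\<bar> \<le> H"
  using continuous_on_Icc_bounded[of 0 T h] h by (auto simp: bv_paths_def paths_def)

lemma raw_Z_has_derivative:
  assumes t: "t \<in> {s..T}"
  shows "((\<lambda>\<epsilon>. raw_Z T \<Lambda> b \<sigma> s t (shift x h \<epsilon>) y) has_real_derivative U t) (at 0)"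
proof -
  obtain H where H: "\<And>t. t \<in> {0..T} \<Longrightarrow> \<bar>h t\<bar> \<le> H" by (rule bounded_h) blast
  have "((\<lambda>\<epsilon>. raw_Z T \<Lambda> b \<sigma> s t (shift x h \<epsilon>) y) has_real_derivative 1 * U t) (at 0)"
  proof (rule has_derivative_of_quadratic_error[where F = "\<lambda>\<epsilon>. \<epsilon>"])
    show "\<bar>raw_Z T \<Lambda> b \<sigma> s t (shift x h \<epsilon>) y - raw_Z T \<Lambda> b \<sigma> s t (shift x h 0) y - (\<epsilon> - 0) * U t\<bar>
        \<le> response_error K T (2 * H) * (\<epsilon> - 0)\<^sup>2" for \<epsilon>
      using Z_response(1)[OF H t] by (simp add: raw_Z_eq shift_0) (simp add: raw_Z_def lampZ_shift)
  qed auto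
  then show ?thesis by simp
qed

lemma D_Z_eq: "t \<in> {s..T} \<Longrightarrow> D_Z T \<Lambda> b \<sigma> h s t x y = U t"
  unfolding D_Z_def by (rule DERIV_imp_deriv[OF raw_Z_has_derivative])

lemma raw_flow_response:
  assumes H: "\<And>t. t \<in> {0..T} \<Longrightarrow> \<bar>h t\<bar> \<le> H" and t: "t \<in> {s..T}"
  shows "\<bar>raw_flow T \<Lambda> b \<sigma> s t (shift x h \<epsilon>) y - raw_flow T \<Lambda> b \<sigma> s t x y - \<epsilon> * (\<sigma> (G (Z t)) * U t)\<bar>
    \<le> (B * (4 * H * exp (2 * K * T))\<^sup>2 + B * response_error K T (2 * H)) * \<epsilon>\<^sup>2"
  using flow_response[OF H t, of \<epsilon>] unfolding raw_flow_eq by (simp add: raw_flow_def flow_def lampZ_shift)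

lemma raw_flow_has_derivative:
  assumes t: "t \<in> {s..T}"
  shows "((\<lambda>\<epsilon>. raw_flow T \<Lambda> b \<sigma> s t (shift x h \<epsilon>) y) has_real_derivative \<sigma> (G (Z t)) * U t) (at 0)"
proof -
  obtain H where H: "\<And>t. t \<in> {0..T} \<Longrightarrow> \<bar>h t\<bar> \<le> H" by (rule bounded_h) blast
  have "((\<lambda>\<epsilon>. raw_flow T \<Lambda> b \<sigma> s t (shift x h \<epsilon>) y) has_real_derivative 1 * (\<sigma> (G (Z t)) * U t)) (at 0)"
  proof (rule has_derivative_of_quadratic_error[where F = "\<lambda>\<epsilon>. \<epsilon>"])
    show "\<bar>raw_flow T \<Lambda> b \<sigma> s t (shift x h \<epsilon>) y - raw_flow T \<Lambda> b \<sigma> s t (shift x h 0) y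
        - (\<epsilon> - 0) * (\<sigma> (G (Z t)) * U t)\<bar>
        \<le> (B * (4 * H * exp (2 * K * T))\<^sup>2 + B * response_error K T (2 * H)) * (\<epsilon> - 0)\<^sup>2" for \<epsilon>
      using raw_flow_response[OF H t] by (simp add: shift_0)
  qed auto
  then show ?thesis by simp
qed

lemma D_S_eq: "t \<in> {s..T} \<Longrightarrow> D_S T \<Lambda> b \<sigma> h s t x y = \<sigma> (G (Z t)) * U t"
  unfolding D_S_def by (rule DERIV_imp_deriv[OF raw_flow_has_derivative])

lemma response_kernel_eq:
  "r \<in> {s..T} \<Longrightarrow> t \<in> {r..T} \<Longrightarrow>
    response_kernel T \<Lambda> b \<sigma> s t r x y = \<sigma> (G (Z t)) * (E t / E r)"
  unfolding response_kernel_def raw_flow_eq flow_Z by (rule kernel_eq)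

text \<open>On \<open>{s<..t}\<close> the kernel equals a function continuous on
  \<open>{s..t}\<close>, hence is integrable against both Jordan measures.\<close>

lemma D_S_eq_integral:
  assumes t: "t \<in> {s..T}"
  shows "bv_integrable_on T h {s<..t} (\<lambda>r. response_kernel T \<Lambda> b \<sigma> s t r x y)"
    and "D_S T \<Lambda> b \<sigma> h s t x y = bv_integral T h {s<..t} (\<lambda>r. response_kernel T \<Lambda> b \<sigma> s t r x y)"
proof -
  have eq: "response_kernel T \<Lambda> b \<sigma> s t r x y = \<sigma> (G (Z t)) * (E t / E r)" if "r \<in> {s<..t}" for r
    using that t by (intro response_kernel_eq) auto
  have "continuous_on {s..t} (\<lambda>r. \<sigma> (G (Z t)) * (E t / E r))"
    using t by (intro continuous_on_mult continuous_on_const continuous_on_subset[OF E_ratio_continuous]) auto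
  then have "bv_integrable_on T h {s<..t} (\<lambda>r. \<sigma> (G (Z t)) * (E t / E r))"
    using s t T by (intro bv_integrable_on_continuous_on h) auto
  then show "bv_integrable_on T h {s<..t} (\<lambda>r. response_kernel T \<Lambda> b \<sigma> s t r x y)"
    unfolding bv_integrable_on_def
    by (subst (1 2) set_integrable_cong[where f' = "\<lambda>r. \<sigma> (G (Z t)) * (E t / E r)"]) (auto simp: eq)
  have "bv_integral T h {s<..t} (\<lambda>r. response_kernel T \<Lambda> b \<sigma> s t r x y)
      = bv_integral T h {s<..t} (\<lambda>r. \<sigma> (G (Z t)) * (E t / E r))"
    unfolding bv_integral_def by (intro arg_cong2[where f = minus] set_lebesgue_integral_cong ballI allI impI eq) auto
  then show "D_S T \<Lambda> b \<sigma> h s t x y = bv_integral T h {s<..t} (\<lambda>r. response_kernel T \<Lambda> b \<sigma> s t r x y)"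
    using D_S_eq[OF t] U_eq_integral by simp
qed

end

end

end

subsection \<open>The coefficient hypotheses\<close>

lemma Cb_has_derivative:
  assumes "f \<in> Cb k" "j < k"
  shows "((deriv ^^ j) f has_real_derivative (deriv ^^ Suc j) f y) (at y)"
  using assms by (auto simp: Cb_def DERIV_deriv_iff_field_differentiable)

lemma Cb_abs_le:
  assumes f: "f \<in> Cb k" and j: "j \<le> k"
  shows "\<bar>(deriv ^^ j) f y\<bar> \<le> Cb_norm k f"
proof -
  have le: "\<bar>(deriv ^^ i) f y\<bar> \<le> (SUP y. \<bar>(deriv ^^ i) f y\<bar>)" if "i \<le> k" for i y
  proof (rule cSUP_upper)
    have "bounded (range ((deriv ^^ i) f))" using f that unfolding Cb_def by blast
    then obtain c where "\<And>y. \<bar>(deriv ^^ i) f y\<bar> \<le> c" by (auto simp: bounded_iff)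
    then show "bdd_above (range (\<lambda>y. \<bar>(deriv ^^ i) f y\<bar>))" by (rule bdd_aboveI2)
  qed simp
  have "(SUP y. \<bar>(deriv ^^ j) f y\<bar>) \<le> Cb_norm k f"
    unfolding Cb_norm_def
    using j order_trans[OF abs_ge_zero le] by (intro member_le_sum) auto
  then show ?thesis using le[OF j, of y] by linarith
qed

lemma coefficient_hypotheses_lamperti:
  assumes coeff: "coefficient_hypotheses \<Theta> b \<sigma> L \<sigma>min \<sigma>max" and \<theta>: "\<theta> \<in> \<Theta>"
  shows "lamperti (b \<theta>) ((deriv ^^ 1) (b \<theta>)) ((deriv ^^ 2) (b \<theta>))
    (\<sigma> \<theta>) ((deriv ^^ 1) (\<sigma> \<theta>)) ((deriv ^^ 2) (\<sigma> \<theta>)) ((deriv ^^ 3) (\<sigma> \<theta>)) L \<sigma>min \<sigma>max"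
proof -
  have b: "b \<theta> \<in> Cb 2" and s: "\<sigma> \<theta> \<in> Cb 3"
    and L: "Cb_norm 2 (b \<theta>) + Cb_norm 3 (\<sigma> \<theta>) \<le> L"
    and bounds: "0 < \<sigma>min" "\<And>y. \<sigma>min \<le> \<sigma> \<theta> y" "\<And>y. \<sigma> \<theta> y \<le> \<sigma>max"
    using coeff \<theta> unfolding coefficient_hypotheses_def Cb_continuous_on_def by auto
  \<comment> \<open>The second instance of \<open>Cb_abs_le\<close> only shows that the norm of the
    other coefficient is nonnegative, so \<open>L\<close> bounds each norm separately.\<close>
  have b_le: "\<bar>(deriv ^^ j) (b \<theta>) y\<bar> \<le> L" if "j \<le> 2" for j y
    using Cb_abs_le[OF b that, of y] Cb_abs_le[OF s, of 0 0] L by linarith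
  have s_le: "\<bar>(deriv ^^ j) (\<sigma> \<theta>) y\<bar> \<le> L" if "j \<le> 3" for j y
    using Cb_abs_le[OF s that, of y] Cb_abs_le[OF b, of 0 0] L by linarith
  show ?thesis
    using Cb_has_derivative[OF b, of 0] Cb_has_derivative[OF b, of 1]
      Cb_has_derivative[OF s, of 0] Cb_has_derivative[OF s, of 1] Cb_has_derivative[OF s, of 2]
      b_le[of 0] b_le[of 1] b_le[of 2] s_le[of 1] s_le[of 2] s_le[of 3] bounds
    by unfold_locales (simp_all add: numeral_2_eq_2 numeral_3_eq_3)
qed

lemma driven_bracket:
  assumes "T > 0" "\<Lambda> > 0" "coefficient_hypotheses \<Theta> b \<sigma> L \<sigma>min \<sigma>max" "\<theta> \<in> \<Theta>"
  obtains \<rho> where "driven (b \<theta>) ((deriv ^^ 1) (b \<theta>)) ((deriv ^^ 2) (b \<theta>))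
    (\<sigma> \<theta>) ((deriv ^^ 1) (\<sigma> \<theta>)) ((deriv ^^ 2) (\<sigma> \<theta>)) ((deriv ^^ 3) (\<sigma> \<theta>)) L \<sigma>min \<sigma>max
    T \<Lambda> (bracket T \<Lambda> x) \<rho>"
proof -
  obtain \<rho> where "\<rho> \<in> borel_measurable borel" "\<And>r. 0 \<le> \<rho> r" "\<And>r. \<rho> r \<le> \<Lambda>"
    "stieltjes_measure T (bracket T \<Lambda> x) = density lborel (\<lambda>r. ennreal (\<rho> r))"
    using clock_density[OF _ _ bracket_in_clocks[OF assms(1,2), of x]] assms(1,2) by auto
  then show ?thesis
    using assms(1,2)
    by (intro that[of \<rho>] driven.intro driven_axioms.intro coefficient_hypotheses_lamperti[OF assms(3,4)]) auto
qed

subsection \<open>Directional derivatives and the response kernel\<close>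

context
  fixes T \<Lambda> L \<sigma>min \<sigma>max C :: real
    and \<Theta> :: "(real ^ 'd) set"
    and b \<sigma> :: "real ^ 'd \<Rightarrow> real \<Rightarrow> real"
  assumes T_pos: "T > 0" and \<Lambda>_pos: "\<Lambda> > 0"
    and coeff: "coefficient_hypotheses \<Theta> b \<sigma> L \<sigma>min \<sigma>max"
    and bound: "flow_derivative_bound T \<Lambda> \<Theta> b \<sigma> C"
begin

lemma response_kernel_bound:
  assumes x: "x \<in> paths T" and \<theta>: "\<theta> \<in> \<Theta>" and "0 \<le> s" "s \<le> r" "r \<le> t" "t \<le> T"
  shows "\<bar>response_kernel T \<Lambda> (b \<theta>) (\<sigma> \<theta>) s t r x y\<bar> \<le> \<sigma>max * C"
proof -
  let ?Y = "raw_flow T \<Lambda> (b \<theta>) (\<sigma> \<theta>) s r x y"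
  let ?d = "deriv (\<lambda>\<xi>. raw_flow T \<Lambda> (b \<theta>) (\<sigma> \<theta>) r t x \<xi>) ?Y"
  have "0 \<le> r" using assms by linarith
  then have "0 < deriv (flow T (b \<theta>) (\<sigma> \<theta>) r t x (bracket T \<Lambda> x)) ?Y \<and>
      deriv (flow T (b \<theta>) (\<sigma> \<theta>) r t x (bracket T \<Lambda> x)) ?Y \<le> C"
    using bound x \<theta> assms bracket_in_clocks[OF T_pos \<Lambda>_pos, of x] unfolding flow_derivative_bound_def by blast
  then have d: "0 < ?d" "?d \<le> C" unfolding raw_flow_def by auto
  have "\<bar>\<sigma> \<theta> ?Y\<bar> \<le> \<sigma>max"
    using coeff \<theta> unfolding coefficient_hypotheses_def
    by (smt (verit, best))
  then show ?thesis
    unfolding response_kernel_def using d by (intro abs_mult_le) auto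
qed

text \<open>The difference quotient is within \<open>M * \<bar>\<epsilon>\<bar>\<close> of the
  derivative at every parameter, so the convergence is uniform on the whole domain and
  \<open>UNIV\<close> serves as neighbourhood.\<close>

lemma locally_uniform_derivative:
  assumes x: "x \<in> paths T" and h: "h \<in> bv_paths T"
  shows "locally_uniform_limit (parameter_domain T \<Theta>)
    (\<lambda>\<epsilon> (\<theta>, s, t, y). (raw_flow T \<Lambda> (b \<theta>) (\<sigma> \<theta>) s t (shift x h \<epsilon>) y
      - raw_flow T \<Lambda> (b \<theta>) (\<sigma> \<theta>) s t x y) / \<epsilon>)
    (\<lambda>(\<theta>, s, t, y). D_S T \<Lambda> (b \<theta>) (\<sigma> \<theta>) h s t x y) (at 0)"
proof -
  have xc: "continuous_on {0..T} x" using x by (simp add: paths_def)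
  obtain H where H: "\<And>t. t \<in> {0..T} \<Longrightarrow> \<bar>h t\<bar> \<le> H"
    using continuous_on_Icc_bounded[of 0 T h] h by (auto simp: bv_paths_def paths_def)
  \<comment> \<open>The constant of \<open>raw_flow_response\<close>, written out here because it
    must be fixed before \<theta> and the interpretation of \<open>driven\<close> are
    chosen.\<close>
  define M where "M = (let B = coeff_bound L \<sigma>min \<sigma>max; K = B + \<Lambda> * B in
    B * (4 * H * exp (2 * K * T))\<^sup>2 + B * response_error K T (2 * H))"
  have err: "\<bar>(raw_flow T \<Lambda> (b \<theta>) (\<sigma> \<theta>) s t (shift x h \<epsilon>) y - raw_flow T \<Lambda> (b \<theta>) (\<sigma> \<theta>) s t x y) / \<epsilon>
      - D_S T \<Lambda> (b \<theta>) (\<sigma> \<theta>) h s t x y\<bar> \<le> M * \<bar>\<epsilon>\<bar>"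
    if p: "(\<theta>, s, t, y) \<in> parameter_domain T \<Theta>" and "\<epsilon> \<noteq> 0" for \<theta> s t y \<epsilon>
  proof -
    have \<theta>: "\<theta> \<in> \<Theta>" and s: "s \<in> {0..T}" and t: "t \<in> {s..T}"
      using p by (auto simp: parameter_domain_def)
    obtain \<rho> where "driven (b \<theta>) ((deriv ^^ 1) (b \<theta>)) ((deriv ^^ 2) (b \<theta>))
      (\<sigma> \<theta>) ((deriv ^^ 1) (\<sigma> \<theta>)) ((deriv ^^ 2) (\<sigma> \<theta>)) ((deriv ^^ 3) (\<sigma> \<theta>)) L \<sigma>min \<sigma>max
      T \<Lambda> (bracket T \<Lambda> x) \<rho>"
      using driven_bracket[OF T_pos \<Lambda>_pos coeff \<theta>] by blast
    then interpret driven "b \<theta>" "(deriv ^^ 1) (b \<theta>)" "(deriv ^^ 2) (b \<theta>)"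
      "\<sigma> \<theta>" "(deriv ^^ 1) (\<sigma> \<theta>)" "(deriv ^^ 2) (\<sigma> \<theta>)" "(deriv ^^ 3) (\<sigma> \<theta>)" L \<sigma>min \<sigma>max
      T \<Lambda> "bracket T \<Lambda> x" \<rho> .
    let ?\<Delta> = "raw_flow T \<Lambda> (b \<theta>) (\<sigma> \<theta>) s t (shift x h \<epsilon>) y - raw_flow T \<Lambda> (b \<theta>) (\<sigma> \<theta>) s t x y"
    let ?D = "D_S T \<Lambda> (b \<theta>) (\<sigma> \<theta>) h s t x y"
    have "\<bar>?\<Delta> - \<epsilon> * ?D\<bar> \<le> M * \<epsilon>\<^sup>2"
      using raw_flow_response[OF xc h s \<Lambda>_pos refl H t] D_S_eq[OF xc h s \<Lambda>_pos refl t] by (simp add: M_def Let_def)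
    moreover have "?\<Delta> - \<epsilon> * ?D = (?\<Delta> / \<epsilon> - ?D) * \<epsilon>"
      using \<open>\<epsilon> \<noteq> 0\<close> by (simp add: field_simps)
    moreover have "M * \<epsilon>\<^sup>2 = M * \<bar>\<epsilon>\<bar> * \<bar>\<epsilon>\<bar>"
      by (simp add: power2_eq_square)
    ultimately have "\<bar>?\<Delta> / \<epsilon> - ?D\<bar> * \<bar>\<epsilon>\<bar> \<le> M * \<bar>\<epsilon>\<bar> * \<bar>\<epsilon>\<bar>"
      by (metis abs_mult)
    then show ?thesis using \<open>\<epsilon> \<noteq> 0\<close> by (simp add: mult_le_cancel_right)
  qed
  have lim: "((\<lambda>\<epsilon>. M * \<bar>\<epsilon>\<bar>) \<longlongrightarrow> 0) (at 0)"
    by (rule tendsto_eq_intros | simp)+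
  have "uniform_limit (UNIV \<inter> parameter_domain T \<Theta>)
    (\<lambda>\<epsilon> (\<theta>, s, t, y). (raw_flow T \<Lambda> (b \<theta>) (\<sigma> \<theta>) s t (shift x h \<epsilon>) y
      - raw_flow T \<Lambda> (b \<theta>) (\<sigma> \<theta>) s t x y) / \<epsilon>)
    (\<lambda>(\<theta>, s, t, y). D_S T \<Lambda> (b \<theta>) (\<sigma> \<theta>) h s t x y) (at 0)"
  proof (rule uniform_limitI)
    fix e :: real assume "e > 0"
    have "\<forall>\<^sub>F \<epsilon> in at 0. M * \<bar>\<epsilon>\<bar> < e"
      using order_tendstoD(2)[OF lim \<open>e > 0\<close>] .
    moreover have "\<forall>\<^sub>F \<epsilon> in at (0::real). \<epsilon> \<noteq> 0"
      by (simp add: eventually_at_filter)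
    ultimately show "\<forall>\<^sub>F \<epsilon> in at 0. \<forall>p\<in>UNIV \<inter> parameter_domain T \<Theta>.
        dist ((case p of (\<theta>, s, t, y) \<Rightarrow> (raw_flow T \<Lambda> (b \<theta>) (\<sigma> \<theta>) s t (shift x h \<epsilon>) y
          - raw_flow T \<Lambda> (b \<theta>) (\<sigma> \<theta>) s t x y) / \<epsilon>))
        (case p of (\<theta>, s, t, y) \<Rightarrow> D_S T \<Lambda> (b \<theta>) (\<sigma> \<theta>) h s t x y) < e"
    proof eventually_elim
      case (elim \<epsilon>)
      then show ?case
        by (auto simp: dist_real_def intro!: le_less_trans[OF err elim(1)])
    qed
  qed
  then show ?thesis
    unfolding locally_uniform_limit_def by (intro ballI exI[of _ UNIV]) auto
qed

lemma directional_derivative: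
  assumes x: "x \<in> paths T" and h: "h \<in> bv_paths T" and \<theta>: "\<theta> \<in> \<Theta>" and s: "s \<in> {0..T}"
  shows
    "linearised_solution T \<Lambda> (b \<theta>) (\<sigma> \<theta>) h s x y (\<lambda>t. D_Z T \<Lambda> (b \<theta>) (\<sigma> \<theta>) h s t x y)"
    "\<And>U t. linearised_solution T \<Lambda> (b \<theta>) (\<sigma> \<theta>) h s x y U \<Longrightarrow> t \<in> {s..T} \<Longrightarrow>
      U t = D_Z T \<Lambda> (b \<theta>) (\<sigma> \<theta>) h s t x y"
    "\<And>t. t \<in> {s..T} \<Longrightarrow>
      (\<lambda>\<epsilon>. raw_Z T \<Lambda> (b \<theta>) (\<sigma> \<theta>) s t (shift x h \<epsilon>) y) field_differentiable at 0"
    "\<And>t. t \<in> {s..T} \<Longrightarrow>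
      (\<lambda>\<epsilon>. raw_flow T \<Lambda> (b \<theta>) (\<sigma> \<theta>) s t (shift x h \<epsilon>) y) field_differentiable at 0"
    "\<And>t. t \<in> {s..T} \<Longrightarrow> D_S T \<Lambda> (b \<theta>) (\<sigma> \<theta>) h s t x y =
      deriv (lampG (\<sigma> \<theta>)) (raw_Z T \<Lambda> (b \<theta>) (\<sigma> \<theta>) s t x y) * D_Z T \<Lambda> (b \<theta>) (\<sigma> \<theta>) h s t x y"
    "\<And>t. t \<in> {s..T} \<Longrightarrow>
      bv_integrable_on T h {s<..t} (\<lambda>r. response_kernel T \<Lambda> (b \<theta>) (\<sigma> \<theta>) s t r x y)"
    "\<And>t. t \<in> {s..T} \<Longrightarrow> D_S T \<Lambda> (b \<theta>) (\<sigma> \<theta>) h s t x y =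
      bv_integral T h {s<..t} (\<lambda>r. response_kernel T \<Lambda> (b \<theta>) (\<sigma> \<theta>) s t r x y)"
proof -
  have xc: "continuous_on {0..T} x" using x by (simp add: paths_def)
  obtain \<rho> where "driven (b \<theta>) ((deriv ^^ 1) (b \<theta>)) ((deriv ^^ 2) (b \<theta>))
    (\<sigma> \<theta>) ((deriv ^^ 1) (\<sigma> \<theta>)) ((deriv ^^ 2) (\<sigma> \<theta>)) ((deriv ^^ 3) (\<sigma> \<theta>)) L \<sigma>min \<sigma>max
    T \<Lambda> (bracket T \<Lambda> x) \<rho>"
    using driven_bracket[OF T_pos \<Lambda>_pos coeff \<theta>] by blast
  then interpret driven "b \<theta>" "(deriv ^^ 1) (b \<theta>)" "(deriv ^^ 2) (b \<theta>)"
    "\<sigma> \<theta>" "(deriv ^^ 1) (\<sigma> \<theta>)" "(deriv ^^ 2) (\<sigma> \<theta>)" "(deriv ^^ 3) (\<sigma> \<theta>)" L \<sigma>min \<sigma>max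
    T \<Lambda> "bracket T \<Lambda> x" \<rho> .
  note hyps = xc h s \<Lambda>_pos refl
  note D_Z = D_Z_eq[OF hyps]
  show "linearised_solution T \<Lambda> (b \<theta>) (\<sigma> \<theta>) h s x y (\<lambda>t. D_Z T \<Lambda> (b \<theta>) (\<sigma> \<theta>) h s t x y)"
    unfolding linearised_solution_iff[OF hyps]
    \<comment> \<open>\<open>D_Z\<close> is known to equal \<open>U\<close> on \<open>{s..T}\<close>
      only, which is all the equation sees.\<close>
    by (subst volterra_eq_on[where Z = "U x h s y"], rule D_Z, assumption, rule U_solves[OF xc h s])
  show "U t = D_Z T \<Lambda> (b \<theta>) (\<sigma> \<theta>) h s t x y"
    if "linearised_solution T \<Lambda> (b \<theta>) (\<sigma> \<theta>) h s x y U" "t \<in> {s..T}" for U t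
    unfolding D_Z[OF that(2)]
    by (rule U_unique[OF xc h s that(1)[unfolded linearised_solution_iff[OF hyps]] that(2)])
  fix t assume t: "t \<in> {s..T}"
  show "(\<lambda>\<epsilon>. raw_Z T \<Lambda> (b \<theta>) (\<sigma> \<theta>) s t (shift x h \<epsilon>) y) field_differentiable at 0"
    using raw_Z_has_derivative[OF hyps t] unfolding field_differentiable_def by blast
  show "(\<lambda>\<epsilon>. raw_flow T \<Lambda> (b \<theta>) (\<sigma> \<theta>) s t (shift x h \<epsilon>) y) field_differentiable at 0"
    using raw_flow_has_derivative[OF hyps t] unfolding field_differentiable_def by blast
  show "D_S T \<Lambda> (b \<theta>) (\<sigma> \<theta>) h s t x y =
      deriv (lampG (\<sigma> \<theta>)) (raw_Z T \<Lambda> (b \<theta>) (\<sigma> \<theta>) s t x y) * D_Z T \<Lambda> (b \<theta>) (\<sigma> \<theta>) h s t x y"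
    unfolding D_S_eq[OF hyps t] D_Z[OF t] raw_Z_eq[OF hyps] DERIV_imp_deriv[OF G_deriv] ..
  show "bv_integrable_on T h {s<..t} (\<lambda>r. response_kernel T \<Lambda> (b \<theta>) (\<sigma> \<theta>) s t r x y)"
    "D_S T \<Lambda> (b \<theta>) (\<sigma> \<theta>) h s t x y =
      bv_integral T h {s<..t} (\<lambda>r. response_kernel T \<Lambda> (b \<theta>) (\<sigma> \<theta>) s t r x y)"
    by (rule D_S_eq_integral[OF hyps t])+
qed

lemma D_S_bound:
  assumes x: "x \<in> paths T" and h: "h \<in> bv_paths T" and \<theta>: "\<theta> \<in> \<Theta>"
    and st: "0 \<le> s" "s \<le> t" "t \<le> T"
  shows "\<bar>D_S T \<Lambda> (b \<theta>) (\<sigma> \<theta>) h s t x y\<bar> \<le> \<sigma>max * C * Var h s t"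
proof -
  have s: "s \<in> {0..T}" and t: "t \<in> {s..T}" using st by auto
  show ?thesis
    unfolding directional_derivative(7)[OF x h \<theta> s t]
    using T_pos st by (intro abs_bv_integral_le h directional_derivative(6)[OF x h \<theta> s t]
        response_kernel_bound x \<theta>) auto
qed

end

theorem theorem6p2:
  fixes T \<Lambda> L \<sigma>min \<sigma>max C :: real
    and \<Theta> :: "(real ^ 'd) set"
    and b \<sigma> :: "real ^ 'd \<Rightarrow> real \<Rightarrow> real"
  assumes "T > 0" and "\<Lambda> > 0"
    and "coefficient_hypotheses \<Theta> b \<sigma> L \<sigma>min \<sigma>max"
    and "flow_derivative_bound T \<Lambda> \<Theta> b \<sigma> C"
  shows
    "(\<forall>x\<in>paths T. \<forall>h\<in>bv_paths T.
        (\<forall>(\<theta>, s, t, y)\<in>parameter_domain T \<Theta>.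
           (\<lambda>\<epsilon>. raw_flow T \<Lambda> (b \<theta>) (\<sigma> \<theta>) s t (shift x h \<epsilon>) y) field_differentiable at 0) \<and>
        locally_uniform_limit (parameter_domain T \<Theta>)
          (\<lambda>\<epsilon> (\<theta>, s, t, y).
             (raw_flow T \<Lambda> (b \<theta>) (\<sigma> \<theta>) s t (shift x h \<epsilon>) y
              - raw_flow T \<Lambda> (b \<theta>) (\<sigma> \<theta>) s t x y) / \<epsilon>)
          (\<lambda>(\<theta>, s, t, y). D_S T \<Lambda> (b \<theta>) (\<sigma> \<theta>) h s t x y)
          (at 0)) \<and>
     (\<forall>x\<in>paths T. \<forall>h\<in>bv_paths T. \<forall>\<theta>\<in>\<Theta>. \<forall>s\<in>{0..T}. \<forall>y.
        (\<forall>t\<in>{s..T}.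
           (\<lambda>\<epsilon>. raw_Z T \<Lambda> (b \<theta>) (\<sigma> \<theta>) s t (shift x h \<epsilon>) y) field_differentiable at 0) \<and>
        linearised_solution T \<Lambda> (b \<theta>) (\<sigma> \<theta>) h s x y
          (\<lambda>t. D_Z T \<Lambda> (b \<theta>) (\<sigma> \<theta>) h s t x y) \<and>
        (\<forall>U. linearised_solution T \<Lambda> (b \<theta>) (\<sigma> \<theta>) h s x y U \<longrightarrow>
           (\<forall>t\<in>{s..T}. U t = D_Z T \<Lambda> (b \<theta>) (\<sigma> \<theta>) h s t x y)) \<and>
        (\<forall>t\<in>{s..T}.
           D_S T \<Lambda> (b \<theta>) (\<sigma> \<theta>) h s t x y =
             deriv (lampG (\<sigma> \<theta>)) (raw_Z T \<Lambda> (b \<theta>) (\<sigma> \<theta>) s t x y) *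
             D_Z T \<Lambda> (b \<theta>) (\<sigma> \<theta>) h s t x y) \<and>
        (\<forall>t\<in>{s..T}.
           bv_integrable_on T h {s<..t} (\<lambda>r. response_kernel T \<Lambda> (b \<theta>) (\<sigma> \<theta>) s t r x y) \<and>
           D_S T \<Lambda> (b \<theta>) (\<sigma> \<theta>) h s t x y =
             bv_integral T h {s<..t} (\<lambda>r. response_kernel T \<Lambda> (b \<theta>) (\<sigma> \<theta>) s t r x y))) \<and>
     (SUP (x, \<theta>, y, s, r, t) \<in>
          {(x, \<theta>, y, s, r, t). x \<in> paths T \<and> \<theta> \<in> \<Theta> \<and> 0 \<le> s \<and> s \<le> r \<and> r \<le> t \<and> t \<le> T}.
        ereal \<bar>response_kernel T \<Lambda> (b \<theta>) (\<sigma> \<theta>) s t r x y\<bar>) \<le> ereal (\<sigma>max * C) \<and>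
     (\<forall>x\<in>paths T. \<forall>h\<in>bv_paths T. \<forall>\<theta>\<in>\<Theta>. \<forall>y s t. 0 \<le> s \<and> s \<le> t \<and> t \<le> T \<longrightarrow>
        \<bar>D_S T \<Lambda> (b \<theta>) (\<sigma> \<theta>) h s t x y\<bar> \<le> \<sigma>max * C * Var h s t)"
proof (intro conjI ballI allI impI SUP_least, goal_cases)
  case (1 x h p)
  then show ?case
    by (cases p) (auto simp: parameter_domain_def intro: directional_derivative(4)[OF assms])
next
  case (2 x h)
  then show ?case by (rule locally_uniform_derivative[OF assms])
next
  case (3 x h \<theta> s y t)
  then show ?case by (rule directional_derivative(3)[OF assms])
next
  case (4 x h \<theta> s y)
  then show ?case by (rule directional_derivative(1)[OF assms])
next
  case (5 x h \<theta> s y U t)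
  then show ?case by (intro directional_derivative(2)[OF assms])
next
  case (6 x h \<theta> s y t)
  then show ?case by (rule directional_derivative(5)[OF assms])
next
  case (7 x h \<theta> s y t)
  then show ?case by (rule directional_derivative(6)[OF assms])
next
  case (8 x h \<theta> s y t)
  then show ?case by (rule directional_derivative(7)[OF assms])
next
  case (9 p)
  then show ?case by (auto intro: response_kernel_bound[OF assms])
next
  case (10 x h \<theta> y s t)
  then show ?case by (intro D_S_bound[OF assms]) auto
qed

end
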